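(* Let $N$ be a positive integer, $w=\mathrm{polylog}(N)$, and let $f\colon[N]\to[2^{w}]$ be a function computable in $\tilde{O}(1)$ time. For any choice of a constant $0<\alpha<1$, one can construct in $\tilde{O}(N)$ time with high probability a data structure using $\tilde{O}(N^{1-\alpha/3})$ words of space which supports the following query: given an integer $y\in[2^{w}]$, report $x\in[N]$ such that $f(x)$ is the largest value in $f([N])$ that is smaller than or equal to $y$, if it exists, in $\tilde{O}(N^{\alpha})$ time.
   Context: $[M]$ denotes $\{0,1,\dots,M-1\}$. The notation $\tilde{O}(\cdot)$ omits factors polylogarithmic in $N$. Space is measured in machine words (word RAM model). *)

theory Defs
  imports "HOL-Probability.Probability" "HOL-Library.Landau_Symbols"
begin

unbundle bit_operations_syntax

definition soft_O :: "(nat \<Rightarrow> real) \<Rightarrow> (nat \<Rightarrow> real) set" where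
  "soft_O g = (\<Union>k::nat. O(\<lambda>N. g N * ln (real N) ^ k))"

section \<open>Word RAM\<close>

text \<open>
  A program is a list of instructions; it works on a finite number of registers (those it mentions)
  and on a memory of \<open>2 ^ b\<close> cells, all of them holding words of \<open>b\<close> bits.
  It halts when its program counter leaves the list.
\<close>

datatype binop = Add | Sub | Mul | Div | Mod | And | Or | Xor | ShiftL | ShiftR

fun apply_binop :: "nat \<Rightarrow> binop \<Rightarrow> nat \<Rightarrow> nat \<Rightarrow> nat" where
  "apply_binop b Add u v = (u + v) mod 2 ^ b"
| "apply_binop b Sub u v = (u + 2 ^ b - v) mod 2 ^ b"
| "apply_binop b Mul u v = (u * v) mod 2 ^ b"
| "apply_binop b Div u v = u div v"
| "apply_binop b Mod u v = u mod v"
| "apply_binop b And u v = u AND v"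
| "apply_binop b Or u v = u OR v"
| "apply_binop b Xor u v = u XOR v"
| "apply_binop b ShiftL u v = push_bit v u mod 2 ^ b"
| "apply_binop b ShiftR u v = drop_bit v u"

datatype instr =
    Imm nat nat               \<comment> \<open>\<open>Imm r k\<close>: \<open>r := k\<close>\<close>
  | Arith binop nat nat nat   \<comment> \<open>\<open>Arith op r s t\<close>: \<open>r := s op t\<close>\<close>
  | Load nat nat              \<comment> \<open>\<open>Load r s\<close>: \<open>r := mem[s]\<close>\<close>
  | Store nat nat             \<comment> \<open>\<open>Store r s\<close>: \<open>mem[r] := s\<close>\<close>
  | JumpLess nat nat nat      \<comment> \<open>\<open>JumpLess r s l\<close>: if \<open>r < s\<close> goto \<open>l\<close>\<close>
  | Rand nat                  \<comment> \<open>\<open>Rand r\<close>: \<open>r :=\<close> uniformly random word\<close>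
  | Call nat nat              \<comment> \<open>\<open>Call r s\<close>: \<open>r :=\<close> result of the subroutine on input \<open>s\<close>\<close>

type_synonym program = "instr list"

definition deterministic :: "program \<Rightarrow> bool" where
  "deterministic p \<longleftrightarrow> (\<forall>r. Rand r \<notin> set p)"

record config =
  pc :: nat
  reg :: "nat \<Rightarrow> nat"
  mem :: "nat \<Rightarrow> nat"
  clock :: nat

definition init :: "nat list \<Rightarrow> nat list \<Rightarrow> config" where
  "init xs D =
    \<lparr>pc = 0,
     reg = (\<lambda>i. if i < length xs then xs ! i else 0),
     mem = (\<lambda>a. if a < length D then D ! a else 0),
     clock = 0\<rparr>"

definition halted :: "program \<Rightarrow> config \<Rightarrow> bool" where
  "halted p c \<longleftrightarrow> length p \<le> pc c"

definition set_reg :: "nat \<Rightarrow> nat \<Rightarrow> config \<Rightarrow> config" where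
  "set_reg r v c = c\<lparr>reg := (reg c)(r := v), pc := Suc (pc c), clock := Suc (clock c)\<rparr>"

text \<open>
  A subroutine maps an input word to its result and running time, or to \<open>None\<close> if it diverges,
  and then the caller diverges as well. A call is charged the running time of the subroutine.
  The argument \<open>v\<close> of \<open>exec\<close> is the random word supplied to this step.
\<close>

type_synonym subroutine = "nat \<Rightarrow> (nat \<times> nat) option"

fun exec :: "nat \<Rightarrow> subroutine \<Rightarrow> nat \<Rightarrow> instr \<Rightarrow> config \<Rightarrow> config" where
  "exec b sub v (Imm r k) c = set_reg r (k mod 2 ^ b) c"
| "exec b sub v (Arith op r s t) c = set_reg r (apply_binop b op (reg c s) (reg c t)) c"
| "exec b sub v (Load r s) c = set_reg r (mem c (reg c s)) c"
| "exec b sub v (Store r s) c =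
     c\<lparr>mem := (mem c)(reg c r := reg c s), pc := Suc (pc c), clock := Suc (clock c)\<rparr>"
| "exec b sub v (JumpLess r s l) c =
     c\<lparr>pc := (if reg c r < reg c s then l else Suc (pc c)), clock := Suc (clock c)\<rparr>"
| "exec b sub v (Rand r) c = set_reg r v c"
| "exec b sub v (Call r s) c =
     (case sub (reg c s) of
        None \<Rightarrow> c
      | Some (u, t) \<Rightarrow> (set_reg r u c)\<lparr>clock := Suc (clock c + t)\<rparr>)"

definition step :: "nat \<Rightarrow> subroutine \<Rightarrow> program \<Rightarrow> nat \<Rightarrow> config \<Rightarrow> config" where
  "step b sub p v c = (if halted p c then c else exec b sub v (p ! pc c) c)"

fun rand_run :: "nat \<Rightarrow> subroutine \<Rightarrow> program \<Rightarrow> nat \<Rightarrow> config \<Rightarrow> config pmf" where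
  "rand_run b sub p 0 c = return_pmf c"
| "rand_run b sub p (Suc n) c =
     bind_pmf (pmf_of_set {..<2 ^ b}) (\<lambda>v. rand_run b sub p n (step b sub p v c))"

text \<open>For deterministic programs only, for which the random words supplied are irrelevant.\<close>

definition halts_in :: "nat \<Rightarrow> subroutine \<Rightarrow> program \<Rightarrow> config \<Rightarrow> config \<Rightarrow> bool" where
  "halts_in b sub p c c' \<longleftrightarrow> (\<exists>n. c' = (step b sub p 0 ^^ n) c \<and> halted p c')"

definition no_sub :: subroutine where
  "no_sub x = None"

text \<open>Input and output of a subroutine are in register 0, and it works on a memory of its own.\<close>

definition computes_within ::
    "nat \<Rightarrow> program \<Rightarrow> nat \<Rightarrow> (nat \<Rightarrow> nat) \<Rightarrow> nat \<Rightarrow> bool" where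
  "computes_within b F N f T \<longleftrightarrow>
     deterministic F \<and>
     (\<forall>x<N. \<exists>c. halts_in b no_sub F (init [x] []) c \<and> reg c 0 = f x \<and> clock c \<le> T)"

definition as_sub :: "nat \<Rightarrow> program \<Rightarrow> subroutine" where
  "as_sub b F x =
     (if \<exists>c. halts_in b no_sub F (init [x] []) c
      then let c = (THE c. halts_in b no_sub F (init [x] []) c) in Some (reg c 0, clock c)
      else None)"

section \<open>Predecessor data structures\<close>

text \<open>
  The query finds \<open>y\<close> in register 0 and the data structure \<open>D\<close> in the first cells of an otherwise
  zero memory. It leaves 0 in register 0 if there is no answer, and otherwise 1 in register 0 and the
  answer in register 1.
\<close>

definition answers_pred_within ::
    "nat \<Rightarrow> program \<Rightarrow> program \<Rightarrow> nat list \<Rightarrow> nat \<Rightarrow> (nat \<Rightarrow> nat) \<Rightarrow> nat \<Rightarrow> nat \<Rightarrow> bool" where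
  "answers_pred_within b F query D N f T y \<longleftrightarrow>
     (\<exists>c. halts_in b (as_sub b F) query (init [y] D) c \<and> clock c \<le> T \<and>
       (let V = {v \<in> f ` {..<N}. v \<le> y} in
        if V = {} then reg c 0 = 0
        else reg c 0 = 1 \<and> reg c 1 < N \<and> f (reg c 1) = Max V))"

text \<open>
  On halting, the construction has left the size of the data structure in register 0 and the
  data structure itself in the first cells of its memory.
\<close>

definition output_words :: "config \<Rightarrow> nat list" where
  "output_words c = map (mem c) [0..<reg c 0]"

text \<open>
  A real \<open>\<alpha>\<close> need not be computable, so the construction receives it in the form of the word
  \<open>\<lceil>N powr \<alpha>\<rceil>\<close>.
\<close>

definition construction_input :: "nat \<Rightarrow> nat \<Rightarrow> real \<Rightarrow> nat list" where
  "construction_input N w \<alpha> = [N, w, nat \<lceil>real N powr \<alpha>\<rceil>]"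

text \<open>
  The probability that the construction halts within time \<open>tc\<close> having built a structure of at most
  \<open>s\<close> words that answers every query correctly within time \<open>tq\<close>. As an instruction takes at least
  one unit of time, \<open>tc\<close> steps suffice.
\<close>

definition success_prob ::
    "nat \<Rightarrow> program \<Rightarrow> program \<Rightarrow> program \<Rightarrow> real \<Rightarrow>
     nat \<Rightarrow> nat \<Rightarrow> (nat \<Rightarrow> nat) \<Rightarrow> nat \<Rightarrow> nat \<Rightarrow> nat \<Rightarrow> real" where
  "success_prob b F build query \<alpha> N w f tc s tq =
     measure_pmf.prob
       (rand_run b (as_sub b F) build tc (init (construction_input N w \<alpha>) []))
       {c. halted build c \<and> clock c \<le> tc \<and>
           length (output_words c) \<le> s \<and>
           (\<forall>y<2 ^ w. answers_pred_within b F query (output_words c) N f tq y)}"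

end

(* Let k be the number of bits of N and t = 2^kt about N^(alpha/3). For each level j, a block inverts
   the function x |-> f(x) >> j with constant probability, and polylog(N) independent blocks per level
   invert it at all points with high probability. The predecessor of y is then found by a descent over
   the prefixes of y, since a prefix occurs in f([N]) iff it has a preimage at its level.

   A block follows Fiat and Naor. The values of M = O(N/t) random samples are kept in a hash table, so
   that values with many preimages are likely to be answered directly. The remaining values are hashed
   to [M], and values that the table answers are replaced by a hash of their argument; this gives a map
   F : [2^k] -> [M]. Each of t^2 clusters composes F with its own random table g : [M] -> [2^k] and
   stores the ends of m = 2^k/t^3 chains of length t. A search costs t steps in each of the t^2
   clusters, that is N^alpha up to constants, and the chain ends take O(t^2 m) = O(N/t) words.

   The tables g of the clusters are too large to be stored one by one. They are interleaved
   exclusive-or hash functions over O(log N) tables of M + m random words: within a cluster all entries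
   are independent, and any two clusters are independent of each other. *)
theory Submission
  imports Defs "HOL-Real_Asymp.Real_Asymp"
begin

unbundle bit_operations_syntax

section \<open>A structured language for the word RAM\<close>

text \<open>The obstacle is collisions: chains through a map that collides often merge and cover few
  points. A value with I preimages is met by a random point with probability about I / 2^k, but it
  escapes the hash table with probability O(2^k / (M I)). The factor I cancels, and two random
  points collide under \<open>F\<close> with expected probability O(1 / M). So a chain fails to be
  free of repetitions and to avoid the m - 1 other chains of its cluster with probability O(m t^2 /
  M), a small constant for M = 512 m t^2. As 2^k = t^2 * m * t, the expected number of clusters that
  cover a given point is at most 1 and bounded below, and second moments, that is pairwise
  independence, are enough to make coverage likely.

  The random words are part of the structure, because a query evaluates the same hash functions. One
  set of them serves all levels, since a union bound over the levels tolerates any dependence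
  between them. Hash tables and chain ends depend on the level and are stored for each.\<close>

datatype ex = V nat | C nat | Bin binop ex ex | Ld ex

fun ev :: "nat \<Rightarrow> (nat \<Rightarrow> nat) \<Rightarrow> (nat \<Rightarrow> nat) \<Rightarrow> ex \<Rightarrow> nat" where
  "ev b s m (V r) = s r"
| "ev b s m (C k) = k mod 2 ^ b"
| "ev b s m (Bin op x y) = apply_binop b op (ev b s m x) (ev b s m y)"
| "ev b s m (Ld x) = m (ev b s m x)"

text \<open>Registers from 100 on are reserved for intermediate results.\<close>

fun wfx :: "ex \<Rightarrow> bool" where
  "wfx (V r) \<longleftrightarrow> r < 100"
| "wfx (C k) \<longleftrightarrow> True"
| "wfx (Bin op x y) \<longleftrightarrow> wfx x \<and> wfx y"
| "wfx (Ld x) \<longleftrightarrow> wfx x"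

text \<open>The machine has no move instruction, so a register is copied by taking \<open>Or\<close>
  of it with itself. Evaluation works as on a stack: the result goes to \<open>d\<close>, registers
  above \<open>d\<close> may be overwritten, and those below are kept.\<close>

fun ce :: "nat \<Rightarrow> ex \<Rightarrow> instr list" where
  "ce d (V r) = [Arith Or d r r]"
| "ce d (C k) = [Imm d k]"
| "ce d (Bin op x y) = ce d x @ ce (Suc d) y @ [Arith op d d (Suc d)]"
| "ce d (Ld x) = ce d x @ [Load d d]"

fun esz :: "ex \<Rightarrow> nat" where
  "esz (V r) = 1"
| "esz (C k) = 1"
| "esz (Bin op x y) = esz x + esz y + 1"
| "esz (Ld x) = esz x + 1"

lemma length_ce [simp]: "length (ce d e) = esz e"
  by (induction e arbitrary: d) auto

datatype cmd = Skip | Asg nat ex | Sto ex ex | Cal nat ex | Seq cmd cmd (infixr ";;" 60)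
  | If ex ex cmd cmd | For nat nat nat cmd

text \<open>\<open>If x y c d\<close> branches to \<open>c\<close> if \<open>x < y\<close>. In \<open>For i n L c\<close> the register \<open>i\<close> runs from 0 up to the
  content of register \<open>n\<close>; the static time bound uses the limit number \<open>L\<close> for the number of rounds.\<close>

fun wfc :: "cmd \<Rightarrow> bool" where
  "wfc Skip \<longleftrightarrow> True"
| "wfc (Asg r e) \<longleftrightarrow> r < 100 \<and> wfx e"
| "wfc (Sto x e) \<longleftrightarrow> wfx x \<and> wfx e"
| "wfc (Cal r e) \<longleftrightarrow> r < 100 \<and> wfx e"
| "wfc (Seq c d) \<longleftrightarrow> wfc c \<and> wfc d"
| "wfc (If x y c d) \<longleftrightarrow> wfx x \<and> wfx y \<and> wfc c \<and> wfc d"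
| "wfc (For i n L c) \<longleftrightarrow> i < 100 \<and> n < 100 \<and> i \<noteq> n \<and> wfc c"

fun csz :: "cmd \<Rightarrow> nat" where
  "csz Skip = 0"
| "csz (Asg r e) = esz e + 1"
| "csz (Sto x e) = esz x + esz e + 1"
| "csz (Cal r e) = esz e + 1"
| "csz (Seq c d) = csz c + csz d"
| "csz (If x y c d) = esz x + esz y + 4 + csz c + csz d"
| "csz (For i n L c) = csz c + 7"

text \<open>\<open>p\<close> is the address of the first instruction, since jump targets are
  absolute. An unconditional jump is a comparison of the constants 0 and 1. A loop is entered by a
  jump to the test at its bottom, so it may run zero times.\<close>

fun comp :: "nat \<Rightarrow> cmd \<Rightarrow> instr list" where
  "comp p Skip = []"
| "comp p (Asg r e) = ce 100 e @ [Arith Or r 100 100]"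
| "comp p (Sto x e) = ce 100 x @ ce 101 e @ [Store 100 101]"
| "comp p (Cal r e) = ce 100 e @ [Call r 100]"
| "comp p (Seq c d) = comp p c @ comp (p + csz c) d"
| "comp p (If x y c d) =
    ce 100 x @ ce 101 y @ [JumpLess 100 101 (p + esz x + esz y + 4 + csz d)] @
    comp (p + esz x + esz y + 1) d @
    [Imm 100 0, Imm 101 1, JumpLess 100 101 (p + esz x + esz y + 4 + csz d + csz c)] @
    comp (p + esz x + esz y + 4 + csz d) c"
| "comp p (For i n L c) =
    [Imm i 0, Imm 100 0, Imm 101 1, JumpLess 100 101 (p + 6 + csz c)] @
    comp (p + 4) c @ [Imm 101 1, Arith Add i i 101, JumpLess i n (p + 4)]"

lemma length_comp [simp]: "length (comp p c) = csz c"
  by (induction c arbitrary: p) auto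

lemma Rand_notin_ce: "Rand r \<notin> set (ce d e)"
  by (induction e arbitrary: d) auto

lemma deterministic_comp: "deterministic (comp p c)"
  unfolding deterministic_def
  by (rule allI, induction c arbitrary: p) (auto simp: Rand_notin_ce)

text \<open>A bound independent of the state, to which the asymptotic estimates are applied: both
  branches of a conditional are charged, a call costs up to \<open>\<tau>\<close>, and a loop is
  charged for its full limit \<open>lm L\<close>.\<close>

fun tb :: "nat \<Rightarrow> (nat \<Rightarrow> nat) \<Rightarrow> cmd \<Rightarrow> nat" where
  "tb \<tau> lm Skip = 0"
| "tb \<tau> lm (Asg r e) = esz e + 1"
| "tb \<tau> lm (Sto x e) = esz x + esz e + 1"
| "tb \<tau> lm (Cal r e) = esz e + 1 + \<tau>"
| "tb \<tau> lm (Seq c d) = tb \<tau> lm c + tb \<tau> lm d"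
| "tb \<tau> lm (If x y c d) = esz x + esz y + 4 + tb \<tau> lm c + tb \<tau> lm d"
| "tb \<tau> lm (For i n L c) = 5 + lm L * (tb \<tau> lm c + 3)"

section \<open>Code fragments and runs without random instructions\<close>

definition code :: "program \<Rightarrow> nat \<Rightarrow> instr list \<Rightarrow> bool" where
  "code P p xs \<longleftrightarrow> (\<exists>us vs. P = us @ xs @ vs \<and> length us = p)"

lemma code_append: "code P p (xs @ ys) \<longleftrightarrow> code P p xs \<and> code P (p + length xs) ys"
proof
  assume "code P p (xs @ ys)"
  then obtain us vs where "P = us @ (xs @ ys) @ vs" "length us = p"
    by (auto simp: code_def)
  then show "code P p xs \<and> code P (p + length xs) ys"
    unfolding code_def by (intro conjI exI[of _ us] exI[of _ "ys @ vs"] exI[of _ "us @ xs"] exI[of _ vs]) auto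
next
  assume "code P p xs \<and> code P (p + length xs) ys"
  then have *: "code P p xs" "code P (p + length xs) ys"
    by simp_all
  from *(1) obtain us vs where 1: "P = us @ xs @ vs" "length us = p"
    unfolding code_def by blast
  from *(2) obtain us' vs' where 2: "P = us' @ ys @ vs'" "length us' = p + length xs"
    unfolding code_def by blast
  have "us' = us @ xs"
    using 1 2 by (metis append_assoc append_eq_append_conv length_append)
  then have "P = us @ (xs @ ys) @ vs'"
    using 2 by simp
  then show "code P p (xs @ ys)"
    unfolding code_def using 1 by blast
qed

lemma code_single: "code P p [x] \<longleftrightarrow> p < length P \<and> P ! p = x"
proof
  assume "p < length P \<and> P ! p = x"
  then show "code P p [x]"
    unfolding code_def by (intro exI[of _ "take p P"] exI[of _ "drop (Suc p) P"]) (auto simp: id_take_nth_drop[symmetric])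
qed (auto simp: code_def)

lemma code_Cons: "code P p (x # y # xs) \<longleftrightarrow> p < length P \<and> P ! p = x \<and> code P (Suc p) (y # xs)"
  using code_append[of P p "[x]" "y # xs"] by (simp add: code_single)

text \<open>Each step must advance the clock. This rules out a diverging call, which leaves the
  configuration as it is, and it makes the number of steps at most the elapsed time, so that a time
  bound also bounds the steps given to \<open>rand_run\<close>.\<close>

inductive rch :: "nat \<Rightarrow> subroutine \<Rightarrow> program \<Rightarrow> nat \<Rightarrow> config \<Rightarrow> config \<Rightarrow> bool" for b sub P where
  rch0: "rch b sub P 0 c c"
| rchS: "pc c < length P \<Longrightarrow> (\<And>r. P ! pc c \<noteq> Rand r) \<Longrightarrow> clock c < clock (exec b sub 0 (P ! pc c) c) \<Longrightarrow>
    rch b sub P n (exec b sub 0 (P ! pc c) c) c' \<Longrightarrow> rch b sub P (Suc n) c c'"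

lemma rch_trans: "rch b sub P n c1 c2 \<Longrightarrow> rch b sub P k c2 c3 \<Longrightarrow> rch b sub P (n + k) c1 c3"
  by (induction rule: rch.induct) (auto intro: rchS)

lemma rch_clock: "rch b sub P n c c' \<Longrightarrow> n + clock c \<le> clock c'"
  by (induction rule: rch.induct) auto

lemma exec_not_Rand: "(\<And>r. i \<noteq> Rand r) \<Longrightarrow> exec b sub v i c = exec b sub u i c"
  by (cases i) auto

lemma rch_step: "rch b sub P n c c' \<Longrightarrow> (step b sub P 0 ^^ n) c = c'"
proof (induction rule: rch.induct)
  case (rchS c n c')
  then show ?case
    by (simp add: step_def halted_def funpow_Suc_right del: funpow.simps)
qed simp

text \<open>Without a \<open>Rand\<close> instruction the supplied word has no effect, so drawing it
  yields the same configuration with certainty and the segment can be cut off.\<close>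

lemma rch_rand_run: "rch b sub P n c c' \<Longrightarrow> rand_run b sub P (n + r) c = rand_run b sub P r c'"
proof (induction rule: rch.induct)
  case (rchS c n c')
  have "step b sub P v c = exec b sub 0 (P ! pc c) c" for v
    using rchS(1,2) exec_not_Rand[of "P ! pc c" b sub v c 0] by (simp add: step_def halted_def)
  then show ?case
    using rchS by simp
qed simp

lemma rand_run_halted: "halted P c \<Longrightarrow> rand_run b sub P n c = return_pmf c"
  by (induction n) (auto simp: step_def)

section \<open>Predicate transformer of the structured language and its soundness\<close>

locale ram =
  fixes b :: nat and N :: nat and f :: "nat \<Rightarrow> nat" and sub :: subroutine and \<tau> :: nat and lm :: "nat \<Rightarrow> nat"
  assumes b1: "1 \<le> b" and lm: "\<And>L. lm L < 2 ^ b"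
    and sub: "\<And>x. x < N \<Longrightarrow> \<exists>t\<le>\<tau>. sub x = Some (f x, t)"
begin

lemma b_gt_0: "0 < b"
  using b1 by simp

text \<open>A precondition computed by recursion on the syntax. Instead of a fixed point, a loop
  asks for an invariant \<open>J\<close> indexed by the round, and its body must leave the counter
  and the bound as they were. A call asks for an argument below \<open>N\<close>, where the
  subroutine is known to halt.\<close>

primrec exc :: "cmd \<Rightarrow> (nat \<Rightarrow> nat) \<Rightarrow> (nat \<Rightarrow> nat) \<Rightarrow> ((nat \<Rightarrow> nat) \<Rightarrow> (nat \<Rightarrow> nat) \<Rightarrow> bool) \<Rightarrow> bool" where
  "exc Skip s m Q = Q s m"
| "exc (Asg r e) s m Q = Q (s(r := ev b s m e)) m"
| "exc (Sto x e) s m Q = Q s (m(ev b s m x := ev b s m e))"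
| "exc (Cal r e) s m Q = (ev b s m e < N \<and> Q (s(r := f (ev b s m e))) m)"
| "exc (Seq c d) s m Q = exc c s m (\<lambda>s m. exc d s m Q)"
| "exc (If x y c d) s m Q = (if ev b s m x < ev b s m y then exc c s m Q else exc d s m Q)"
| "exc (For i n L c) s m Q = (s n \<le> lm L \<and> (\<exists>J. J 0 (s(i := 0)) m \<and>
     (\<forall>j s' m'. j < s n \<and> J j s' m' \<and> s' i = j \<and> s' n = s n \<longrightarrow>
        exc c s' m' (\<lambda>s'' m''. s'' i = j \<and> s'' n = s n \<and> J (Suc j) (s''(i := Suc j)) m'')) \<and>
     (\<forall>s' m'. J (s n) s' m' \<and> s' i = s n \<and> s' n = s n \<longrightarrow> Q s' m')))"

declare exc.simps(7) [simp del]

lemma exc_For: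
  assumes "s n \<le> lm L" "J 0 (s(i := 0)) m"
    "\<And>j s' m'. j < s n \<Longrightarrow> J j s' m' \<Longrightarrow> s' i = j \<Longrightarrow> s' n = s n \<Longrightarrow>
      exc c s' m' (\<lambda>s'' m''. s'' i = j \<and> s'' n = s n \<and> J (Suc j) (s''(i := Suc j)) m'')"
    "\<And>s' m'. J (s n) s' m' \<Longrightarrow> s' i = s n \<Longrightarrow> s' n = s n \<Longrightarrow> Q s' m'"
  shows "exc (For i n L c) s m Q"
  unfolding exc.simps(7) using assms by (intro conjI exI[of _ J]) auto

lemma exc_mono: "exc c s m Q \<Longrightarrow> (\<And>s m. Q s m \<Longrightarrow> Q' s m) \<Longrightarrow> exc c s m Q'"
proof (induction c arbitrary: s m Q Q')
  case (Seq c1 c2)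
  show ?case
    unfolding exc.simps
    by (rule Seq.IH(1)[OF Seq.prems(1)[unfolded exc.simps] Seq.IH(2)[OF _ Seq.prems(2)]])
next
  case (If x1 x2 c1 c2)
  then show ?case
    by (simp split: if_splits)
next
  case (For i n L c)
  from For.prems(1) obtain J where J: "s n \<le> lm L" "J 0 (s(i := 0)) m"
    "\<And>j s' m'. j < s n \<Longrightarrow> J j s' m' \<Longrightarrow> s' i = j \<Longrightarrow> s' n = s n \<Longrightarrow>
        exc c s' m' (\<lambda>s'' m''. s'' i = j \<and> s'' n = s n \<and> J (Suc j) (s''(i := Suc j)) m'')"
    "\<And>s' m'. J (s n) s' m' \<Longrightarrow> s' i = s n \<Longrightarrow> s' n = s n \<Longrightarrow> Q s' m'"
    unfolding exc.simps(7) by blast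
  show ?case
    by (rule exc_For[of s n L J i m, OF J(1-3)]) (auto intro: For.prems(2) J(4))
qed auto

abbreviation "R \<equiv> rch b sub"

lemma rch1: "pc c < length P \<Longrightarrow> P ! pc c = ins \<Longrightarrow> (\<And>r. ins \<noteq> Rand r) \<Longrightarrow> exec b sub 0 ins c = c' \<Longrightarrow>
   clock c < clock c' \<Longrightarrow> R P 1 c c'"
  using rchS[of c P b sub 0 c'] rch0[of b sub P c'] by simp

definition agree :: "(nat \<Rightarrow> nat) \<Rightarrow> (nat \<Rightarrow> nat) \<Rightarrow> bool" where
  "agree s r \<longleftrightarrow> (\<forall>i<100. r i = s i)"

lemma ce_sound:
  assumes "wfx e" "code P p (ce d e)" "100 \<le> d" "agree s r"
  shows "\<exists>r'. R P (esz e) \<lparr>pc = p, reg = r, mem = m, clock = k\<rparr>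
      \<lparr>pc = p + esz e, reg = r', mem = m, clock = k + esz e\<rparr> \<and>
    r' d = ev b s m e \<and> (\<forall>i<d. r' i = r i)"
  using assms
proof (induction e arbitrary: p d r k)
  case (V i)
  then have "R P 1 \<lparr>pc = p, reg = r, mem = m, clock = k\<rparr>
      \<lparr>pc = p + 1, reg = r(d := s i), mem = m, clock = k + 1\<rparr>"
    by (intro rch1[of _ _ "Arith Or d i i"]) (auto simp: code_single agree_def set_reg_def)
  then show ?case
    by (intro exI[of _ "r(d := s i)"] conjI) (simp only: esz.simps, auto)
next
  case (C i)
  then have "R P 1 \<lparr>pc = p, reg = r, mem = m, clock = k\<rparr>
      \<lparr>pc = p + 1, reg = r(d := i mod 2 ^ b), mem = m, clock = k + 1\<rparr>"
    by (intro rch1[of _ _ "Imm d i"]) (auto simp: code_single agree_def set_reg_def)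
  then show ?case
    by (intro exI[of _ "r(d := i mod 2 ^ b)"] conjI) (simp only: esz.simps, auto)
next
  case (Bin op x y)
  obtain r1 where 1: "R P (esz x) \<lparr>pc = p, reg = r, mem = m, clock = k\<rparr>
      \<lparr>pc = p + esz x, reg = r1, mem = m, clock = k + esz x\<rparr>" "r1 d = ev b s m x" "\<forall>i<d. r1 i = r i"
    using Bin.IH(1)[of p d r k] Bin.prems by (auto simp: code_append)
  have "agree s r1"
    using Bin.prems(3,4) 1(3) by (auto simp: agree_def)
  then obtain r2 where 2: "R P (esz y) \<lparr>pc = p + esz x, reg = r1, mem = m, clock = k + esz x\<rparr>
      \<lparr>pc = p + esz x + esz y, reg = r2, mem = m, clock = k + esz x + esz y\<rparr>" "r2 (Suc d) = ev b s m y"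
      "\<forall>i<Suc d. r2 i = r1 i"
    using Bin.IH(2)[of "p + esz x" "Suc d" r1 "k + esz x"] Bin.prems by (auto simp: code_append)
  have "R P 1 \<lparr>pc = p + esz x + esz y, reg = r2, mem = m, clock = k + esz x + esz y\<rparr>
     \<lparr>pc = p + esz (Bin op x y), reg = r2(d := ev b s m (Bin op x y)), mem = m, clock = k + esz (Bin op x y)\<rparr>"
    using Bin.prems 1 2
    by (intro rch1[of _ _ "Arith op d d (Suc d)"]) (auto simp: code_append code_single set_reg_def)
  from rch_trans[OF rch_trans[OF 1(1) 2(1)] this] show ?case
    using 1 2 by (intro exI[of _ "r2(d := ev b s m (Bin op x y))"] conjI) (simp only: esz.simps, auto)
next
  case (Ld x)
  obtain r1 where 1: "R P (esz x) \<lparr>pc = p, reg = r, mem = m, clock = k\<rparr>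
      \<lparr>pc = p + esz x, reg = r1, mem = m, clock = k + esz x\<rparr>" "r1 d = ev b s m x" "\<forall>i<d. r1 i = r i"
    using Ld.IH[of p d r k] Ld.prems by (auto simp: code_append)
  have "R P 1 \<lparr>pc = p + esz x, reg = r1, mem = m, clock = k + esz x\<rparr>
     \<lparr>pc = p + esz (Ld x), reg = r1(d := ev b s m (Ld x)), mem = m, clock = k + esz (Ld x)\<rparr>"
    using Ld.prems 1
    by (intro rch1[of _ _ "Load d d"]) (auto simp: code_append code_single set_reg_def)
  from rch_trans[OF 1(1) this] show ?case
    using 1 by (intro exI[of _ "r1(d := ev b s m (Ld x))"] conjI) (simp only: esz.simps, auto)
qed

text \<open>Total correctness of the code between two addresses within time \<open>t\<close>. The
  starting clock is universally quantified so that pieces compose, and the postcondition speaks of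
  an abstract state \<open>s'\<close> because the registers from 100 on are arbitrary.\<close>

definition rnc :: "program \<Rightarrow> nat \<Rightarrow> nat \<Rightarrow> (nat \<Rightarrow> nat) \<Rightarrow> (nat \<Rightarrow> nat) \<Rightarrow> nat \<Rightarrow>
    ((nat \<Rightarrow> nat) \<Rightarrow> (nat \<Rightarrow> nat) \<Rightarrow> bool) \<Rightarrow> bool" where
  "rnc P p q r m t Q \<longleftrightarrow> (\<forall>k. \<exists>n s' m' r' k'. R P n \<lparr>pc = p, reg = r, mem = m, clock = k\<rparr>
      \<lparr>pc = q, reg = r', mem = m', clock = k'\<rparr> \<and> agree s' r' \<and> Q s' m' \<and> k' \<le> k + t)"

lemma rnc0: "agree s r \<Longrightarrow> Q s m \<Longrightarrow> rnc P p p r m t Q"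
  unfolding rnc_def using rch0 by (metis le_add1)

lemma rnc_trans:
  assumes "rnc P p q r m t Q" "\<And>s r m. agree s r \<Longrightarrow> Q s m \<Longrightarrow> rnc P q q' r m t' Q'" "t + t' \<le> u"
  shows "rnc P p q' r m u Q'"
  unfolding rnc_def
proof (intro allI)
  fix k
  from assms(1) obtain n s' m' r' k' where 1: "R P n \<lparr>pc = p, reg = r, mem = m, clock = k\<rparr>
      \<lparr>pc = q, reg = r', mem = m', clock = k'\<rparr>" "agree s' r'" "Q s' m'" "k' \<le> k + t"
    unfolding rnc_def by blast
  from assms(2)[OF 1(2,3)] obtain n2 s2 m2 r2 k2 where 2: "R P n2 \<lparr>pc = q, reg = r', mem = m', clock = k'\<rparr>
      \<lparr>pc = q', reg = r2, mem = m2, clock = k2\<rparr>" "agree s2 r2" "Q' s2 m2" "k2 \<le> k' + t'"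
    unfolding rnc_def by blast
  show "\<exists>n s' m' r' k'. R P n \<lparr>pc = p, reg = r, mem = m, clock = k\<rparr>
      \<lparr>pc = q', reg = r', mem = m', clock = k'\<rparr> \<and> agree s' r' \<and> Q' s' m' \<and> k' \<le> k + u"
    using rch_trans[OF 1(1) 2(1)] 2 1(4) assms(3)
    by (intro exI[of _ "n + n2"] exI[of _ s2] exI[of _ m2] exI[of _ r2] exI[of _ k2]) auto
qed

lemma rnc_rch:
  assumes "\<And>k. R P n \<lparr>pc = p, reg = r, mem = m, clock = k\<rparr> \<lparr>pc = q, reg = r', mem = m', clock = k + t\<rparr>"
    "rnc P q q' r' m' t' Q" "t + t' \<le> u"
  shows "rnc P p q' r m u Q"
  unfolding rnc_def
proof (intro allI)
  fix k
  from assms(2) obtain n2 s2 m2 r2 k2 where 2: "R P n2 \<lparr>pc = q, reg = r', mem = m', clock = k + t\<rparr>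
      \<lparr>pc = q', reg = r2, mem = m2, clock = k2\<rparr>" "agree s2 r2" "Q s2 m2" "k2 \<le> (k + t) + t'"
    unfolding rnc_def by blast
  show "\<exists>n s' m' r' k'. R P n \<lparr>pc = p, reg = r, mem = m, clock = k\<rparr>
      \<lparr>pc = q', reg = r', mem = m', clock = k'\<rparr> \<and> agree s' r' \<and> Q s' m' \<and> k' \<le> k + u"
    using rch_trans[OF assms(1) 2(1)] 2 assms(3)
    by (intro exI[of _ "n + n2"] exI[of _ s2] exI[of _ m2] exI[of _ r2] exI[of _ k2]) auto
qed

lemma rnc_ce:
  assumes "wfx e" "code P p (ce d e)" "100 \<le> d" "agree s r"
    "\<And>r'. r' d = ev b s m e \<Longrightarrow> (\<And>i. i < d \<Longrightarrow> r' i = r i) \<Longrightarrow> agree s r' \<Longrightarrow> rnc P (p + esz e) q r' m t Q"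
    "esz e + t \<le> u"
  shows "rnc P p q r m u Q"
  unfolding rnc_def
proof (intro allI)
  fix k
  from ce_sound[OF assms(1-4), of m k] obtain r' where 1: "R P (esz e) \<lparr>pc = p, reg = r, mem = m, clock = k\<rparr>
      \<lparr>pc = p + esz e, reg = r', mem = m, clock = k + esz e\<rparr>" "r' d = ev b s m e" "\<forall>i<d. r' i = r i"
    by blast
  have "agree s r'"
    using assms(3,4) 1(3) by (auto simp: agree_def)
  then have "rnc P (p + esz e) q r' m t Q"
    using assms(5)[of r'] 1 by blast
  then obtain n2 s2 m2 r2 k2 where 2: "R P n2 \<lparr>pc = p + esz e, reg = r', mem = m, clock = k + esz e\<rparr>
      \<lparr>pc = q, reg = r2, mem = m2, clock = k2\<rparr>" "agree s2 r2" "Q s2 m2" "k2 \<le> k + esz e + t"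
    unfolding rnc_def by blast
  show "\<exists>n s' m' r' k'. R P n \<lparr>pc = p, reg = r, mem = m, clock = k\<rparr>
      \<lparr>pc = q, reg = r', mem = m', clock = k'\<rparr> \<and> agree s' r' \<and> Q s' m' \<and> k' \<le> k + u"
    using rch_trans[OF 1(1) 2(1)] 2 assms(6)
    by (intro exI[of _ "esz e + n2"] exI[of _ s2] exI[of _ m2] exI[of _ r2] exI[of _ k2]) auto
qed

lemma rnc_Imm: "code P p [Imm i c] \<Longrightarrow> rnc P (Suc p) q (r(i := c mod 2 ^ b)) m t Q \<Longrightarrow> Suc t \<le> u \<Longrightarrow> rnc P p q r m u Q"
  by (rule rnc_rch[where n = 1 and t = 1 and t' = t, OF rch1[of _ _ "Imm i c"]]) (auto simp: code_single set_reg_def)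

lemma rnc_Arith: "code P p [Arith op i j l] \<Longrightarrow> rnc P (Suc p) q (r(i := apply_binop b op (r j) (r l))) m t Q \<Longrightarrow>
    Suc t \<le> u \<Longrightarrow> rnc P p q r m u Q"
  by (rule rnc_rch[where n = 1 and t = 1 and t' = t, OF rch1[of _ _ "Arith op i j l"]]) (auto simp: code_single set_reg_def)

lemma rnc_Store: "code P p [Store i j] \<Longrightarrow> rnc P (Suc p) q r (m(r i := r j)) t Q \<Longrightarrow>
    Suc t \<le> u \<Longrightarrow> rnc P p q r m u Q"
  by (rule rnc_rch[where n = 1 and t = 1 and t' = t, OF rch1[of _ _ "Store i j"]]) (auto simp: code_single)

lemma rnc_JumpLess: "code P p [JumpLess i j l] \<Longrightarrow> rnc P (if r i < r j then l else Suc p) q r m t Q \<Longrightarrow>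
    Suc t \<le> u \<Longrightarrow> rnc P p q r m u Q"
  by (rule rnc_rch[where n = 1 and t = 1 and t' = t, OF rch1[of _ _ "JumpLess i j l"]]) (auto simp: code_single)

lemma rnc_Call: "code P p [Call i j] \<Longrightarrow> r j < N \<Longrightarrow> rnc P (Suc p) q (r(i := f (r j))) m t Q \<Longrightarrow>
    Suc t + \<tau> \<le> u \<Longrightarrow> rnc P p q r m u Q"
proof -
  assume 1: "code P p [Call i j]" "r j < N" "rnc P (Suc p) q (r(i := f (r j))) m t Q" "Suc t + \<tau> \<le> u"
  from sub[OF 1(2)] obtain t0 where t0: "t0 \<le> \<tau>" "sub (r j) = Some (f (r j), t0)"
    by blast
  show ?thesis
    by (rule rnc_rch[where n = 1 and t = "Suc t0" and t' = t, OF rch1[of _ _ "Call i j"] 1(3)])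
      (use 1 t0 in \<open>auto simp: code_single set_reg_def\<close>)
qed

lemma rnc_goto: "code P p [Imm 100 0, Imm 101 1, JumpLess 100 101 l] \<Longrightarrow>
    rnc P l q (r(100 := 0, 101 := 1)) m t Q \<Longrightarrow> t + 3 \<le> u \<Longrightarrow> rnc P p q r m u Q"
proof -
  assume 1: "code P p [Imm 100 0, Imm 101 1, JumpLess 100 101 l]" "rnc P l q (r(100 := 0, 101 := 1)) m t Q" "t + 3 \<le> u"
  have b: "1 mod 2 ^ b = (1::nat)"
    using b1 by simp
  have c: "code P p [Imm 100 0]" "code P (Suc p) [Imm 101 1]" "code P (Suc (Suc p)) [JumpLess 100 101 l]"
    using 1(1) by (auto simp: code_Cons code_single)
  show ?thesis
    by (rule rnc_Imm[OF c(1) rnc_Imm[OF c(2) rnc_JumpLess[OF c(3), where t = t]]]) (use 1 b in auto)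
qed

text \<open>By induction on the command for all postconditions: in a sequence, the precondition of
  the second command is the postcondition of the first. A loop is treated at its bottom test, by
  induction on the number of remaining rounds.\<close>

lemma exc_sound:
  "exc c s m Q \<Longrightarrow> wfc c \<Longrightarrow> code P p (comp p c) \<Longrightarrow> agree s r \<Longrightarrow> rnc P p (p + csz c) r m (tb \<tau> lm c) Q"
proof (induction c arbitrary: s m Q p r)
  case Skip
  then show ?case
    by (auto intro: rnc0)
next
  case (Asg i e)
  show ?case
  proof (rule rnc_ce[where d = 100 and e = e and t = 1, OF _ _ _ Asg(4)])
    fix r' assume r': "r' 100 = ev b s m e" "agree s r'"
    have "agree (s(i := ev b s m e)) (r'(i := r' 100 OR r' 100))"
      using r' by (auto simp: agree_def)
    then show "rnc P (p + esz e) (p + csz (Asg i e)) r' m 1 Q"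
      using Asg by - (rule rnc_Arith[where op = Or and i = i and j = 100 and l = 100 and t = 0], auto simp: code_append intro: rnc0)
  qed (use Asg in \<open>auto simp: code_append\<close>)
next
  case (Sto x e)
  show ?case
  proof (rule rnc_ce[where d = 100 and e = x and t = "esz e + 1", OF _ _ _ Sto(4)])
    fix r' assume r': "r' 100 = ev b s m x" "agree s r'"
    show "rnc P (p + esz x) (p + csz (Sto x e)) r' m (esz e + 1) Q"
    proof (rule rnc_ce[where d = 101 and e = e and t = 1, OF _ _ _ r'(2)])
      fix r'' assume r'': "r'' 101 = ev b s m e" "\<And>i. i < 101 \<Longrightarrow> r'' i = r' i" "agree s r''"
      show "rnc P (p + esz x + esz e) (p + csz (Sto x e)) r'' m 1 Q"
        using Sto r' r'' by - (rule rnc_Store[where i = 100 and j = 101 and t = 0], auto simp: code_append add.assoc intro: rnc0)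
    qed (use Sto in \<open>auto simp: code_append\<close>)
  qed (use Sto in \<open>auto simp: code_append\<close>)
next
  case (Cal i e)
  show ?case
  proof (rule rnc_ce[where d = 100 and e = e and t = "1 + \<tau>", OF _ _ _ Cal(4)])
    fix r' assume r': "r' 100 = ev b s m e" "agree s r'"
    have "agree (s(i := f (ev b s m e))) (r'(i := f (r' 100)))"
      using r' by (auto simp: agree_def)
    then show "rnc P (p + esz e) (p + csz (Cal i e)) r' m (1 + \<tau>) Q"
      using Cal r' by - (rule rnc_Call[where i = i and j = 100 and t = 0], auto simp: code_append intro: rnc0)
  qed (use Cal in \<open>auto simp: code_append\<close>)
next
  case (Seq c d)
  have 1: "rnc P p (p + csz c) r m (tb \<tau> lm c) (\<lambda>s m. exc d s m Q)"
    using Seq.IH(1)[of s m _ p r] Seq.prems by (auto simp: code_append)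
  show ?case
  proof (rule rnc_trans[OF 1])
    fix s r m assume "agree s r" "exc d s m Q"
    then show "rnc P (p + csz c) (p + csz (c ;; d)) r m (tb \<tau> lm d) Q"
      using Seq.IH(2)[of s m Q "p + csz c" r] Seq.prems by (auto simp: code_append add.assoc)
  qed simp
next
  case (If x y c d)
  let ?p = "p + esz x + esz y"
  let ?q = "p + csz (If x y c d)"
  have S4: "Suc (Suc (Suc (Suc i))) = i + 4" for i
    by simp
  have cd: "code P p (ce 100 x)" "code P (p + esz x) (ce 101 y)" "code P ?p [JumpLess 100 101 (?p + 4 + csz d)]"
    "code P (?p + 1) (comp (?p + 1) d)"
    "code P (?p + 1 + csz d) [Imm 100 0, Imm 101 1, JumpLess 100 101 (?p + 4 + csz d + csz c)]"
    "code P (?p + 4 + csz d) (comp (?p + 4 + csz d) c)"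
    using If.prems(3) code_append[of P "?p + 1 + csz d" "[Imm 100 0, Imm 101 1, JumpLess 100 101 (?p + 4 + csz d + csz c)]"]
    unfolding comp.simps code_append length_append length_ce length_comp by (auto simp: algebra_simps S4)
  show ?case
  proof (rule rnc_ce[where d = 100 and e = x and t = "esz y + 4 + tb \<tau> lm c + tb \<tau> lm d", OF _ cd(1) _ If.prems(4)])
    fix r' assume r': "r' 100 = ev b s m x" "agree s r'"
    show "rnc P (p + esz x) ?q r' m (esz y + 4 + tb \<tau> lm c + tb \<tau> lm d) Q"
    proof (rule rnc_ce[where d = 101 and e = y and t = "4 + tb \<tau> lm c + tb \<tau> lm d", OF _ cd(2) _ r'(2)])
      fix r'' assume r'': "r'' 101 = ev b s m y" "\<And>i. i < 101 \<Longrightarrow> r'' i = r' i" "agree s r''"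
      show "rnc P ?p ?q r'' m (4 + tb \<tau> lm c + tb \<tau> lm d) Q"
      proof (rule rnc_JumpLess[OF cd(3), where t = "3 + tb \<tau> lm c + tb \<tau> lm d"])
        show "rnc P (if r'' 100 < r'' 101 then ?p + 4 + csz d else Suc ?p) ?q r'' m (3 + tb \<tau> lm c + tb \<tau> lm d) Q"
        proof (cases "ev b s m x < ev b s m y")
          case True
          then have "rnc P (?p + 4 + csz d) (?p + 4 + csz d + csz c) r'' m (tb \<tau> lm c) Q"
            using If.IH(1)[OF _ _ cd(6) r''(3)] If.prems by auto
          then have "rnc P (?p + 4 + csz d) ?q r'' m (3 + tb \<tau> lm c + tb \<tau> lm d) Q"
            by (rule rnc_trans[where t' = 0]) (auto intro: rnc0 simp: algebra_simps)
          then show ?thesis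
            using True r' r'' by simp
        next
          case False
          then have "rnc P (?p + 1) (?p + 1 + csz d) r'' m (tb \<tau> lm d) Q"
            using If.IH(2)[OF _ _ cd(4) r''(3)] If.prems by auto
          then have "rnc P (?p + 1) ?q r'' m (3 + tb \<tau> lm c + tb \<tau> lm d) Q"
          proof (rule rnc_trans[where t' = 3])
            fix s r m assume "agree s r" "Q s m"
            then show "rnc P (?p + 1 + csz d) ?q r m 3 Q"
              by - (rule rnc_goto[OF cd(5), where t = 0], auto intro!: rnc0[of s] simp: algebra_simps agree_def)
          qed simp
          then show ?thesis
            using False r' r'' by simp
        qed
      qed simp
    qed (use If in auto)
  qed (use If in auto)
next
  case (For i n L c)
  let ?q = "p + csz (For i n L c)"
  from For.prems(1) obtain J where J: "s n \<le> lm L" "J 0 (s(i := 0)) m"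
    "\<And>j s' m'. j < s n \<Longrightarrow> J j s' m' \<Longrightarrow> s' i = j \<Longrightarrow> s' n = s n \<Longrightarrow>
        exc c s' m' (\<lambda>s'' m''. s'' i = j \<and> s'' n = s n \<and> J (Suc j) (s''(i := Suc j)) m'')"
    "\<And>s' m'. J (s n) s' m' \<Longrightarrow> s' i = s n \<Longrightarrow> s' n = s n \<Longrightarrow> Q s' m'"
    unfolding exc.simps(7) by blast
  have wf: "i < 100" "n < 100" "i \<noteq> n" "wfc c"
    using For.prems by auto
  have b: "1 mod 2 ^ b = (1::nat)"
    using b1 by simp
  have S: "i + 4 = Suc (Suc (Suc (Suc i)))" "i + 5 = Suc (Suc (Suc (Suc (Suc i))))"
    "i + 6 = Suc (Suc (Suc (Suc (Suc (Suc i)))))" for i :: nat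
    by simp_all
  have cd: "code P p [Imm i 0]" "code P (Suc p) [Imm 100 0, Imm 101 1, JumpLess 100 101 (p + 6 + csz c)]"
    "code P (p + 4) (comp (p + 4) c)" "code P (p + 4 + csz c) [Imm 101 1]" "code P (p + 5 + csz c) [Arith Add i i 101]"
    "code P (p + 6 + csz c) [JumpLess i n (p + 4)]"
    using For.prems(3) unfolding comp.simps code_append length_append length_ce length_comp
    by (auto simp: algebra_simps code_Cons code_single S)
  have cd5: "code P (Suc (p + 4 + csz c)) [Arith Add i i 101]" and e: "Suc (Suc (p + 4 + csz c)) = p + 6 + csz c"
    using cd(5) by (simp_all add: numeral_eq_Suc)
  have loop: "rnc P (p + 6 + csz c) ?q r m (1 + (s n - j) * (tb \<tau> lm c + 3)) Q"
    if "agree s' r" "J j s' m" "s' i = j" "s' n = s n" "j \<le> s n" for j s' r m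
    using that
  proof (induction "s n - j" arbitrary: j s' r m)
    case 0
    then have "j = s n" by simp
    then show ?case
      using 0 J(4) wf by - (rule rnc_JumpLess[OF cd(6), where t = 0], auto simp: agree_def algebra_simps intro!: rnc0[of s'])
  next
    case (Suc d)
    then have j: "j < s n" by simp
    \<comment> \<open>Loop limits are words, hence incrementing the counter does not wrap
      around.\<close>
    have "Suc j < 2 ^ b"
      using j J(1) lm[of L] by linarith
    note jb = this
    have 1: "rnc P (p + 4) (p + 4 + csz c) r m (tb \<tau> lm c) (\<lambda>s'' m''. s'' i = j \<and> s'' n = s n \<and> J (Suc j) (s''(i := Suc j)) m'')"
      using For.IH[OF J(3)[OF j Suc.prems(2-4)] wf(4) cd(3) Suc.prems(1)] .
    have 2: "rnc P (p + 4) ?q r m (tb \<tau> lm c + 2 + (1 + (s n - Suc j) * (tb \<tau> lm c + 3))) Q"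
    proof (rule rnc_trans[OF 1])
      fix s2 r2 m2 assume *: "agree s2 r2" "s2 i = j \<and> s2 n = s n \<and> J (Suc j) (s2(i := Suc j)) m2"
      have "rnc P (p + 6 + csz c) ?q (r2(101 := 1, i := Suc j)) m2 (1 + (s n - Suc j) * (tb \<tau> lm c + 3)) Q"
        by (rule Suc.hyps(1)[of "Suc j" "s2(i := Suc j)"]) (use Suc.hyps(2) * wf j in \<open>auto simp: agree_def\<close>)
      moreover have "(r2(101 := 1))(i := apply_binop b Add ((r2(101 := 1)) i) ((r2(101 := 1)) 101)) = r2(101 := 1, i := Suc j)"
        using * wf jb by (auto simp: agree_def)
      ultimately show "rnc P (p + 4 + csz c) ?q r2 m2 (2 + (1 + (s n - Suc j) * (tb \<tau> lm c + 3))) Q"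
        using b e by - (rule rnc_Imm[OF cd(4) rnc_Arith[OF cd5]], auto simp: algebra_simps)
    qed simp
    have "s n - j = Suc (s n - Suc j)"
      using j by simp
    then have "Suc (tb \<tau> lm c + 2 + (1 + (s n - Suc j) * (tb \<tau> lm c + 3))) \<le> 1 + (s n - j) * (tb \<tau> lm c + 3)"
      by simp
    moreover have "r i < r n"
      using Suc.prems j wf by (auto simp: agree_def)
    ultimately show ?case
      using 2 by - (rule rnc_JumpLess[OF cd(6) _], auto)
  qed
  have "rnc P (p + 6 + csz c) ?q (r(i := 0, 100 := 0, 101 := 1)) m (1 + (s n - 0) * (tb \<tau> lm c + 3)) Q"
    by (rule loop[of "s(i := 0)"]) (use For.prems(4) J wf in \<open>auto simp: agree_def\<close>)
  moreover have "s n * (tb \<tau> lm c + 3) \<le> lm L * (tb \<tau> lm c + 3)"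
    using J(1) by (rule mult_le_mono1)
  ultimately show ?case
    by - (rule rnc_Imm[OF cd(1) rnc_goto[OF cd(2)]], auto)
qed

end

section \<open>Averages over finite sets\<close>

text \<open>Expectation under the uniform distribution as a finite sum. The probabilistic analysis
  is carried out with averages over lists of words, to which the distribution of a run is reduced
  one random word at a time.\<close>

definition avg :: "'a set \<Rightarrow> ('a \<Rightarrow> real) \<Rightarrow> real" where
  "avg A \<phi> = (\<Sum>x\<in>A. \<phi> x) / real (card A)"

lemma avg_cong: "A = B \<Longrightarrow> (\<And>x. x \<in> B \<Longrightarrow> \<phi> x = \<psi> x) \<Longrightarrow> avg A \<phi> = avg B \<psi>"
  by (simp add: avg_def)

lemma avg_mono: "(\<And>x. x \<in> A \<Longrightarrow> \<phi> x \<le> \<psi> x) \<Longrightarrow> avg A \<phi> \<le> avg A \<psi>"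
  by (simp add: avg_def sum_mono divide_right_mono)

lemma avg_nonneg: "(\<And>x. x \<in> A \<Longrightarrow> 0 \<le> \<phi> x) \<Longrightarrow> 0 \<le> avg A \<phi>"
  by (simp add: avg_def sum_nonneg)

lemma avg_add: "avg A (\<lambda>x. \<phi> x + \<psi> x) = avg A \<phi> + avg A \<psi>"
  by (simp add: avg_def sum.distrib add_divide_distrib)

lemma avg_diff: "avg A (\<lambda>x. \<phi> x - \<psi> x) = avg A \<phi> - avg A \<psi>"
  by (simp add: avg_def sum_subtractf diff_divide_distrib)

lemma avg_cmult: "avg A (\<lambda>x. c * \<phi> x) = c * avg A \<phi>"
  by (simp add: avg_def sum_distrib_left)

lemma avg_divide: "avg A (\<lambda>x. \<phi> x / c) = avg A \<phi> / c"
  by (simp add: avg_def sum_divide_distrib mult.commute)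

lemma avg_sum: "avg A (\<lambda>x. \<Sum>i\<in>I. \<phi> i x) = (\<Sum>i\<in>I. avg A (\<phi> i))"
  by (simp add: avg_def sum.swap[of _ I A] sum_divide_distrib)

lemma avg_const: "finite A \<Longrightarrow> A \<noteq> {} \<Longrightarrow> avg A (\<lambda>x. c) = c"
  by (simp add: avg_def)

lemma avg_swap: "avg A (\<lambda>x. avg B (\<lambda>y. \<phi> x y)) = avg B (\<lambda>y. avg A (\<lambda>x. \<phi> x y))"
  by (simp add: avg_def sum_divide_distrib[symmetric] sum.swap[of _ A B] mult.commute)

lemma avg_Times: "avg (A \<times> B) \<phi> = avg A (\<lambda>x. avg B (\<lambda>y. \<phi> (x, y)))"
  by (simp add: avg_def sum.cartesian_product sum_divide_distrib[symmetric] card_cartesian_product mult.commute)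

lemma avg_bij: "bij_betw \<pi> A B \<Longrightarrow> avg B \<phi> = avg A (\<lambda>x. \<phi> (\<pi> x))"
  unfolding avg_def using sum.reindex_bij_betw[of \<pi> A B \<phi>] bij_betw_same_card[of \<pi> A B] by simp

text \<open>A variable that admits all translations of a group is uniformly distributed.\<close>

lemma avg_translation:
  assumes "finite A" "A \<noteq> {}" "finite G" "G \<noteq> {}"
    and bij: "\<And>a. a \<in> G \<Longrightarrow> bij_betw (\<pi> a) A A"
    and key: "\<And>a x. a \<in> G \<Longrightarrow> x \<in> A \<Longrightarrow> key (\<pi> a x) = opn a (key x)"
    and opn: "\<And>x. x \<in> A \<Longrightarrow> bij_betw (\<lambda>a. opn a (key x)) G G"
  shows "avg A (\<lambda>x. \<psi> (key x)) = avg G \<psi>"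
proof -
  have "avg A (\<lambda>x. \<psi> (key x)) = avg G (\<lambda>a. avg A (\<lambda>x. \<psi> (key x)))"
    using assms by (simp add: avg_const)
  also have "\<dots> = avg G (\<lambda>a. avg A (\<lambda>x. \<psi> (opn a (key x))))"
  proof (rule avg_cong[OF refl])
    fix a assume a: "a \<in> G"
    show "avg A (\<lambda>x. \<psi> (key x)) = avg A (\<lambda>x. \<psi> (opn a (key x)))"
      unfolding avg_bij[OF bij[OF a], of "\<lambda>x. \<psi> (key x)"] using key[OF a] by (intro avg_cong refl) simp
  qed
  also have "\<dots> = avg A (\<lambda>x. avg G (\<lambda>a. \<psi> (opn a (key x))))"
    by (rule avg_swap)
  also have "\<dots> = avg A (\<lambda>x. avg G \<psi>)"
    by (intro avg_cong[OF refl] avg_bij[OF opn, symmetric])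
  finally show ?thesis
    using assms by (simp add: avg_const)
qed

lemma prob_bind_pmf_of_set:
  assumes "finite A" "A \<noteq> {}"
  shows "measure_pmf.prob (bind_pmf (pmf_of_set A) g) S = avg A (\<lambda>v. measure_pmf.prob (g v) S)"
proof -
  have "ennreal (measure_pmf.prob (bind_pmf (pmf_of_set A) g) S) = emeasure (bind_pmf (pmf_of_set A) g) S"
    by (simp add: measure_pmf.emeasure_eq_measure)
  also have "\<dots> = (\<integral>\<^sup>+x. ennreal (measure_pmf.prob (g x) S) \<partial>pmf_of_set A)"
    by (subst emeasure_bind_pmf) (simp add: measure_pmf.emeasure_eq_measure)
  also have "\<dots> = ennreal (\<integral>x. measure_pmf.prob (g x) S \<partial>pmf_of_set A)"
    by (intro nn_integral_eq_integral measure_pmf.integrable_const_bound[where B = 1]) auto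
  also have "\<dots> = ennreal (avg A (\<lambda>v. measure_pmf.prob (g v) S))"
    using assms by (simp add: integral_pmf_of_set avg_def)
  finally show ?thesis
    by (simp add: avg_nonneg)
qed

section \<open>Lists of random words\<close>

definition W :: "nat \<Rightarrow> nat \<Rightarrow> nat list set" where
  "W b r = {xs. length xs = r \<and> set xs \<subseteq> {..<2 ^ b}}"

lemma W_0 [simp]: "W b 0 = {[]}"
  by (auto simp: W_def)

lemma length_W: "xs \<in> W b r \<Longrightarrow> length xs = r"
  by (simp add: W_def)

lemma W_iff: "xs \<in> W b r \<longleftrightarrow> length xs = r \<and> (\<forall>i<r. xs ! i < 2 ^ b)"
  by (auto simp: W_def set_conv_nth)

lemma nth_W: "xs \<in> W b r \<Longrightarrow> i < r \<Longrightarrow> xs ! i < 2 ^ b"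
  by (simp add: W_iff)

lemma finite_W [simp]: "finite (W b r)"
  using finite_lists_length_eq[of "{..<2 ^ b :: nat}" r] by (simp add: W_def conj_commute)

lemma card_W: "card (W b r) = (2 ^ b) ^ r"
  using card_lists_length_eq[of "{..<2 ^ b :: nat}" r] by (simp add: W_def conj_commute)

lemma W_nonempty [simp]: "W b r \<noteq> {}"
  using card_W[of b r] by (metis card.empty power_not_zero zero_neq_numeral)

lemma avg_W_append: "avg (W b (r + r')) \<phi> = avg (W b r) (\<lambda>xs. avg (W b r') (\<lambda>ys. \<phi> (xs @ ys)))"
proof -
  have "bij_betw (\<lambda>(xs, ys). xs @ ys) (W b r \<times> W b r') (W b (r + r'))"
  proof (rule bij_betw_byWitness[where f' = "\<lambda>zs. (take r zs, drop r zs)"])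
    show "(\<lambda>zs. (take r zs, drop r zs)) ` W b (r + r') \<subseteq> W b r \<times> W b r'"
      by (auto simp: W_def dest: in_set_takeD in_set_dropD)
  qed (auto simp: W_def)
  from avg_bij[OF this, of \<phi>] show ?thesis
    by (simp add: avg_Times case_prod_unfold)
qed

lemma avg_W_1: "avg (W b (Suc 0)) \<phi> = avg {..<2 ^ b} (\<lambda>v. \<phi> [v])"
proof -
  have "bij_betw (\<lambda>v. [v]) {..<2 ^ b} (W b (Suc 0))"
    by (rule bij_betw_byWitness[where f' = hd]) (auto simp: W_def length_Suc_conv)
  from avg_bij[OF this, of \<phi>] show ?thesis .
qed

lemma avg_W_Suc: "avg (W b (Suc r)) \<phi> = avg {..<2 ^ b} (\<lambda>v. avg (W b r) (\<lambda>xs. \<phi> (v # xs)))"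
  using avg_W_append[of b "Suc 0" r \<phi>] by (simp add: avg_W_1)

lemma avg_W_snoc: "avg (W b (Suc r)) \<phi> = avg (W b r) (\<lambda>xs. avg {..<2 ^ b} (\<lambda>v. \<phi> (xs @ [v])))"
  using avg_W_append[of b r "Suc 0" \<phi>] by (simp add: avg_W_1)

section \<open>Translations by exclusive or\<close>

lemma xor_less: "x < 2 ^ b \<Longrightarrow> y < 2 ^ b \<Longrightarrow> x XOR y < (2::nat) ^ b"
  using take_bit_xor[of b x y] by (metis take_bit_nat_eq_self_iff)

lemma xor_cancel: "(x XOR d) XOR d = (x::nat)"
  by (simp add: xor.assoc)

lemma bij_xor_shift:
  assumes "\<And>i. i < r \<Longrightarrow> d i < 2 ^ b"
  shows "bij_betw (\<lambda>xs. map (\<lambda>i. xs ! i XOR d i) [0..<r]) (W b r) (W b r)"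
  by (rule bij_betw_byWitness[where f' = "\<lambda>xs. map (\<lambda>i. xs ! i XOR d i) [0..<r]"])
    (auto simp: W_iff xor_cancel xor_less assms intro!: nth_equalityI)

lemma bij_xor_translate:
  assumes "y \<in> W b r"
  shows "bij_betw (\<lambda>xs. map (\<lambda>i. xs ! i XOR y ! i) [0..<r]) (W b r) (W b r)"
  using assms by (intro bij_xor_shift) (auto simp: W_iff)

text \<open>Exclusive or with a list that carries \<open>a\<close> at the coordinates
  \<open>zs\<close> and 0 elsewhere permutes \<open>W b r\<close> and translates the observed bits
  by \<open>a\<close>, which forces them to be uniform.\<close>

lemma avg_W_coords:
  assumes "distinct zs" "set zs \<subseteq> {..<r}" "k \<le> b"
  shows "avg (W b r) (\<lambda>g. \<psi> (map (\<lambda>z. take_bit k (g ! z)) zs)) = avg (W k (length zs)) \<psi>"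
proof (rule avg_translation[where \<pi> = "\<lambda>a xs. map (\<lambda>i. xs ! i XOR (case map_of (zip zs a) i of None \<Rightarrow> 0 | Some v \<Rightarrow> v)) [0..<r]"
      and opn = "\<lambda>a ys. map (\<lambda>i. a ! i XOR ys ! i) [0..<length zs]"])
  fix a assume a: "a \<in> W k (length zs)"
  have *: "map_of (zip zs a) (zs ! i) = Some (a ! i)" if "i < length zs" for i
    using a assms(1) that by (simp add: map_of_zip_nth length_W)
  have "(case map_of (zip zs a) i of None \<Rightarrow> 0 | Some v \<Rightarrow> v) < 2 ^ k" for i
  proof (cases "i \<in> set zs")
    case True
    then obtain j where "j < length zs" "i = zs ! j"
      by (auto simp: in_set_conv_nth)
    then show ?thesis
      using * a by (auto simp: W_iff)
  next
    case False
    then have "map_of (zip zs a) i = None"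
      using a by (simp add: map_of_zip_is_None length_W)
    then show ?thesis
      by simp
  qed
  moreover have "(2::nat) ^ k \<le> 2 ^ b"
    using assms(3) by simp
  ultimately show "bij_betw (\<lambda>xs. map (\<lambda>i. xs ! i XOR (case map_of (zip zs a) i of None \<Rightarrow> 0 | Some v \<Rightarrow> v)) [0..<r]) (W b r) (W b r)"
    by (intro bij_xor_shift) (meson less_le_trans)
  show "map (\<lambda>z. take_bit k (map (\<lambda>i. x ! i XOR (case map_of (zip zs a) i of None \<Rightarrow> 0 | Some v \<Rightarrow> v)) [0..<r] ! z)) zs =
      map (\<lambda>i. a ! i XOR map (\<lambda>z. take_bit k (x ! z)) zs ! i) [0..<length zs]" if "x \<in> W b r" for x
  proof (rule nth_equalityI; simp)
    fix i assume i: "i < length zs"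
    then have "zs ! i < r" "take_bit k (a ! i) = a ! i"
      using subsetD[OF assms(2) nth_mem[OF i]] a by (auto simp: W_iff take_bit_nat_eq_self_iff)
    then show "take_bit k (map (\<lambda>i. x ! i XOR (case map_of (zip zs a) i of None \<Rightarrow> 0 | Some v \<Rightarrow> v)) [0..<r] ! (zs ! i)) =
         a ! i XOR take_bit k (x ! (zs ! i))"
      using i * by (simp add: xor.commute)
  qed
next
  fix x assume "x \<in> W b r"
  have "map (\<lambda>z. take_bit k (x ! z)) zs \<in> W k (length zs)"
    by (simp add: W_iff)
  then show "bij_betw (\<lambda>a. map (\<lambda>i. a ! i XOR map (\<lambda>z. take_bit k (x ! z)) zs ! i) [0..<length zs])
      (W k (length zs)) (W k (length zs))"
    by (rule bij_xor_translate)
qed auto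

section \<open>Affine exclusive-or hashing\<close>

text \<open>\<open>X 0\<close> is the constant term, and \<open>X ((c + 1) K)\<close> is switched on by bit \<open>c\<close> of the hashed number.
  The stride \<open>K\<close> allows \<open>K\<close> such functions to be interleaved.\<close>

fun hx :: "(nat \<Rightarrow> nat) \<Rightarrow> nat \<Rightarrow> nat \<Rightarrow> nat \<Rightarrow> nat" where
  "hx X K 0 v = X 0"
| "hx X K (Suc c) v = hx X K c v XOR (if bit v c then X (Suc c * K) else 0)"

lemma hx_xor: "hx (\<lambda>i. X i XOR D i) K c v = hx X K c v XOR hx D K c v"
  by (induction c) (auto simp: ac_simps)

lemma hx_cong: "(\<And>c. c \<le> q \<Longrightarrow> X (c * K) = Y (c * K)) \<Longrightarrow> hx X K q v = hx Y K q v"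
proof (induction q)
  case 0
  from 0[of 0] show ?case by simp
next
  case (Suc q)
  from Suc.prems[of "Suc q"] Suc.IH Suc.prems show ?case by simp
qed

text \<open>Translations of the tables are chosen of this shape: a constant term \<open>a\<close>
  moves the hash of every number, a coefficient \<open>e\<close> at bit \<open>c\<close> only the
  hashes of numbers that have this bit.\<close>

lemma hx_single: 
  assumes "0 < K" "c < q" "D 0 = a" "D (Suc c * K) = e" "\<And>j. j < q \<Longrightarrow> j \<noteq> c \<Longrightarrow> D (Suc j * K) = 0"
  shows "hx D K q v = a XOR (if bit v c then e else 0)"
proof -
  have "hx D K p v = a XOR (if c < p \<and> bit v c then e else 0)" if "p \<le> q" for p
    using that
  proof (induction p)
    case (Suc p)
    then show ?case
      using assms(4) assms(5)[of p] by (cases "p = c") auto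
  qed (use assms in auto)
  from this[of q] show ?thesis using assms by simp
qed

lemma bit_difference:
  assumes "i < 2 ^ q" "j < 2 ^ q" "i \<noteq> (j::nat)"
  shows "\<exists>c<q. bit i c \<noteq> bit j c"
proof (rule ccontr)
  assume "\<not> ?thesis"
  then have "take_bit q i = take_bit q j"
    by (intro bit_eqI) (auto simp: bit_take_bit_iff)
  then show False
    using assms by (simp add: take_bit_nat_eq_self)
qed

text \<open>The whole random table of cluster \<open>v\<close>: entry \<open>z\<close> is the hash
  of \<open>v\<close> under the \<open>z\<close>-th of the \<open>K\<close> interleaved
  functions.\<close>

definition hrow :: "nat \<Rightarrow> nat \<Rightarrow> nat \<Rightarrow> nat list \<Rightarrow> nat \<Rightarrow> nat list" where
  "hrow k q K X v = map (\<lambda>z. take_bit k (hx (\<lambda>c. X ! (z + c)) K q v)) [0..<K]"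

lemma hrow_in_W: "hrow k q K X v \<in> W k K"
  by (auto simp: hrow_def W_iff)

text \<open>The indices differ in some bit \<open>c\<close>. Shifting the constant terms moves both
  rows alike, shifting the coefficients of bit \<open>c\<close> moves only the row that has the bit.
  Together these give all translations of the pair of rows, so the pair is uniform.\<close>

lemma avg_hrow_pair:
  assumes ij: "i < 2 ^ q" "j < 2 ^ q" "i \<noteq> j" and k: "k \<le> b" and K: "0 < K"
  shows "avg (W b ((q + 1) * K)) (\<lambda>X. \<psi> (hrow k q K X i) (hrow k q K X j)) =
    avg (W k K) (\<lambda>g. avg (W k K) (\<lambda>g'. \<psi> g g'))"
proof -
  have main: "avg (W b ((q + 1) * K)) (\<lambda>X. \<psi> (hrow k q K X i) (hrow k q K X j)) =
    avg (W k K) (\<lambda>g. avg (W k K) (\<lambda>g'. \<psi> g g'))"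
    if c: "c < q" "bit i c" "\<not> bit j c" and ij: "i < 2 ^ q" "j < 2 ^ q" for i j c and \<psi> :: "nat list \<Rightarrow> nat list \<Rightarrow> real"
  proof -
    \<comment> \<open>The constant terms are shifted by what row \<open>j\<close> needs. The
      coefficients of bit \<open>c\<close> are shifted by the exclusive or of both wanted
      translations, which turns the shift of row \<open>i\<close> into \<open>fst a\<close>.\<close>
    let ?d = "\<lambda>a p. if p < K then snd a ! p else if Suc c * K \<le> p \<and> p < Suc c * K + K then
      fst a ! (p - Suc c * K) XOR snd a ! (p - Suc c * K) else (0::nat)"
    have "avg (W b ((q + 1) * K)) (\<lambda>X. (\<lambda>(g, g'). \<psi> g g') (hrow k q K X i, hrow k q K X j)) =
       avg (W k K \<times> W k K) (\<lambda>(g, g'). \<psi> g g')"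
    proof (rule avg_translation[where \<pi> = "\<lambda>a xs. map (\<lambda>p. xs ! p XOR ?d a p) [0..<(q + 1) * K]"
        and opn = "\<lambda>a ys. (map (\<lambda>p. fst a ! p XOR fst ys ! p) [0..<K], map (\<lambda>p. snd a ! p XOR snd ys ! p) [0..<K])"])
      fix a assume a: "a \<in> W k K \<times> W k K"
      have kb: "(2::nat) ^ k \<le> 2 ^ b"
        using k by simp
      have "?d a p < 2 ^ k" for p
        using a by (auto simp: W_iff intro!: xor_less)
      then show "bij_betw (\<lambda>xs. map (\<lambda>p. xs ! p XOR ?d a p) [0..<(q + 1) * K]) (W b ((q + 1) * K)) (W b ((q + 1) * K))"
        using kb by (intro bij_xor_shift) (meson less_le_trans)
      have row: "hrow k q K (map (\<lambda>p. x ! p XOR ?d a p) [0..<(q + 1) * K]) v =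
         map (\<lambda>p. (snd a ! p XOR (if bit v c then fst a ! p XOR snd a ! p else 0)) XOR hrow k q K x v ! p) [0..<K]" for v x
        unfolding hrow_def
      proof (rule map_cong[OF refl])
        fix z assume "z \<in> set [0..<K]"
        then have z: "z < K" by simp
        have "hx (\<lambda>l. map (\<lambda>p. x ! p XOR ?d a p) [0..<(q + 1) * K] ! (z + l)) K q v =
            hx (\<lambda>l. x ! (z + l) XOR ?d a (z + l)) K q v"
        proof (rule hx_cong)
          fix l assume "l \<le> q"
          then have "l * K \<le> q * K"
            by (rule mult_le_mono1)
          then have "z + l * K < (q + 1) * K"
            using z unfolding add_mult_distrib by linarith
          then show "map (\<lambda>p. x ! p XOR ?d a p) [0..<(q + 1) * K] ! (z + l * K) = x ! (z + l * K) XOR ?d a (z + l * K)"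
            by (subst nth_map_upt) simp_all
        qed
        also have "\<dots> = hx (\<lambda>l. x ! (z + l)) K q v XOR hx (\<lambda>l. ?d a (z + l)) K q v"
          by (rule hx_xor)
        also have "hx (\<lambda>l. ?d a (z + l)) K q v = snd a ! z XOR (if bit v c then fst a ! z XOR snd a ! z else 0)"
        proof (rule hx_single[OF K c(1)])
          fix l assume l: "l < q" "l \<noteq> c"
          then consider "l < c" | "c < l" by linarith
          then show "?d a (z + Suc l * K) = 0"
          proof cases
            case 1
            then have "Suc l * K + K \<le> Suc c * K"
              using mult_le_mono1[of "Suc (Suc l)" "Suc c" K] by simp
            then show ?thesis using z by auto
          next
            case 2
            then have "Suc c * K + K \<le> Suc l * K"
              using mult_le_mono1[of "Suc (Suc c)" "Suc l" K] by simp
            then show ?thesis using z by auto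
          qed
        qed (use z in auto)
        finally have eq: "hx (\<lambda>l. map (\<lambda>p. x ! p XOR ?d a p) [0..<(q + 1) * K] ! (z + l)) K q v =
           hx (\<lambda>l. x ! (z + l)) K q v XOR (snd a ! z XOR (if bit v c then fst a ! z XOR snd a ! z else 0))" .
        have *: "take_bit k (u XOR d) = d XOR take_bit k u" if "d < 2 ^ k" for u d :: nat
          using that by (simp add: take_bit_nat_eq_self xor.commute)
        have "snd a ! z XOR (if bit v c then fst a ! z XOR snd a ! z else 0) < 2 ^ k"
          using a z by (auto simp: W_iff intro!: xor_less)
        from *[OF this] show "take_bit k (hx (\<lambda>l. map (\<lambda>p. x ! p XOR ?d a p) [0..<(q + 1) * K] ! (z + l)) K q v) =
          (snd a ! z XOR (if bit v c then fst a ! z XOR snd a ! z else 0)) XOR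
          map (\<lambda>z. take_bit k (hx (\<lambda>l. x ! (z + l)) K q v)) [0..<K] ! z"
          unfolding eq using z by simp
      qed
      show "(hrow k q K (map (\<lambda>p. x ! p XOR ?d a p) [0..<(q + 1) * K]) i, hrow k q K (map (\<lambda>p. x ! p XOR ?d a p) [0..<(q + 1) * K]) j) =
         (map (\<lambda>p. fst a ! p XOR fst (hrow k q K x i, hrow k q K x j) ! p) [0..<K],
          map (\<lambda>p. snd a ! p XOR snd (hrow k q K x i, hrow k q K x j) ! p) [0..<K])" for x
        unfolding row using c by (simp add: xor.left_commute[of "snd a ! _"])
    next
      fix x
      show "bij_betw (\<lambda>a. (map (\<lambda>p. fst a ! p XOR fst (hrow k q K x i, hrow k q K x j) ! p) [0..<K],
          map (\<lambda>p. snd a ! p XOR snd (hrow k q K x i, hrow k q K x j) ! p) [0..<K])) (W k K \<times> W k K) (W k K \<times> W k K)"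
        using bij_betw_map_prod[OF bij_xor_translate[OF hrow_in_W[of k q K x i]] bij_xor_translate[OF hrow_in_W[of k q K x j]]]
        by (simp add: map_prod_def case_prod_unfold)
    qed auto
    then show ?thesis
      by (simp add: avg_Times)
  qed
  obtain c where c: "c < q" "bit i c \<noteq> bit j c"
    using bit_difference[OF ij] by blast
  show ?thesis
  proof (cases "bit i c")
    case True
    with c ij show ?thesis by (intro main[of c]) auto
  next
    case False
    with c ij have "avg (W b ((q + 1) * K)) (\<lambda>X. \<psi> (hrow k q K X i) (hrow k q K X j)) =
      avg (W k K) (\<lambda>g. avg (W k K) (\<lambda>g'. \<psi> g' g))"
      by (intro main[of c j i "\<lambda>x y. \<psi> y x"]) auto
    then show ?thesis
      by (simp add: avg_swap[of _ _ \<psi>])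
  qed
qed

text \<open>A marginal of the pair law; \<open>0 < q\<close> provides the second index.\<close>

lemma avg_hrow:
  assumes "i < 2 ^ q" "0 < q" "k \<le> b" "0 < K"
  shows "avg (W b ((q + 1) * K)) (\<lambda>X. \<psi> (hrow k q K X i)) = avg (W k K) \<psi>"
proof -
  have "(2::nat) ^ 1 \<le> 2 ^ q"
    using assms(2) by (intro power_increasing) auto
  then have "\<exists>j<2 ^ q. j \<noteq> i"
    by (intro exI[of _ "if i = 0 then 1 else 0"]) auto
  then obtain j where "j < 2 ^ q" "i \<noteq> j"
    by blast
  from avg_hrow_pair[OF assms(1) this assms(3,4), where \<psi> = "\<lambda>g g'. \<psi> g"] show ?thesis
    by (simp add: avg_const)
qed

lemma avg_eq_const: "(c::nat) < 2 ^ k \<Longrightarrow> avg {..<2 ^ k} (\<lambda>v. of_bool (v = c)) = 1 / 2 ^ k"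
  by (simp add: avg_def of_bool_def)

text \<open>A single hash function is the interleaving with \<open>K = 1\<close>, so pairwise
  independence makes a collision as likely as for two independent uniform words.\<close>

lemma avg_hx_collide:
  assumes "v < 2 ^ q" "v' < 2 ^ q" "v \<noteq> v'" "k \<le> b"
  shows "avg (W b (q + 1)) (\<lambda>X. of_bool (take_bit k (hx ((!) X) 1 q v) = take_bit k (hx ((!) X) 1 q v'))) = 1 / 2 ^ k"
proof -
  have "avg (W b ((q + 1) * 1)) (\<lambda>X. of_bool (hrow k q 1 X v = hrow k q 1 X v')) =
      avg (W k 1) (\<lambda>g. avg (W k 1) (\<lambda>g'. of_bool (g = g')))"
    using assms by (intro avg_hrow_pair) auto
  also have "\<dots> = avg {..<2 ^ k :: nat} (\<lambda>x. 1 / 2 ^ k)"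
    unfolding One_nat_def avg_W_1
  proof (rule avg_cong[OF refl])
    fix x :: nat assume "x \<in> {..<2 ^ k}"
    then show "avg {..<2 ^ k} (\<lambda>v. of_bool ([x] = [v])) = 1 / 2 ^ k"
      using avg_eq_const[of x k] by (simp add: eq_commute)
  qed
  also have "\<dots> = 1 / 2 ^ k"
    by (simp add: avg_const lessThan_empty_iff)
  finally show ?thesis
    by (simp add: hrow_def)
qed

lemma avg_hx_const:
  assumes "v < 2 ^ q" "0 < q" "k \<le> b" "c < 2 ^ k"
  shows "avg (W b (q + 1)) (\<lambda>X. of_bool (take_bit k (hx ((!) X) 1 q v) = c)) = 1 / 2 ^ k"
proof -
  have "avg (W b ((q + 1) * 1)) (\<lambda>X. of_bool (hrow k q 1 X v = [c])) = avg (W k 1) (\<lambda>g. of_bool (g = [c]))"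
    using assms by (intro avg_hrow) auto
  also have "\<dots> = 1 / 2 ^ k"
    using assms(4) by (simp add: avg_W_1 avg_eq_const)
  finally show ?thesis
    by (simp add: hrow_def)
qed

section \<open>Random chains\<close>

text \<open>As long as an adaptive sequence of look-ups in a random table does not repeat a key, the values
  are independent and uniform.\<close>

lemma avg_adaptive:
  assumes run: "\<And>g. g \<in> W k K \<Longrightarrow> run g \<in> W k r"
    and step: "\<And>g c. g \<in> W k K \<Longrightarrow> c < r \<Longrightarrow> run g ! c = g ! key (run g) c"
    and key: "\<And>vs vs' c. c < r \<Longrightarrow> (\<And>c'. c' < c \<Longrightarrow> vs ! c' = vs' ! c') \<Longrightarrow> key vs c = key vs' c"
    and supp: "\<And>vs. vs \<in> W k r \<Longrightarrow> \<psi> vs \<noteq> 0 \<Longrightarrow> inj_on (key vs) {..<r} \<and> (\<forall>c<r. key vs c < K)"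
  shows "avg (W k K) (\<lambda>g. \<psi> (run g)) = avg (W k r) \<psi>"
proof -
  \<comment> \<open>Fixing the outcome \<open>vs\<close> fixes all keys, so the adaptive event turns
    into prescribed entries of the table at known places.\<close>
  have char: "run g = vs \<longleftrightarrow> map (\<lambda>z. take_bit k (g ! z)) (map (key vs) [0..<r]) = vs"
    if g: "g \<in> W k K" and vs: "vs \<in> W k r" and lt: "\<And>c. c < r \<Longrightarrow> key vs c < K" for g vs
  proof
    assume "run g = vs"
    then show "map (\<lambda>z. take_bit k (g ! z)) (map (key vs) [0..<r]) = vs"
      using step[OF g] vs lt g by (intro nth_equalityI) (auto simp: W_iff take_bit_nat_eq_self)
  next
    assume "map (\<lambda>z. take_bit k (g ! z)) (map (key vs) [0..<r]) = vs"
    then have v: "vs ! c = g ! key vs c" if "c < r" for c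
      using nth_map[of c "map (key vs) [0..<r]" "\<lambda>z. take_bit k (g ! z)"] that lt[OF that] g
      by (simp add: W_iff take_bit_nat_eq_self)
    have "run g ! c = vs ! c" if "c < r" for c
      using that
    proof (induction c rule: less_induct)
      case (less c)
      then have "key (run g) c = key vs c"
        by (intro key) auto
      then show ?case
        using step[OF g less.prems] v[OF less.prems] by simp
    qed
    then show "run g = vs"
      using run[OF g] vs by (intro nth_equalityI) (auto simp: W_iff)
  qed
  have one: "avg (W k K) (\<lambda>g. \<psi> vs * of_bool (run g = vs)) = \<psi> vs / real (card (W k r))" if vs: "vs \<in> W k r" for vs
  proof (cases "\<psi> vs = 0")
    case False
    note s = supp[OF vs False]
    have "avg (W k K) (\<lambda>g. of_bool (run g = vs)) =
        avg (W k K) (\<lambda>g. of_bool (map (\<lambda>z. take_bit k (g ! z)) (map (key vs) [0..<r]) = vs))"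
      by (intro avg_cong refl arg_cong[where f = of_bool] char vs) (use s in auto)
    also have "\<dots> = avg (W k (length (map (key vs) [0..<r]))) (\<lambda>ws. of_bool (ws = vs))"
      using s by (intro avg_W_coords) (auto simp: distinct_map atLeast0LessThan)
    also have "\<dots> = 1 / real (card (W k r))"
      using vs by (simp add: avg_def of_bool_def)
    finally show ?thesis
      by (simp add: avg_cmult)
  qed (simp add: avg_def)
  have "avg (W k K) (\<lambda>g. \<psi> (run g)) = avg (W k K) (\<lambda>g. \<Sum>vs\<in>W k r. \<psi> vs * of_bool (run g = vs))"
    using run by (intro avg_cong refl) (simp add: of_bool_def if_distrib cong: if_cong)
  also have "\<dots> = (\<Sum>vs\<in>W k r. \<psi> vs / real (card (W k r)))"
    unfolding avg_sum by (intro sum.cong refl one)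
  finally show ?thesis
    by (simp add: avg_def sum_divide_distrib)
qed

lemma avg_single: "avg {a} \<phi> = \<phi> a"
  by (simp add: avg_def)

lemma avg_W_2: "avg (W k (length [p, p'])) \<psi> = avg {..<2 ^ k} (\<lambda>u. avg {..<2 ^ k} (\<lambda>u'. \<psi> [u, u']))"
  by (simp add: avg_W_Suc avg_single)

lemma avg_W_3: "avg (W k (length [p, p', p''])) \<psi> =
    avg {..<2 ^ k} (\<lambda>u. avg {..<2 ^ k} (\<lambda>u'. avg {..<2 ^ k} (\<lambda>u''. \<psi> [u, u', u''])))"
  by (simp add: avg_W_Suc avg_single)

lemma avg_take_bit: "e \<le> k \<Longrightarrow> (c::nat) < 2 ^ e \<Longrightarrow> avg {..<2 ^ k} (\<lambda>u. of_bool (take_bit e u = c)) = 1 / 2 ^ e"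
  using avg_W_coords[of "[0]" 1 e k "\<lambda>xs. of_bool (xs = [c])"] avg_eq_const[of c e] by (simp add: avg_W_Suc avg_single)

lemma avg_of_bool_conj: "avg A (\<lambda>x. of_bool (p \<and> \<phi> x)) = of_bool p * avg A (\<lambda>x. of_bool (\<phi> x))"
  by (simp add: avg_def)

lemma avg_pos_set: "avg {..<(2::nat) ^ k} (\<lambda>u. c) = c"
  by (simp add: avg_const lessThan_empty_iff)

text \<open>\<open>F\<close> and the point \<open>x\<close> are fixed and only the table
  \<open>g\<close> of one cluster is random. Its first \<open>M\<close> entries lead from values of
  \<open>F\<close> to next points, the last \<open>m\<close> entries are the starting points of the
  chains, which are thus random look-ups at keys outside the range of \<open>F\<close>.\<close>

locale chains =
  fixes k e M m t :: nat and F :: "nat \<Rightarrow> nat" and x :: nat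
  assumes F: "\<And>u. F u < M" and e: "e \<le> k" and m: "2 \<le> m" and t: "1 \<le> t" and x: "x < 2 ^ k"
begin

definition chn :: "nat list \<Rightarrow> nat \<Rightarrow> nat \<Rightarrow> nat" where
  "chn g j c = ((\<lambda>u. g ! F u) ^^ c) (g ! (M + j))"

text \<open>Two chains of \<open>t + 1\<close> points each, joined to one sequence so that they form
  a single adaptive process.\<close>

definition chn2 :: "nat list \<Rightarrow> nat \<Rightarrow> nat \<Rightarrow> nat \<Rightarrow> nat" where
  "chn2 g j j' c = (if c \<le> t then chn g j c else chn g j' (c - Suc t))"

text \<open>Distinctness is required of the values of \<open>F\<close>, because these are the keys
  of the next look-ups. The low \<open>e\<close> bits of the two ends must differ because they
  address the slot in which an end is stored.\<close>

definition good2 :: "nat \<Rightarrow> (nat \<Rightarrow> nat) \<Rightarrow> bool" where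
  "good2 a v \<longleftrightarrow> v a = x \<and> inj_on (\<lambda>c. F (v c)) {..<2 * t + 2} \<and> take_bit e (v t) \<noteq> take_bit e (v (2 * t + 1))"

definition good1 :: "nat \<Rightarrow> (nat \<Rightarrow> nat) \<Rightarrow> bool" where
  "good1 a v \<longleftrightarrow> v a = x \<and> inj_on (\<lambda>c. F (v c)) {..t}"

text \<open>Only pairs that contain chain \<open>j\<close> are constrained; two other chains may
  merge with each other. The failure probability therefore grows linearly in \<open>m\<close> and
  not quadratically.\<close>

definition hit :: "nat list \<Rightarrow> nat \<Rightarrow> nat \<Rightarrow> bool" where
  "hit g j a \<longleftrightarrow> (\<forall>j'<m. j' \<noteq> j \<longrightarrow> good2 a (chn2 g j j'))"

definition lam :: real where
  "lam = avg {..<2 ^ k} (\<lambda>u. avg {..<2 ^ k} (\<lambda>u'. of_bool (F u = F u')))"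

definition wst :: real where
  "wst = avg {..<2 ^ k} (\<lambda>u. of_bool (F u = F x))"

text \<open>Given that position \<open>a\<close> holds \<open>x\<close>, the terms bound a
  coincidence of \<open>F x\<close> with the value at another position, a coincidence among the
  remaining positions, and equal low bits of the ends. The factors come from
  \<open>2 * t + 1 \<le> 4 * t\<close> other positions.\<close>

definition dlt :: real where
  "dlt = 4 * real t * wst + 16 * real t ^ 2 * lam + 1 / 2 ^ e"

lemma dlt_nonneg: "0 \<le> dlt"
  unfolding dlt_def wst_def lam_def by (intro add_nonneg_nonneg mult_nonneg_nonneg avg_nonneg) auto

abbreviation "K \<equiv> M + m"

lemma chn_0: "chn g j 0 = g ! (M + j)"
  and chn_Suc: "chn g j (Suc c) = g ! F (chn g j c)"
  by (simp_all add: chn_def)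

lemma chn_less: "g \<in> W k K \<Longrightarrow> j < m \<Longrightarrow> chn g j c < 2 ^ k"
  using nth_W[of g k K "M + j"] nth_W[of g k K "F (chn g j (c - 1))"] trans_less_add1[OF F]
  by (cases c) (simp_all add: chn_0 chn_Suc)

text \<open>On \<open>good1\<close> no key repeats, so the points count as independent and uniform,
  and of the event only the value at position \<open>a\<close> is kept.\<close>

lemma good1_upper:
  assumes "j < m" "a \<le> t"
  shows "avg (W k K) (\<lambda>g. of_bool (good1 a (chn g j))) \<le> 1 / 2 ^ k"
proof -
  let ?key = "\<lambda>vs c. if c = 0 then M + j else F (vs ! (c - 1))"
  have "avg (W k K) (\<lambda>g. of_bool (good1 a (chn g j))) =
      avg (W k K) (\<lambda>g. (\<lambda>vs. of_bool (good1 a ((!) vs))) (map (chn g j) [0..<Suc t]))"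
    using assms by (intro avg_cong refl arg_cong[where f = of_bool])
      (auto simp: good1_def inj_on_def nth_append less_Suc_eq_le simp del: upt_Suc)
  also have "\<dots> = avg (W k (Suc t)) (\<lambda>vs. of_bool (good1 a ((!) vs)))"
  proof (rule avg_adaptive[where key = ?key])
    fix g assume g: "g \<in> W k K"
    show "map (chn g j) [0..<Suc t] \<in> W k (Suc t)"
      using chn_less[OF g assms(1)] by (simp add: W_iff del: upt_Suc)
    show "map (chn g j) [0..<Suc t] ! c = g ! ?key (map (chn g j) [0..<Suc t]) c" if "c < Suc t" for c
      using that by (cases c) (auto simp: chn_0 chn_Suc simp del: upt_Suc)
  next
    fix vs assume "vs \<in> W k (Suc t)" "of_bool (good1 a ((!) vs)) \<noteq> (0::real)"
    then have "inj_on (\<lambda>c. F (vs ! c)) {..t}"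
      by (simp add: good1_def)
    then have i: "F (vs ! c) = F (vs ! c') \<Longrightarrow> c \<le> t \<Longrightarrow> c' \<le> t \<Longrightarrow> c = c'" for c c'
      by (auto dest: inj_onD)
    have ne: "M + j \<noteq> F u" "F u \<noteq> M + j" for u
      using F[of u] by auto
    show "inj_on (?key vs) {..<Suc t} \<and> (\<forall>c<Suc t. ?key vs c < K)"
    proof (intro conjI inj_onI allI impI)
      fix c c' assume "c \<in> {..<Suc t}" "c' \<in> {..<Suc t}" "?key vs c = ?key vs c'"
      then show "c = c'"
        using i[of "c - 1" "c' - 1"] ne by (cases c; cases c') auto
    qed (use assms F in \<open>auto intro: trans_less_add1\<close>)
  qed auto
  also have "\<dots> \<le> avg (W k (Suc t)) (\<lambda>vs. of_bool (map (\<lambda>z. take_bit k (vs ! z)) [a] = [x]))"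
    using assms by (intro avg_mono) (auto simp: good1_def W_iff take_bit_nat_eq_self)
  also have "\<dots> = avg (W k (length [a])) (\<lambda>vs. of_bool (vs = [x]))"
    using assms by (intro avg_W_coords) auto
  also have "\<dots> = 1 / 2 ^ k"
    using avg_eq_const[OF x] by (simp add: avg_W_Suc avg_single)
  finally show ?thesis .
qed

text \<open>On \<open>good2\<close> no key repeats, so the \<open>2 * t + 2\<close> points count as
  independent and uniform. A union bound inside the event that position \<open>a\<close> holds
  \<open>x\<close> removes the collisions, and every removed term carries the same factor
  \<open>1 / 2 ^ k\<close>.\<close>

lemma good2_lower:
  assumes "j < m" "j' < m" "j \<noteq> j'" "a < t"
  shows "avg (W k K) (\<lambda>g. of_bool (good2 a (chn2 g j j'))) \<ge> (1 - dlt) / 2 ^ k"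
proof -
  let ?r = "2 * t + 2"
  let ?key = "\<lambda>vs c. if c = 0 then M + j else if c = Suc t then M + j' else F (vs ! (c - 1))"
  have eq: "avg (W k K) (\<lambda>g. of_bool (good2 a (chn2 g j j'))) =
      avg (W k K) (\<lambda>g. (\<lambda>vs. of_bool (good2 a ((!) vs))) (map (chn2 g j j') [0..<?r]))"
    using assms by (intro avg_cong refl arg_cong[where f = of_bool])
      (auto simp: good2_def inj_on_def simp del: upt_Suc)
  also have "\<dots> = avg (W k ?r) (\<lambda>vs. of_bool (good2 a ((!) vs)))"
  proof (rule avg_adaptive[where key = ?key])
    fix g assume g: "g \<in> W k K"
    show "map (chn2 g j j') [0..<?r] \<in> W k ?r"
    proof -
      have "chn2 g j j' c < 2 ^ k" for c
        by (simp add: chn2_def chn_less[OF g] assms)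
      then show ?thesis
        by (simp add: W_iff del: upt_Suc)
    qed
    show "map (chn2 g j j') [0..<?r] ! c = g ! ?key (map (chn2 g j j') [0..<?r]) c" if "c < ?r" for c
    proof -
      consider "c = 0" | "c = Suc t" | "0 < c" "c \<le> t" | "Suc t < c" by linarith
      then show ?thesis
      proof cases
        case 3
        then obtain d where "c = Suc d" by (cases c) auto
        with 3 that show ?thesis by (simp add: chn2_def chn_Suc del: upt_Suc)
      next
        case 4
        then have c: "c - Suc t = Suc (c - Suc (Suc t))" "c - 1 - Suc t = c - Suc (Suc t)" by simp_all
        have "map (chn2 g j j') [0..<?r] ! c = chn g j' (Suc (c - Suc (Suc t)))"
          using 4 that c by (simp add: chn2_def del: upt_Suc)
        moreover have "map (chn2 g j j') [0..<?r] ! (c - 1) = (if c - 1 \<le> t then chn g j (c - 1) else chn g j' (c - Suc (Suc t)))"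
          using 4 that by (simp add: chn2_def del: upt_Suc)
        moreover have "\<not> c - 1 \<le> t"
          using 4 by simp
        ultimately show ?thesis using 4 by (simp only: chn_Suc if_False) simp
      qed (use that in \<open>simp_all add: chn2_def chn_0 del: upt_Suc\<close>)
    qed
  next
    fix vs assume "vs \<in> W k ?r" "of_bool (good2 a ((!) vs)) \<noteq> (0::real)"
    then have "inj_on (\<lambda>c. F (vs ! c)) {..<?r}"
      by (simp add: good2_def)
    then have i: "F (vs ! c) = F (vs ! c') \<Longrightarrow> c < ?r \<Longrightarrow> c' < ?r \<Longrightarrow> c = c'" for c c'
      by (auto dest: inj_onD)
    have ne: "M + j \<noteq> F u" "F u \<noteq> M + j" for u j
      using F[of u] by auto
    show "inj_on (?key vs) {..<?r} \<and> (\<forall>c<?r. ?key vs c < K)"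
    proof (intro conjI inj_onI allI impI)
      fix c c' assume "c \<in> {..<?r}" "c' \<in> {..<?r}" "?key vs c = ?key vs c'"
      then show "c = c'"
        using i[of "c - 1" "c' - 1"] ne assms(3) by (cases c; cases c') (auto split: if_splits)
    qed (use assms F in \<open>auto intro: trans_less_add1\<close>)
  qed auto
  finally have eq: "avg (W k K) (\<lambda>g. of_bool (good2 a (chn2 g j j'))) = avg (W k ?r) (\<lambda>vs. of_bool (good2 a ((!) vs)))" .
  let ?A = "\<lambda>vs. of_bool (vs ! a = x) :: real"
  let ?B = "\<lambda>c vs. of_bool (vs ! a = x \<and> F (vs ! c) = F x) :: real"
  let ?C = "\<lambda>c c' vs. of_bool (vs ! a = x \<and> F (vs ! c) = F (vs ! c')) :: real"
  let ?D = "\<lambda>vs. of_bool (vs ! a = x \<and> take_bit e (vs ! t) = take_bit e (vs ! (2 * t + 1))) :: real"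
  let ?I = "{..<?r} - {a}"
  have point: "?A vs - (\<Sum>c\<in>?I. ?B c vs) - (\<Sum>c\<in>?I. \<Sum>c'\<in>?I - {c}. ?C c c' vs) - ?D vs \<le> of_bool (good2 a ((!) vs))" for vs
  proof (cases "vs ! a = x \<and> \<not> good2 a ((!) vs)")
    case False
    have "0 \<le> (\<Sum>c\<in>?I. ?B c vs)" "0 \<le> (\<Sum>c\<in>?I. \<Sum>c'\<in>?I - {c}. ?C c c' vs)" "0 \<le> ?D vs"
      by (intro sum_nonneg, simp)+ simp
    then show ?thesis
      using False by (cases "vs ! a = x") (auto simp: good2_def)
  next
    case True
    then consider "?D vs = 1" | c c' where "c < ?r" "c' < ?r" "c \<noteq> c'" "F (vs ! c) = F (vs ! c')"
      unfolding good2_def inj_on_def by auto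
    then have "1 \<le> (\<Sum>c\<in>?I. ?B c vs) + (\<Sum>c\<in>?I. \<Sum>c'\<in>?I - {c}. ?C c c' vs) + ?D vs"
    proof cases
      case 1
      have "0 \<le> (\<Sum>c\<in>?I. ?B c vs)" "0 \<le> (\<Sum>c\<in>?I. \<Sum>c'\<in>?I - {c}. ?C c c' vs)"
        by (intro sum_nonneg, simp)+
      with 1 show ?thesis by linarith
    next
      case 2
      have nn: "0 \<le> (\<Sum>c\<in>?I. ?B c vs)" "0 \<le> (\<Sum>c\<in>?I. \<Sum>c'\<in>?I - {c}. ?C c c' vs)" "0 \<le> ?D vs"
        by (intro sum_nonneg, simp)+ simp
      show ?thesis
      proof (cases "c = a \<or> c' = a")
        case T: True
        define d where "d = (if c = a then c' else c)"
        have d: "d \<in> ?I" "?B d vs = 1"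
          using T 2 True by (auto simp: d_def)
        have "?B d vs \<le> (\<Sum>c\<in>?I. ?B c vs)"
          using d by (intro member_le_sum) auto
        then show ?thesis
          using nn d by linarith
      next
        case F: False
        have "1 = ?C c c' vs"
          using 2 True by simp
        also have "\<dots> \<le> (\<Sum>c'\<in>?I - {c}. ?C c c' vs)"
          using 2 F by (intro member_le_sum[of c' _ "\<lambda>c'. ?C c c' vs"]) auto
        also have "\<dots> \<le> (\<Sum>c\<in>?I. \<Sum>c'\<in>?I - {c}. ?C c c' vs)"
          using 2 F by (intro member_le_sum[of c _ "\<lambda>c. \<Sum>c'\<in>?I - {c}. ?C c c' vs"]) (auto intro!: sum_nonneg)
        finally show ?thesis
          using nn by linarith
      qed
    qed
    then show ?thesis
      using True by simp
  qed
  have A: "avg (W k ?r) ?A = 1 / 2 ^ k"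
  proof -
    have "avg (W k ?r) ?A = avg (W k ?r) (\<lambda>vs. of_bool (map (\<lambda>z. take_bit k (vs ! z)) [a] = [x]))"
      using assms by (intro avg_cong refl) (auto simp: W_iff take_bit_nat_eq_self)
    also have "\<dots> = avg (W k (length [a])) (\<lambda>vs. of_bool (vs = [x]))"
      using assms by (intro avg_W_coords) auto
    finally show ?thesis
      using avg_eq_const[OF x] by (simp add: avg_W_Suc avg_single)
  qed
  have B: "avg (W k ?r) (?B c) = wst / 2 ^ k" if "c \<in> ?I" for c
  proof -
    have "avg (W k ?r) (?B c) = avg (W k ?r) (\<lambda>vs. (\<lambda>ws. of_bool (ws ! 0 = x \<and> F (ws ! 1) = F x)) (map (\<lambda>z. take_bit k (vs ! z)) [a, c]))"
      using assms that by (intro avg_cong refl) (auto simp: W_iff take_bit_nat_eq_self)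
    also have "\<dots> = avg (W k (length [a, c])) (\<lambda>ws. of_bool (ws ! 0 = x \<and> F (ws ! 1) = F x))"
      using assms that by (intro avg_W_coords) auto
    also have "\<dots> = wst / 2 ^ k"
      unfolding avg_W_2 by (simp add: avg_of_bool_conj wst_def[symmetric])
        (simp only: mult.commute[of _ wst] avg_cmult avg_eq_const[OF x], simp)
    finally show ?thesis .
  qed
  have C: "avg (W k ?r) (?C c c') = lam / 2 ^ k" if "c \<in> ?I" "c' \<in> ?I - {c}" for c c'
  proof -
    have "avg (W k ?r) (?C c c') = avg (W k ?r) (\<lambda>vs. (\<lambda>ws. of_bool (ws ! 0 = x \<and> F (ws ! 1) = F (ws ! 2))) (map (\<lambda>z. take_bit k (vs ! z)) [a, c, c']))"
      using assms that by (intro avg_cong refl) (auto simp: W_iff take_bit_nat_eq_self)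
    also have "\<dots> = avg (W k (length [a, c, c'])) (\<lambda>ws. of_bool (ws ! 0 = x \<and> F (ws ! 1) = F (ws ! 2)))"
      using assms that by (intro avg_W_coords) auto
    also have "\<dots> = lam / 2 ^ k"
      unfolding avg_W_3 by (simp add: avg_of_bool_conj avg_cmult lam_def[symmetric])
        (simp only: mult.commute[of _ lam] avg_cmult avg_eq_const[OF x], simp)
    finally show ?thesis .
  qed
  \<comment> \<open>\<open>a < t\<close> keeps position \<open>a\<close> apart from both ends, so
    three distinct coordinates are involved.\<close>
  have D: "avg (W k ?r) ?D = (1 / 2 ^ e) / 2 ^ k"
  proof -
    let ?\<psi> = "\<lambda>ws. of_bool (ws ! 0 = x \<and> take_bit e (ws ! 1) = take_bit e (ws ! 2)) :: real"
    have "avg (W k ?r) ?D = avg (W k ?r) (\<lambda>vs. ?\<psi> (map (\<lambda>z. take_bit k (vs ! z)) [a, 2 * t + 1, t]))"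
      using assms by (intro avg_cong refl) (auto simp: W_iff take_bit_nat_eq_self)
    also have "\<dots> = avg (W k (length [a, 2 * t + 1, t])) ?\<psi>"
      using assms by (intro avg_W_coords) auto
    also have "\<dots> = (1 / 2 ^ e) / 2 ^ k"
    proof -
      have "avg {..<2 ^ k} (\<lambda>u''. of_bool (take_bit e u' = take_bit e u'')) = (1 / 2 ^ e :: real)" for u' :: nat
        unfolding eq_commute[of "take_bit e u'"] by (intro avg_take_bit[OF e]) simp
      then have "avg {..<2 ^ k :: nat} (\<lambda>u'. avg {..<2 ^ k :: nat} (\<lambda>u''. of_bool (take_bit e u' = take_bit e u''))) = (1 / 2 ^ e :: real)"
        by (simp add: avg_pos_set)
      then show ?thesis
        unfolding avg_W_3 by (simp add: avg_of_bool_conj avg_cmult)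
          (simp only: mult.commute[of _ "1 / _"] avg_cmult avg_eq_const[OF x] times_divide_eq_right[symmetric] avg_divide, simp)
    qed
    finally show ?thesis .
  qed
  have lw: "0 \<le> lam" "0 \<le> wst"
    by (simp_all add: lam_def wst_def avg_nonneg)
  have card: "card ?I \<le> 4 * t"
    using t by (auto simp: card_Diff_subset_Int intro: order_trans[OF diff_le_self])
  have "(\<Sum>c\<in>?I. avg (W k ?r) (?B c)) \<le> 4 * real t * wst / 2 ^ k"
  proof -
    have "(\<Sum>c\<in>?I. avg (W k ?r) (?B c)) = (\<Sum>c\<in>?I. wst / 2 ^ k)"
      by (intro sum.cong refl B)
    also have "\<dots> = real (card ?I) * (wst / 2 ^ k)"
      by (rule sum_constant)
    also have "\<dots> \<le> real (4 * t) * (wst / 2 ^ k)"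
      using card lw by (intro mult_right_mono) (simp_all only: of_nat_le_iff, simp)
    finally show ?thesis by simp
  qed
  moreover have "(\<Sum>c\<in>?I. \<Sum>c'\<in>?I - {c}. avg (W k ?r) (?C c c')) \<le> 16 * real t ^ 2 * lam / 2 ^ k"
  proof -
    have "(\<Sum>c\<in>?I. \<Sum>c'\<in>?I - {c}. avg (W k ?r) (?C c c')) \<le> (\<Sum>c\<in>?I. \<Sum>c'\<in>?I. lam / 2 ^ k)"
      using lw by (intro sum_mono order_trans[OF eq_refl[OF sum.cong[OF refl C]] sum_mono2]) auto
    also have "\<dots> = real (card ?I) * real (card ?I) * (lam / 2 ^ k)"
      unfolding sum_constant by simp
    also have "\<dots> \<le> real (4 * t) * real (4 * t) * (lam / 2 ^ k)"
      using card lw by (intro mult_right_mono mult_mono) (simp_all only: of_nat_le_iff, simp_all)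
    finally show ?thesis
      by (simp add: power2_eq_square)
  qed
  moreover have "avg (W k ?r) (\<lambda>vs. ?A vs - (\<Sum>c\<in>?I. ?B c vs) - (\<Sum>c\<in>?I. \<Sum>c'\<in>?I - {c}. ?C c c' vs) - ?D vs)
      \<le> avg (W k ?r) (\<lambda>vs. of_bool (good2 a ((!) vs)))"
    by (intro avg_mono point)
  moreover have "(1 - dlt) / 2 ^ k = 1 / 2 ^ k - 4 * real t * wst / 2 ^ k - 16 * real t ^ 2 * lam / 2 ^ k - (1 / 2 ^ e) / 2 ^ k"
    unfolding dlt_def by (simp add: diff_divide_distrib add_divide_distrib)
  ultimately show ?thesis
    unfolding eq avg_diff avg_sum A D by linarith
qed

section \<open>Probability that a cluster covers the point\<close>

lemma good2_good1: "good2 a (chn2 g j j') \<Longrightarrow> a \<le> t \<Longrightarrow> good1 a (chn g j)"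
  unfolding good1_def good2_def by (auto simp: inj_on_def chn2_def)

lemma hit_D:
  assumes "hit g j a" "j' < m" "j' \<noteq> j" "a \<le> t"
  shows "chn g j a = x"
    and "\<And>c c'. c \<le> t \<Longrightarrow> c' \<le> t \<Longrightarrow> F (chn g j c) = F (chn g j c') \<Longrightarrow> c = c'"
    and "\<And>c c'. c \<le> t \<Longrightarrow> c' \<le> t \<Longrightarrow> F (chn g j c) \<noteq> F (chn g j' c')"
    and "take_bit e (chn g j t) \<noteq> take_bit e (chn g j' t)"
proof -
  have g: "good2 a (chn2 g j j')"
    using assms by (simp add: hit_def)
  then have i: "F (chn2 g j j' c) = F (chn2 g j j' c') \<Longrightarrow> c < 2 * t + 2 \<Longrightarrow> c' < 2 * t + 2 \<Longrightarrow> c = c'" for c c'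
    by (auto simp: good2_def dest: inj_onD)
  show "chn g j a = x" "take_bit e (chn g j t) \<noteq> take_bit e (chn g j' t)"
    using g assms(4) by (auto simp: good2_def chn2_def)
  show "c = c'" if "c \<le> t" "c' \<le> t" "F (chn g j c) = F (chn g j c')" for c c'
    using i[of c c'] that by (simp add: chn2_def)
  show "F (chn g j c) \<noteq> F (chn g j' c')" if "c \<le> t" "c' \<le> t" for c c'
    using i[of c "Suc t + c'"] that by (auto simp: chn2_def)
qed

lemma exists_other: "\<exists>j'<m. j' \<noteq> j"
  using m by (intro exI[of _ "if j = 0 then 1 else 0"]) auto

text \<open>A second occurrence of \<open>x\<close> would repeat the value \<open>F x\<close>. The
  events \<open>hit\<close> are therefore disjoint, and their probabilities add up without
  loss.\<close>

lemma hit_unique: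
  assumes "hit g j a" "hit g j' a'" "j < m" "j' < m" "a < t" "a' < t"
  shows "j = j' \<and> a = a'"
proof -
  have 1: "chn g j a = x" "chn g j' a' = x"
    using exists_other hit_D(1) assms by (meson less_imp_le)+
  show ?thesis
  proof (cases "j = j'")
    case True
    obtain j2 where "j2 < m" "j2 \<noteq> j"
      using exists_other by blast
    then show ?thesis
      using hit_D(2)[OF assms(1), of j2 a a'] 1 assms True by auto
  next
    case False
    then show ?thesis
      using hit_D(3)[OF assms(1), of j' a a'] 1 assms by auto
  qed
qed

definition hits :: "nat list \<Rightarrow> bool" where
  "hits g \<longleftrightarrow> (\<exists>j<m. \<exists>a<t. hit g j a)"

lemma of_bool_hits: "of_bool (hits g) = (\<Sum>j<m. \<Sum>a<t. of_bool (hit g j a) :: real)"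
proof (cases "hits g")
  case True
  then obtain j a where ja: "j < m" "a < t" "hit g j a"
    by (auto simp: hits_def)
  then have "(\<Sum>j'<m. \<Sum>a'<t. of_bool (hit g j' a') :: real) = (\<Sum>j'<m. \<Sum>a'<t. if j' = j then if a' = a then 1 else 0 else 0)"
  proof (intro sum.cong refl)
    fix j' a' assume *: "j' \<in> {..<m}" "a' \<in> {..<t}"
    have "hit g j' a' \<longleftrightarrow> j' = j \<and> a' = a"
    proof
      assume "hit g j' a'"
      from hit_unique[OF ja(3) this ja(1) _ ja(2)] show "j' = j \<and> a' = a"
        using * by simp
    qed (use ja(3) in simp)
    then show "(of_bool (hit g j' a') :: real) = (if j' = j then if a' = a then 1 else 0 else 0)"
      by simp
  qed
  also have "\<dots> = (\<Sum>j'<m. if j' = j then \<Sum>a'<t. if a' = a then 1 else 0 else 0)"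
    by (intro sum.cong refl) auto
  also have "\<dots> = 1"
    using ja by simp
  finally show ?thesis
    using True by simp
next
  case False
  then show ?thesis
    by (auto simp: hits_def)
qed

lemma hit_upper: "j < m \<Longrightarrow> a < t \<Longrightarrow> avg (W k K) (\<lambda>g. of_bool (hit g j a)) \<le> 1 / 2 ^ k"
proof (rule order_trans[OF _ good1_upper[of j a]])
  assume "j < m" "a < t"
  obtain j' where "j' < m" "j' \<noteq> j"
    using exists_other by blast
  then show "avg (W k K) (\<lambda>g. of_bool (hit g j a)) \<le> avg (W k K) (\<lambda>g. of_bool (good1 a (chn g j)))"
    using good2_good1 \<open>a < t\<close> by (intro avg_mono) (auto simp: hit_def)
qed auto

text \<open>A union bound relative to \<open>good1\<close>, without conditional probabilities. Each
  \<open>good2\<close> lies inside \<open>good1\<close>, so the left side of the pointwise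
  inequality is 1 if all \<open>m - 1\<close> of them hold and at most 0 if one fails. For small
  \<open>dlt\<close>, \<open>good2\<close> is nearly as likely as \<open>good1\<close>, and the
  multiples \<open>m - 1\<close> and \<open>m - 2\<close> leave about one unit of
  \<open>1 / 2 ^ k\<close>.\<close>

lemma hit_lower:
  assumes "j < m" "a < t"
  shows "(1 - real m * dlt) / 2 ^ k \<le> avg (W k K) (\<lambda>g. of_bool (hit g j a))"
proof -
  let ?J = "{..<m} - {j}"
  have card: "card ?J = m - 1"
    using assms by simp
  have point: "(\<Sum>j'\<in>?J. of_bool (good2 a (chn2 g j j'))) - real (m - 2) * of_bool (good1 a (chn g j)) \<le> (of_bool (hit g j a) :: real)" for g
  proof (cases "hit g j a")
    case True
    then have "(\<Sum>j'\<in>?J. of_bool (good2 a (chn2 g j j')) :: real) = (\<Sum>j'\<in>?J. 1)"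
      by (intro sum.cong refl) (auto simp: hit_def)
    moreover have "good1 a (chn g j)"
      using exists_other True good2_good1 assms unfolding hit_def by (meson less_imp_le)
    ultimately show ?thesis
      using True m by (simp add: card)
  next
    case False
    then obtain j' where j': "j' \<in> ?J" "\<not> good2 a (chn2 g j j')"
      by (auto simp: hit_def)
    have "(\<Sum>i\<in>?J. of_bool (good2 a (chn2 g j i)) :: real) = (\<Sum>i\<in>?J - {j'}. of_bool (good2 a (chn2 g j i)))"
      using j' by (intro sum.mono_neutral_right) auto
    also have "\<dots> \<le> (\<Sum>i\<in>?J - {j'}. of_bool (good1 a (chn g j)))"
      using good2_good1 assms by (intro sum_mono) auto
    also have "\<dots> = real (m - 2) * of_bool (good1 a (chn g j))"
      using j' card by (simp add: numeral_2_eq_2)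
    finally show ?thesis
      using False by simp
  qed
  have "(\<Sum>j'\<in>?J. (1 - dlt) / 2 ^ k) - real (m - 2) * (1 / 2 ^ k) \<le>
      (\<Sum>j'\<in>?J. avg (W k K) (\<lambda>g. of_bool (good2 a (chn2 g j j')))) - real (m - 2) * avg (W k K) (\<lambda>g. of_bool (good1 a (chn g j)))"
    using good1_upper[of j a] assms by (intro diff_mono sum_mono good2_lower mult_left_mono) auto
  also have "\<dots> \<le> avg (W k K) (\<lambda>g. of_bool (hit g j a))"
    unfolding avg_sum[symmetric] avg_cmult[symmetric] avg_diff[symmetric] by (intro avg_mono point)
  finally have "real (m - 1) * ((1 - dlt) / 2 ^ k) - real (m - 2) * (1 / 2 ^ k) \<le> avg (W k K) (\<lambda>g. of_bool (hit g j a))"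
    unfolding sum_constant card .
  moreover have "real (m - 1) * ((1 - dlt) / 2 ^ k) - real (m - 2) * (1 / 2 ^ k) = (1 - (real m - 1) * dlt) / 2 ^ k"
    using m by (simp add: of_nat_diff field_simps)
  moreover have "(1 - real m * dlt) / 2 ^ k \<le> (1 - (real m - 1) * dlt) / 2 ^ k"
    using dlt_nonneg by (intro divide_right_mono) (auto simp: algebra_simps)
  ultimately show ?thesis
    by linarith
qed

lemma hits_bounds:
  shows "avg (W k K) (\<lambda>g. of_bool (hits g)) \<le> real (m * t) / 2 ^ k"
    and "real (m * t) / 2 ^ k * (1 - real m * dlt) \<le> avg (W k K) (\<lambda>g. of_bool (hits g))"
proof -
  have eq: "avg (W k K) (\<lambda>g. of_bool (hits g)) = (\<Sum>j<m. \<Sum>a<t. avg (W k K) (\<lambda>g. of_bool (hit g j a)))"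
    by (simp only: of_bool_hits avg_sum)
  have "\<dots> \<le> (\<Sum>j<m. \<Sum>a<t. 1 / 2 ^ k)"
    by (intro sum_mono hit_upper) auto
  then show "avg (W k K) (\<lambda>g. of_bool (hits g)) \<le> real (m * t) / 2 ^ k"
    unfolding eq by simp
  have "(\<Sum>j<m. \<Sum>a<t. (1 - real m * dlt) / 2 ^ k) \<le> (\<Sum>j<m. \<Sum>a<t. avg (W k K) (\<lambda>g. of_bool (hit g j a)))"
    by (intro sum_mono hit_lower) auto
  then show "real (m * t) / 2 ^ k * (1 - real m * dlt) \<le> avg (W k K) (\<lambda>g. of_bool (hits g))"
    unfolding eq by simp
qed

text \<open>The tables of distinct clusters are only pairwise independent, which suffices for Bonferroni's inequality.\<close>

lemma clusters_lower:
  assumes lmt: "2 ^ q * (m * t) = (2::nat) ^ k" and q: "0 < q" and k: "k \<le> b"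
  shows "(1 - real m * dlt) / 2 \<le> avg (W b ((q + 1) * K)) (\<lambda>T. of_bool (\<exists>i<2 ^ q. hits (hrow k q K T i)))"
proof -
  let ?W = "W b ((q + 1) * K)" and ?l = "2 ^ q :: nat"
  let ?h = "\<lambda>i T. of_bool (hits (hrow k q K T i)) :: real"
  define p where "p = avg (W k K) (\<lambda>g. of_bool (hits g) :: real)"
  have K: "0 < K"
    using m by simp
  have p1: "avg ?W (?h i) = p" if "i < ?l" for i
    unfolding p_def using that q k K by (rule avg_hrow)
  have p2: "avg ?W (\<lambda>T. ?h i T * ?h j T) = p * p" if "i < ?l" "j < ?l" "i \<noteq> j" for i j
  proof -
    have "avg ?W (\<lambda>T. ?h i T * ?h j T) = avg (W k K) (\<lambda>g. avg (W k K) (\<lambda>g'. of_bool (hits g) * of_bool (hits g')))"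
      using that k K by (rule avg_hrow_pair)
    also have "(\<lambda>g. avg (W k K) (\<lambda>g'. of_bool (hits g) * of_bool (hits g'))) = (\<lambda>g. p * (of_bool (hits g) :: real))"
      unfolding avg_cmult p_def by (rule ext) (rule mult.commute)
    finally show ?thesis
      unfolding avg_cmult p_def .
  qed
  \<comment> \<open>By induction on the number of clusters: after a hit has occurred, each further
    one is paid for by its pair with an earlier hit.\<close>
  have point: "(\<Sum>i<?l. ?h i T) - (\<Sum>i<?l. \<Sum>j<i. ?h i T * ?h j T) \<le> of_bool (\<exists>i<?l. hits (hrow k q K T i))" for T
  proof -
    have "(\<Sum>i<n. ?h i T) - (\<Sum>i<n. \<Sum>j<i. ?h i T * ?h j T) \<le> of_bool (\<exists>i<n. hits (hrow k q K T i))" for n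
    proof (induction n)
      case (Suc n)
      show ?case
      proof (cases "\<exists>i<n. hits (hrow k q K T i)")
        case True
        then obtain i where i: "i < n" "?h i T = 1" by auto
        have "?h i T \<le> (\<Sum>j<n. ?h j T)"
          using i by (intro member_le_sum) auto
        then have "?h n T * 1 \<le> ?h n T * (\<Sum>j<n. ?h j T)"
          using i by (intro mult_left_mono) auto
        moreover have "of_bool (\<exists>i<n. hits (hrow k q K T i)) = (1::real)" "of_bool (\<exists>i<Suc n. hits (hrow k q K T i)) = (1::real)"
          using True less_Suc_eq by auto
        ultimately show ?thesis
          using Suc.IH unfolding sum.lessThan_Suc sum_distrib_left[symmetric] by linarith
      next
        case False
        then have "(\<Sum>j<n. ?h n T * ?h j T) = 0" "(\<exists>i<Suc n. hits (hrow k q K T i)) = hits (hrow k q K T n)"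
          by (auto simp: less_Suc_eq)
        then show ?thesis
          using Suc.IH False by simp
      qed
    qed simp
    then show ?thesis .
  qed
  have "avg ?W (\<lambda>T. (\<Sum>i<?l. ?h i T) - (\<Sum>i<?l. \<Sum>j<i. ?h i T * ?h j T)) \<le> avg ?W (\<lambda>T. of_bool (\<exists>i<?l. hits (hrow k q K T i)))"
    by (intro avg_mono point)
  moreover have "avg ?W (\<lambda>T. (\<Sum>i<?l. ?h i T) - (\<Sum>i<?l. \<Sum>j<i. ?h i T * ?h j T)) =
     (\<Sum>i<?l. avg ?W (?h i)) - (\<Sum>i<?l. \<Sum>j<i. avg ?W (\<lambda>T. ?h i T * ?h j T))"
    by (simp only: avg_diff avg_sum)
  moreover have "(\<Sum>i<?l. avg ?W (?h i)) = (\<Sum>i<?l. p)"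
    by (intro sum.cong refl p1) auto
  moreover have "(\<Sum>i<?l. \<Sum>j<i. avg ?W (\<lambda>T. ?h i T * ?h j T)) = (\<Sum>i<?l. \<Sum>j<i. p * p)"
    by (intro sum.cong refl p2) auto
  moreover have "(\<Sum>i<?l. \<Sum>j<i. p * p) \<le> (real ?l * p) ^ 2 / 2"
  proof -
    have "(\<Sum>i<n. \<Sum>j<i. p * p) = real n * (real n - 1) / 2 * (p * p)" for n :: nat
      by (induction n) (auto simp: field_simps)
    then have "(\<Sum>i<?l. \<Sum>j<i. p * p) = real ?l * (real ?l - 1) / 2 * (p * p)" .
    also have "\<dots> \<le> real ?l * real ?l / 2 * (p * p)"
      by (intro mult_right_mono divide_right_mono mult_left_mono) auto
    also have "\<dots> = (real ?l * p) ^ 2 / 2"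
      by (simp only: power2_eq_square) simp
    finally show ?thesis .
  qed
  ultimately have *: "real ?l * p - (real ?l * p) ^ 2 / 2 \<le> avg ?W (\<lambda>T. of_bool (\<exists>i<?l. hits (hrow k q K T i)))"
    by simp
  \<comment> \<open>The clusters provide exactly \<open>2 ^ k\<close> positions, so the expected
    number \<open>y\<close> of clusters with a hit is at most 1, and there
    \<open>y - y ^ 2 / 2\<close> is at least \<open>y / 2\<close>.\<close>
  have lm: "real ?l * (real (m * t) / 2 ^ k) = 1"
  proof -
    have "real ?l * (real (m * t) / 2 ^ k) = real (2 ^ q * (m * t)) / 2 ^ k"
      by (simp only: of_nat_mult times_divide_eq_right)
    also have "\<dots> = 1"
      unfolding lmt by simp
    finally show ?thesis .
  qed
  have "real ?l * p \<le> real ?l * (real (m * t) / 2 ^ k)"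
    using hits_bounds(1) unfolding p_def by (intro mult_left_mono) auto
  then have le1: "real ?l * p \<le> 1"
    using lm by linarith
  have "real ?l * (real (m * t) / 2 ^ k * (1 - real m * dlt)) \<le> real ?l * p"
    using hits_bounds(2) unfolding p_def by (intro mult_left_mono) auto
  then have ge: "1 - real m * dlt \<le> real ?l * p"
    using lm by (simp only: mult.assoc[symmetric] mult_1_left)
  have "0 \<le> real ?l * p"
    unfolding p_def by (intro mult_nonneg_nonneg avg_nonneg) auto
  then have "(real ?l * p) ^ 2 \<le> real ?l * p"
    using le1 by (simp only: power2_eq_square mult_left_le)
  moreover have "d / 2 \<le> z" if "y - y ^ 2 / 2 \<le> z" "y ^ 2 \<le> y" "d \<le> y" for y z d :: real
    using that by linarith
  ultimately show ?thesis
    using * ge by blast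
qed

end

section \<open>One block of the inversion structure\<close>

text \<open>Later samples overwrite earlier ones, and samples not below \<open>N\<close> are
  dropped. An empty cell shows 0, which is a legal argument: an entry is trusted only after the
  function has been evaluated at it.\<close>

fun tab :: "nat \<Rightarrow> (nat \<Rightarrow> nat) \<Rightarrow> (nat \<Rightarrow> nat) \<Rightarrow> (nat \<Rightarrow> nat) \<Rightarrow> nat \<Rightarrow> nat \<Rightarrow> nat" where
  "tab N fs hv sp 0 = (\<lambda>_. 0)"
| "tab N fs hv sp (Suc s) = (if sp s < N then (tab N fs hv sp s)(hv (fs (sp s)) := sp s) else tab N fs hv sp s)"

lemma tab_cong:
  "(\<And>i. i < s \<Longrightarrow> sp i = sp' i) \<Longrightarrow> (\<And>u. u < N \<Longrightarrow> hv (fs u) = hv' (fs u)) \<Longrightarrow> tab N fs hv sp s = tab N fs hv' sp' s"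
  by (induction s) auto

lemma tab_less: "0 < N \<Longrightarrow> tab N fs hv sp s z < N"
  by (induction s) auto

lemma of_bool_le_sum: "(P \<Longrightarrow> P1 \<or> P2 \<or> P3 \<or> P4 \<or> P5) \<Longrightarrow>
    (of_bool P :: real) \<le> of_bool P1 + (of_bool P2 + (of_bool P3 + (of_bool P4 + of_bool P5)))"
  by (auto simp: of_bool_def)

lemma avg_card_take_bit:
  fixes S :: "nat set"
  assumes "k \<le> b" "S \<subseteq> {..<2 ^ k}"
  shows "avg {..<2 ^ b} (\<lambda>v. of_bool (take_bit k v \<in> S)) = real (card S) / 2 ^ k"
proof -
  have "(\<lambda>v. of_bool (take_bit k v \<in> S)) = (\<lambda>v. \<Sum>c\<in>S. of_bool (take_bit k v = c) :: real)"
    using finite_subset[OF assms(2)] by (intro ext) (simp add: of_bool_def)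
  then have "avg {..<2 ^ b} (\<lambda>v. of_bool (take_bit k v \<in> S)) = (\<Sum>c\<in>S. avg {..<2 ^ b} (\<lambda>v. of_bool (take_bit k v = c)))"
    by (simp only: avg_sum)
  also have "\<dots> = (\<Sum>c\<in>S. 1 / 2 ^ k)"
    using assms by (intro sum.cong refl avg_take_bit) auto
  finally show ?thesis
    by simp
qed

text \<open>The last sample makes the cell wrong if it falls into \<open>S - T\<close>, right if
  into \<open>T\<close>, and leaves it alone outside \<open>S\<close>. This is a linear recursion
  whose fixed point is the share of \<open>S - T\<close> in \<open>S\<close>; the distance to it
  shrinks by the factor \<open>1 - card S / 2 ^ k\<close> per sample.\<close>

lemma unmarked_recursion:
  assumes "N \<le> 2 ^ k" "k \<le> b" and y: "x0 < N" "fs x0 = y"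
    and S: "S = {x. x < N \<and> hv (fs x) = hv y}" and T: "T = {x. x < N \<and> fs x = y}"
  shows "avg (W b s) (\<lambda>\<gamma>. of_bool (fs (tab N fs hv (\<lambda>i. take_bit k (\<gamma> ! i)) s (hv y)) \<noteq> y)) \<le>
    (real (card S) - real (card T)) / real (card S) + (1 - real (card S) / 2 ^ k) ^ s"
proof (induction s)
  case 0
  have "finite S" "T \<subseteq> S" "x0 \<in> S"
    using y by (auto simp: S T)
  then have "0 < card S" "card T \<le> card S"
    by (auto simp: card_gt_0_iff card_mono)
  then have "0 \<le> (real (card S) - real (card T)) / real (card S)"
    by simp
  then show ?case
    by (auto simp: avg_single)
next
  case (Suc s)
  let ?u = "\<lambda>\<gamma>. of_bool (fs (tab N fs hv (\<lambda>i. take_bit k (\<gamma> ! i)) s (hv y)) \<noteq> y) :: real"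
  have fin: "finite S" "T \<subseteq> S" "x0 \<in> S" "S \<subseteq> {..<2 ^ k}"
    using y assms(1) by (auto simp: S T)
  then have c: "0 < card S" "card T \<le> card S" "card S \<le> 2 ^ k"
    using card_mono[OF _ fin(4)] by (auto simp: card_gt_0_iff card_mono)
  define p where "p = real (card S) / 2 ^ k"
  have p: "0 < p" "p \<le> 1"
    using c by (auto simp: p_def intro: order_trans[OF of_nat_mono[OF c(3)]])
  have "avg (W b (Suc s)) (\<lambda>\<gamma>. of_bool (fs (tab N fs hv (\<lambda>i. take_bit k (\<gamma> ! i)) (Suc s) (hv y)) \<noteq> y))
     = avg (W b s) (\<lambda>\<gamma>. avg {..<2 ^ b} (\<lambda>v. of_bool (take_bit k v \<in> S - T) + ?u \<gamma> * (1 - of_bool (take_bit k v \<in> S))))"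
    unfolding avg_W_snoc
  proof (intro avg_cong refl)
    fix \<gamma> and v :: nat assume \<gamma>: "\<gamma> \<in> W b s"
    have "tab N fs hv (\<lambda>i. take_bit k ((\<gamma> @ [v]) ! i)) s = tab N fs hv (\<lambda>i. take_bit k (\<gamma> ! i)) s"
      using \<gamma> by (intro tab_cong) (auto simp: nth_append length_W)
    then show "of_bool (fs (tab N fs hv (\<lambda>i. take_bit k ((\<gamma> @ [v]) ! i)) (Suc s) (hv y)) \<noteq> y) =
        of_bool (take_bit k v \<in> S - T) + ?u \<gamma> * (1 - of_bool (take_bit k v \<in> S))"
      using length_W[OF \<gamma>] by (auto simp: nth_append S T)
  qed
  also have "\<dots> = avg (W b s) (\<lambda>\<gamma>. real (card (S - T)) / 2 ^ k + ?u \<gamma> * (1 - p))"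
    unfolding avg_add avg_diff avg_cmult p_def avg_card_take_bit[OF assms(2) fin(4)]
      avg_card_take_bit[OF assms(2) subset_trans[OF Diff_subset fin(4)]] avg_pos_set ..
  also have "\<dots> = real (card (S - T)) / 2 ^ k + (1 - p) * avg (W b s) ?u"
    by (simp only: avg_add mult.commute[of _ "1 - p"] avg_cmult avg_const[OF finite_W W_nonempty])
  also have "\<dots> \<le> real (card (S - T)) / 2 ^ k + (1 - p) * ((real (card S) - real (card T)) / real (card S) + (1 - p) ^ s)"
    using Suc.IH p unfolding p_def by (intro add_left_mono mult_left_mono) auto
  also have "real (card (S - T)) / 2 ^ k = p * ((real (card S) - real (card T)) / real (card S))"
    using fin c finite_subset[OF fin(2,1)] by (auto simp: card_Diff_subset of_nat_diff p_def)
  also have "p * d + (1 - p) * (d + r) = d + (1 - p) * r" for d r :: real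
    by (simp add: algebra_simps)
  finally show ?case
    unfolding p_def[symmetric] power_Suc .
qed

text \<open>Bernoulli's inequality bounds \<open>s * p\<close> by \<open>(1 + p) ^ s\<close>, and
  \<open>(1 - p) * (1 + p)\<close> is at most 1.\<close>

lemma power_le_inverse: "0 < p \<Longrightarrow> p \<le> 1 \<Longrightarrow> 0 < s \<Longrightarrow> (1 - p) ^ s \<le> 1 / (real s * p)"
proof -
  assume p: "0 < p" "p \<le> 1" "0 < s"
  have "(1 - p) ^ s * (real s * p) \<le> (1 - p) ^ s * (1 + p) ^ s"
    using p Bernoulli_inequality[of p s] by (intro mult_left_mono) auto
  also have "\<dots> = (1 - p * p) ^ s"
    by (simp add: power_mult_distrib[symmetric] algebra_simps)
  also have "\<dots> \<le> 1"
    using p by (intro power_le_one) (auto simp: mult_le_one)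
  finally show ?thesis
    using p by (simp add: field_simps)
qed

text \<open>\<open>9 \<le> kt\<close> makes \<open>mu\<close> at most \<open>k\<close>, and
  \<open>3 * kt + 1 \<le> k\<close> makes \<open>m\<close> at least 2, as the analysis of the chains
  demands.\<close>

locale prm =
  fixes b w N k kt :: nat
  assumes N: "1 \<le> N" "N \<le> 2 ^ k" and k: "k \<le> b" and kt: "9 \<le> kt" "3 * kt + 1 \<le> k" and mu_le: "k - kt + 9 \<le> b"
begin

text \<open>The 9 makes \<open>M\<close> equal to \<open>512 * m * t ^ 2\<close>, and the 3 in
  \<open>e\<close> gives each cluster \<open>8 * m\<close> slots. With these constants,
  \<open>m\<close> times the average collision term is at most
  \<open>128 / 512 + 1 / 8\<close>.\<close>

definition "mu = k - kt + 9"
definition "M = (2::nat) ^ mu"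
definition "t = (2::nat) ^ kt"
definition "q = 2 * kt"
definition "m = (2::nat) ^ (k - 3 * kt)"
definition "e = k - 3 * kt + 3"
definition "K = M + m"
text \<open>The random words of a block, in this order: the hash of values, the hash of arguments,
  the samples, the interleaved tables of the clusters.\<close>

definition "BL = (w + 1) + ((k + 1) + (M + (q + 1) * K))"

lemma pow2_ge2: "1 \<le> j \<Longrightarrow> 2 \<le> (2::nat) ^ j"
  using power_increasing[of 1 j "2::nat"] by simp

lemma bounds: "2 \<le> m" "1 \<le> t" "e \<le> k" "0 < q" "mu \<le> b" "mu \<le> k" "0 < M" "M \<le> 2 ^ k" "0 < K"
  using kt mu_le by (auto simp: m_def t_def e_def q_def mu_def M_def K_def intro!: pow2_ge2)

lemma lmt: "2 ^ q * (m * t) = 2 ^ k"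
  using kt by (simp add: m_def t_def q_def power_add[symmetric])

lemma mt2M: "m * t ^ 2 * 512 = M"
proof -
  have "m * t ^ 2 * 2 ^ 9 = M"
    unfolding m_def t_def M_def mu_def power_mult[symmetric] power_add[symmetric]
    using kt by (intro arg_cong[where f = "\<lambda>i. 2 ^ i"]) simp
  then show ?thesis by simp
qed

lemma mE: "8 * m = 2 ^ e"
  by (simp add: m_def e_def power_add)

definition h :: "(nat \<Rightarrow> nat) \<Rightarrow> nat \<Rightarrow> nat" where
  "h X v = take_bit mu (hx X 1 w v)"

definition h' :: "(nat \<Rightarrow> nat) \<Rightarrow> nat \<Rightarrow> nat" where
  "h' X u = take_bit mu (hx (\<lambda>i. X (w + 1 + i)) 1 k u)"

definition smp :: "(nat \<Rightarrow> nat) \<Rightarrow> nat \<Rightarrow> nat" where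
  "smp X s = take_bit k (X (w + k + 2 + s))"

definition gg :: "(nat \<Rightarrow> nat) \<Rightarrow> nat \<Rightarrow> nat \<Rightarrow> nat" where
  "gg X i z = take_bit k (hx (\<lambda>c. X (w + k + 2 + M + z + c)) K q i)"

definition row :: "(nat \<Rightarrow> nat) \<Rightarrow> nat \<Rightarrow> nat list" where
  "row X i = map (gg X i) [0..<K]"

definition hl :: "nat list \<Rightarrow> nat \<Rightarrow> nat" where
  "hl \<alpha> v = take_bit mu (hx ((!) \<alpha>) 1 w v)"

definition hl' :: "nat list \<Rightarrow> nat \<Rightarrow> nat" where
  "hl' \<beta> u = take_bit mu (hx ((!) \<beta>) 1 k u)"

lemma h_less: "h X v < M" and h'_less: "h' X v < M" and hl_less: "hl \<alpha> v < M" and hl'_less: "hl' \<alpha> v < M"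
  by (simp_all add: h_def h'_def M_def hl_def hl'_def)

lemma append_parts:
  assumes "\<alpha> \<in> W b (w + 1)" "\<beta> \<in> W b (k + 1)" "\<gamma> \<in> W b M" "T \<in> W b ((q + 1) * K)"
  defines "X \<equiv> (!) (\<alpha> @ (\<beta> @ (\<gamma> @ T)))"
  shows "h X = hl \<alpha>" and "h' X = hl' \<beta>" and "s < M \<Longrightarrow> smp X s = take_bit k (\<gamma> ! s)" and "row X i = hrow k q K T i"
proof -
  note l = length_W[OF assms(1)] length_W[OF assms(2)] length_W[OF assms(3)]
  show "h X = hl \<alpha>"
    unfolding h_def hl_def using l by (intro ext arg_cong[where f = "take_bit mu"] hx_cong) (auto simp: X_def nth_append)
  show "h' X = hl' \<beta>"
    unfolding h'_def hl'_def using l by (intro ext arg_cong[where f = "take_bit mu"] hx_cong) (auto simp: X_def nth_append)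
  show "smp X s = take_bit k (\<gamma> ! s)" if "s < M"
    unfolding smp_def using l that by (auto simp: X_def nth_append)
  show "row X i = hrow k q K T i"
    unfolding row_def hrow_def gg_def using l
    by (intro map_cong refl arg_cong[where f = "take_bit k"] hx_cong) (auto simp: X_def nth_append)
qed

end

section \<open>The random map of a block and its collision probability\<close>

locale blk = prm +
  fixes fs :: "nat \<Rightarrow> nat"
  assumes fs: "\<And>x. x < N \<Longrightarrow> fs x < 2 ^ w"
begin

definition HT :: "(nat \<Rightarrow> nat) \<Rightarrow> nat \<Rightarrow> nat" where
  "HT X = tab N fs (h X) (smp X) M"

text \<open>Numbers from \<open>N\<close> on have no value; they are treated like arguments whose
  value the table answers, which makes the map total on words of \<open>k\<close> bits.\<close>

definition F :: "(nat \<Rightarrow> nat) \<Rightarrow> nat \<Rightarrow> nat" where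
  "F X u = (if u < N \<and> fs (HT X (h X (fs u))) \<noteq> fs u then h X (fs u) else h' X u)"

definition bgood :: "(nat \<Rightarrow> nat) \<Rightarrow> nat \<Rightarrow> bool" where
  "bgood X x \<longleftrightarrow> fs (HT X (h X (fs x))) = fs x \<or> (\<exists>i<2 ^ q. chains.hits e M m t (F X) x (row X i))"

definition unm :: "nat list \<Rightarrow> nat list \<Rightarrow> nat \<Rightarrow> bool" where
  "unm \<alpha> \<gamma> y \<longleftrightarrow> fs (tab N fs (hl \<alpha>) (\<lambda>i. take_bit k (\<gamma> ! i)) M (hl \<alpha> y)) \<noteq> y"

definition Fl :: "nat list \<Rightarrow> nat list \<Rightarrow> nat list \<Rightarrow> nat \<Rightarrow> nat" where
  "Fl \<alpha> \<beta> \<gamma> u = (if u < N \<and> unm \<alpha> \<gamma> (fs u) then hl \<alpha> (fs u) else hl' \<beta> u)"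

text \<open>The average over everything that determines \<open>F\<close>. The cluster tables are
  left out, as they are analysed for a fixed \<open>F\<close>.\<close>

definition avg3 :: "(nat list \<Rightarrow> nat list \<Rightarrow> nat list \<Rightarrow> real) \<Rightarrow> real" where
  "avg3 \<phi> = avg (W b (w + 1)) (\<lambda>\<alpha>. avg (W b (k + 1)) (\<lambda>\<beta>. avg (W b M) (\<lambda>\<gamma>. \<phi> \<alpha> \<beta> \<gamma>)))"

lemma avg3_mono: "(\<And>\<alpha> \<beta> \<gamma>. \<alpha> \<in> W b (w + 1) \<Longrightarrow> \<beta> \<in> W b (k + 1) \<Longrightarrow> \<gamma> \<in> W b M \<Longrightarrow> \<phi> \<alpha> \<beta> \<gamma> \<le> \<psi> \<alpha> \<beta> \<gamma>) \<Longrightarrow> avg3 \<phi> \<le> avg3 \<psi>"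
  unfolding avg3_def by (intro avg_mono)

lemma avg3_add: "avg3 (\<lambda>\<alpha> \<beta> \<gamma>. \<phi> \<alpha> \<beta> \<gamma> + \<psi> \<alpha> \<beta> \<gamma>) = avg3 \<phi> + avg3 \<psi>"
  unfolding avg3_def avg_add ..

lemma avg3_cmult: "avg3 (\<lambda>\<alpha> \<beta> \<gamma>. c * \<phi> \<alpha> \<beta> \<gamma>) = c * avg3 \<phi>"
  unfolding avg3_def avg_cmult ..

lemma avg3_const: "avg3 (\<lambda>\<alpha> \<beta> \<gamma>. c) = c"
  unfolding avg3_def by (simp add: avg_const)

lemma avg3_swap: "avg3 (\<lambda>\<alpha> \<beta> \<gamma>. avg A (\<lambda>u. \<phi> u \<alpha> \<beta> \<gamma>)) = avg A (\<lambda>u. avg3 (\<phi> u))"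
  unfolding avg3_def by (simp only: avg_swap[of _ A])

lemma avg3_hl_collide:
  assumes "v < 2 ^ w" "v' < 2 ^ w" "v \<noteq> v'"
  shows "avg3 (\<lambda>\<alpha> \<beta> \<gamma>. of_bool (hl \<alpha> v = hl \<alpha> v')) = 1 / M"
  unfolding avg3_def using avg_hx_collide[OF assms bounds(5)] by (simp add: avg_const hl_def M_def)

lemma avg3_hl'_collide:
  assumes "v < 2 ^ k" "v' < 2 ^ k" "v \<noteq> v'"
  shows "avg3 (\<lambda>\<alpha> \<beta> \<gamma>. of_bool (hl' \<beta> v = hl' \<beta> v')) = 1 / M"
  unfolding avg3_def using avg_hx_collide[OF assms bounds(5)] by (simp add: avg_const hl'_def M_def)

lemma avg3_hl'_const:
  assumes "v < 2 ^ k"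
  shows "avg3 (\<lambda>\<alpha> \<beta> \<gamma>. of_bool (hl' \<beta> v = hl \<alpha> y)) = 1 / M"
  unfolding avg3_def using avg_hx_const[OF assms _ bounds(5), of "hl \<alpha> y" for \<alpha>] kt hl_less[of _ y]
  by (simp add: avg_const hl'_def M_def)

definition I :: "nat \<Rightarrow> real" where
  "I y = real (card {x. x < N \<and> fs x = y})"

lemma I_pos: "x < N \<Longrightarrow> 1 \<le> I (fs x)"
proof -
  assume "x < N"
  then have "x \<in> {x'. x' < N \<and> fs x' = fs x}" by simp
  then have "0 < card {x'. x' < N \<and> fs x' = fs x}"
    by (subst card_gt_0_iff) auto
  then show ?thesis by (simp add: I_def)
qed

text \<open>A miss has two causes, each contributing \<open>2 ^ k / (M * I (fs x))\<close>: the cell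
  also receives other values, those of at most \<open>2 ^ k / M\<close> arguments on average, or no
  sample falls into the cell.\<close>

lemma avg_unm:
  assumes x: "x < N"
  shows "avg3 (\<lambda>\<alpha> \<beta> \<gamma>. of_bool (unm \<alpha> \<gamma> (fs x))) \<le> 2 * 2 ^ k / (M * I (fs x))"
proof -
  let ?y = "fs x"
  let ?T = "{u. u < N \<and> fs u = ?y}"
  let ?S = "\<lambda>\<alpha>. {u. u < N \<and> hl \<alpha> (fs u) = hl \<alpha> ?y}"
  have I1: "1 \<le> I ?y"
    by (rule I_pos[OF x])
  have Mr: "0 < real M"
    using bounds by simp
  have "avg3 (\<lambda>\<alpha> \<beta> \<gamma>. of_bool (unm \<alpha> \<gamma> ?y)) = avg (W b (w + 1)) (\<lambda>\<alpha>. avg (W b M) (\<lambda>\<gamma>. of_bool (unm \<alpha> \<gamma> ?y)))"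
    unfolding avg3_def by (simp add: avg_const)
  also have "\<dots> \<le> avg (W b (w + 1)) (\<lambda>\<alpha>. (\<Sum>u\<in>{u. u < N \<and> fs u \<noteq> ?y}. of_bool (hl \<alpha> (fs u) = hl \<alpha> ?y)) / I ?y + 2 ^ k / (M * I ?y))"
  proof (rule avg_mono)
    fix \<alpha>
    let ?s = "real (card (?S \<alpha>))"
    have TS: "?T \<subseteq> ?S \<alpha>" "finite (?S \<alpha>)" "?S \<alpha> \<subseteq> {..<2 ^ k}"
      using N by auto
    have s: "I ?y \<le> ?s" "?s \<le> 2 ^ k"
      unfolding I_def using card_mono[OF TS(2,1)] card_mono[OF _ TS(3)] by (simp_all flip: of_nat_le_iff)
    have diff: "?s - I ?y = (\<Sum>u\<in>{u. u < N \<and> fs u \<noteq> ?y}. of_bool (hl \<alpha> (fs u) = hl \<alpha> ?y))"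
    proof -
      have "?s - I ?y = real (card (?S \<alpha> - ?T))"
        unfolding I_def using TS finite_subset[OF TS(1,2)] by (simp add: card_Diff_subset of_nat_diff card_mono)
      also have "?S \<alpha> - ?T = {u. u < N \<and> fs u \<noteq> ?y} \<inter> {u. hl \<alpha> (fs u) = hl \<alpha> ?y}"
        by auto
      finally show ?thesis
        by simp
    qed
    have "avg (W b M) (\<lambda>\<gamma>. of_bool (unm \<alpha> \<gamma> ?y)) \<le> (?s - I ?y) / ?s + (1 - ?s / 2 ^ k) ^ M"
      unfolding unm_def I_def by (intro unmarked_recursion[OF N(2) k x refl]) auto
    \<comment> \<open>Replacing the random bucket size in the denominator by the size of the fibre
      makes the bound linear in the collisions.\<close>
    also have "(?s - I ?y) / ?s \<le> (?s - I ?y) / I ?y"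
      using s I1 by (intro divide_left_mono) auto
    also have "(1 - ?s / 2 ^ k) ^ M \<le> 1 / (real M * (?s / 2 ^ k))"
      using s I1 Mr by (intro power_le_inverse) auto
    also have "\<dots> \<le> 1 / (real M * (I ?y / 2 ^ k))"
      using s I1 Mr by (intro divide_left_mono mult_left_mono divide_right_mono mult_pos_pos divide_pos_pos) auto
    finally show "avg (W b M) (\<lambda>\<gamma>. of_bool (unm \<alpha> \<gamma> ?y)) \<le>
       (\<Sum>u\<in>{u. u < N \<and> fs u \<noteq> ?y}. of_bool (hl \<alpha> (fs u) = hl \<alpha> ?y)) / I ?y + 2 ^ k / (M * I ?y)"
      unfolding diff by simp
  qed
  also have "\<dots> = (\<Sum>u\<in>{u. u < N \<and> fs u \<noteq> ?y}. avg (W b (w + 1)) (\<lambda>\<alpha>. of_bool (hl \<alpha> (fs u) = hl \<alpha> ?y))) / I ?y + 2 ^ k / (M * I ?y)"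
    unfolding avg_add avg_divide avg_sum by (simp add: avg_const)
  also have "(\<Sum>u\<in>{u. u < N \<and> fs u \<noteq> ?y}. avg (W b (w + 1)) (\<lambda>\<alpha>. of_bool (hl \<alpha> (fs u) = hl \<alpha> ?y))) = (\<Sum>u\<in>{u. u < N \<and> fs u \<noteq> ?y}. 1 / M)"
    using avg_hx_collide[OF fs fs[OF x] _ bounds(5)] by (intro sum.cong refl) (simp add: hl_def M_def)
  also have "\<dots> \<le> 2 ^ k / M"
  proof -
    have "card {u. u < N \<and> fs u \<noteq> ?y} \<le> card {..<N}"
      by (intro card_mono) auto
    then have "card {u. u < N \<and> fs u \<noteq> ?y} \<le> 2 ^ k"
      using N by simp
    then have "real (card {u. u < N \<and> fs u \<noteq> ?y}) \<le> 2 ^ k"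
      by (metis of_nat_le_iff of_nat_numeral of_nat_power)
    then show ?thesis
      by (simp add: divide_right_mono)
  qed
  finally show ?thesis
    using I1 by (simp add: divide_right_mono)
qed

lemma avg_card_fibre: "avg {..<2 ^ k} (\<lambda>u. of_bool (u < N \<and> fs u = y)) = I y / 2 ^ k"
proof -
  have "{..<2 ^ k} \<inter> {u. u < N \<and> fs u = y} = {u. u < N \<and> fs u = y}"
    using N by auto
  then show ?thesis
    by (simp add: avg_def I_def)
qed

text \<open>Here the fibre sizes cancel. A second point lies in the fibre of \<open>u\<close> with
  probability \<open>I (fs u) / 2 ^ k\<close>, but such a pair collides through its value only if
  the value is unmarked, which has probability at most \<open>2 * 2 ^ k / (M * I (fs u))\<close>.
  This gives 2 of the 7 units; equal points give 1, coincidences of hash values 4.\<close>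

lemma avg_lam: "avg3 (\<lambda>\<alpha> \<beta> \<gamma>. chains.lam k (Fl \<alpha> \<beta> \<gamma>)) \<le> 7 / M" (is "?L \<le> _")
proof -
  let ?U = "\<lambda>y. avg3 (\<lambda>\<alpha> \<beta> \<gamma>. of_bool (unm \<alpha> \<gamma> y))"
  have ch: "chains k e M m t (Fl \<alpha> \<beta> \<gamma>) 0" for \<alpha> \<beta> \<gamma>
    using bounds by unfold_locales (auto simp: Fl_def hl_less hl'_less)
  have "?L = avg {..<2 ^ k} (\<lambda>u. avg {..<2 ^ k} (\<lambda>u'. avg3 (\<lambda>\<alpha> \<beta> \<gamma>. of_bool (Fl \<alpha> \<beta> \<gamma> u = Fl \<alpha> \<beta> \<gamma> u'))))"
    unfolding chains.lam_def[OF ch] avg3_swap ..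
  also have "\<dots> \<le> avg {..<2 ^ k} (\<lambda>u. avg {..<2 ^ k} (\<lambda>u'. of_bool (u' = u) + 4 / M + (of_bool (u < N) * ?U (fs u)) * of_bool (u' < N \<and> fs u' = fs u)))"
  proof (intro avg_mono)
    fix u u' assume u: "u \<in> {..<2 ^ k :: nat}" "u' \<in> {..<2 ^ k :: nat}"
    show "avg3 (\<lambda>\<alpha> \<beta> \<gamma>. of_bool (Fl \<alpha> \<beta> \<gamma> u = Fl \<alpha> \<beta> \<gamma> u')) \<le>
      of_bool (u' = u) + 4 / M + (of_bool (u < N) * ?U (fs u)) * of_bool (u' < N \<and> fs u' = fs u)"
    proof (cases "u' = u")
      case True
      have "0 \<le> ?U (fs u)"
        using avg3_mono[of "\<lambda>_ _ _. 0" "\<lambda>\<alpha> \<beta> \<gamma>. of_bool (unm \<alpha> \<gamma> (fs u))"] by (simp add: avg3_const)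
      then show ?thesis
        using True by (simp add: avg3_const)
    next
      case False
      let ?t1 = "\<lambda>\<alpha> \<beta> \<gamma>. of_bool (u < N \<and> u' < N \<and> fs u \<noteq> fs u') * of_bool (hl \<alpha> (fs u) = hl \<alpha> (fs u')) :: real"
      let ?t2 = "\<lambda>\<alpha> \<beta> \<gamma>. (of_bool (u < N) * of_bool (u' < N \<and> fs u' = fs u)) * of_bool (unm \<alpha> \<gamma> (fs u)) :: real"
      let ?t3 = "\<lambda>\<alpha> \<beta> \<gamma>. of_bool (hl' \<beta> u' = hl \<alpha> (fs u)) :: real"
      let ?t4 = "\<lambda>\<alpha> \<beta> \<gamma>. of_bool (hl' \<beta> u = hl \<alpha> (fs u')) :: real"
      let ?t5 = "\<lambda>\<alpha> \<beta> \<gamma>. of_bool (hl' \<beta> u = hl' \<beta> u') :: real"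
      have "avg3 (\<lambda>\<alpha> \<beta> \<gamma>. of_bool (Fl \<alpha> \<beta> \<gamma> u = Fl \<alpha> \<beta> \<gamma> u')) \<le>
         avg3 (\<lambda>\<alpha> \<beta> \<gamma>. ?t1 \<alpha> \<beta> \<gamma> + (?t2 \<alpha> \<beta> \<gamma> + (?t3 \<alpha> \<beta> \<gamma> + (?t4 \<alpha> \<beta> \<gamma> + ?t5 \<alpha> \<beta> \<gamma>))))"
      proof (rule avg3_mono, rule order_trans[OF of_bool_le_sum])
        fix \<alpha> \<beta> \<gamma> assume "Fl \<alpha> \<beta> \<gamma> u = Fl \<alpha> \<beta> \<gamma> u'"
        then show "((u < N \<and> u' < N \<and> fs u \<noteq> fs u') \<and> hl \<alpha> (fs u) = hl \<alpha> (fs u')) \<or>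
          ((u < N \<and> u' < N \<and> fs u' = fs u) \<and> unm \<alpha> \<gamma> (fs u)) \<or> hl' \<beta> u' = hl \<alpha> (fs u) \<or>
          hl' \<beta> u = hl \<alpha> (fs u') \<or> hl' \<beta> u = hl' \<beta> u'"
          unfolding Fl_def by (simp split: if_splits)
      qed (intro add_mono order_refl; simp)
      also have "\<dots> = avg3 ?t1 + (avg3 ?t2 + (1 / M + (1 / M + 1 / M)))"
        using u False by (simp only: avg3_add avg3_hl'_const avg3_hl'_collide lessThan_iff not_sym)
      also have "avg3 ?t1 \<le> 1 / M"
        using avg3_hl_collide[OF fs fs] by (auto simp: avg3_cmult avg3_const of_bool_def)
      also have "avg3 ?t2 = (of_bool (u < N) * ?U (fs u)) * of_bool (u' < N \<and> fs u' = fs u)"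
        by (simp only: avg3_cmult) (simp only: ac_simps)
      finally show ?thesis
        using False by simp
    qed
  qed
  also have "\<dots> = avg {..<2 ^ k} (\<lambda>u. 1 / 2 ^ k + 4 / M + (of_bool (u < N) * ?U (fs u)) * (I (fs u) / 2 ^ k))"
    unfolding avg_add avg_cmult avg_card_fibre
    by (intro avg_cong arg_cong2[where f = "(+)"] refl) (simp_all add: avg_eq_const avg_pos_set)
  also have "\<dots> \<le> avg {..<2 ^ k :: nat} (\<lambda>u. 1 / M + 4 / M + 2 / M)"
  proof (intro avg_mono add_mono)
    have "real M \<le> 2 ^ k"
      using bounds(8) by (metis of_nat_le_iff of_nat_numeral of_nat_power)
    then show "1 / 2 ^ k \<le> 1 / real M"
      using bounds(7) by (intro divide_left_mono) auto
    fix u :: nat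
    show "(of_bool (u < N) * ?U (fs u)) * (I (fs u) / 2 ^ k) \<le> 2 / M"
    proof (cases "u < N")
      case True
      have "?U (fs u) * (I (fs u) / 2 ^ k) \<le> 2 * 2 ^ k / (M * I (fs u)) * (I (fs u) / 2 ^ k)"
        using avg_unm[OF True] I_pos[OF True] by (intro mult_right_mono) auto
      also have "\<dots> = 2 / M"
        using I_pos[OF True] by (simp add: field_simps)
      finally show ?thesis
        using True by simp
    qed simp
  qed auto
  finally show ?thesis
    by (simp add: avg_pos_set)
qed

text \<open>The same cancellation around a fixed \<open>x\<close>. The indicator of being unmarked
  stays inside the average: it supplies the factor that cancels a large fibre, and a marked value is
  answered by the table anyway.\<close>

lemma avg_wst:
  assumes x: "x < N"
  shows "avg3 (\<lambda>\<alpha> \<beta> \<gamma>. of_bool (unm \<alpha> \<gamma> (fs x)) * chains.wst k (Fl \<alpha> \<beta> \<gamma>) x) \<le> 4 / M" (is "?L \<le> _")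
proof -
  let ?y = "fs x"
  let ?U = "avg3 (\<lambda>\<alpha> \<beta> \<gamma>. of_bool (unm \<alpha> \<gamma> ?y))"
  have ch: "chains k e M m t (Fl \<alpha> \<beta> \<gamma>) x" for \<alpha> \<beta> \<gamma>
    using bounds N x by unfold_locales (auto simp: Fl_def hl_less hl'_less)
  have "?L = avg {..<2 ^ k} (\<lambda>u. avg3 (\<lambda>\<alpha> \<beta> \<gamma>. of_bool (unm \<alpha> \<gamma> ?y) * of_bool (Fl \<alpha> \<beta> \<gamma> u = Fl \<alpha> \<beta> \<gamma> x)))"
    unfolding chains.wst_def[OF ch] avg_cmult[symmetric] avg3_swap ..
  also have "\<dots> \<le> avg {..<2 ^ k} (\<lambda>u. ?U * of_bool (u < N \<and> fs u = ?y) + 2 / M)"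
  proof (rule avg_mono)
    fix u assume u: "u \<in> {..<2 ^ k :: nat}"
    let ?t1 = "\<lambda>\<alpha> \<beta> \<gamma>. of_bool (u < N \<and> fs u = ?y) * of_bool (unm \<alpha> \<gamma> ?y) :: real"
    let ?t2 = "\<lambda>\<alpha> \<beta> \<gamma>. of_bool (u < N \<and> fs u \<noteq> ?y) * of_bool (hl \<alpha> (fs u) = hl \<alpha> ?y) :: real"
    let ?t3 = "\<lambda>\<alpha> \<beta> \<gamma>. of_bool (hl' \<beta> u = hl \<alpha> ?y) :: real"
    have "avg3 (\<lambda>\<alpha> \<beta> \<gamma>. of_bool (unm \<alpha> \<gamma> ?y) * of_bool (Fl \<alpha> \<beta> \<gamma> u = Fl \<alpha> \<beta> \<gamma> x)) \<le>
       avg3 (\<lambda>\<alpha> \<beta> \<gamma>. ?t1 \<alpha> \<beta> \<gamma> + (?t2 \<alpha> \<beta> \<gamma> + ?t3 \<alpha> \<beta> \<gamma>))"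
      using x by (intro avg3_mono) (auto simp: Fl_def of_bool_def)
    also have "\<dots> = avg3 ?t1 + (avg3 ?t2 + 1 / M)"
      using u by (simp only: avg3_add avg3_hl'_const lessThan_iff)
    also have "avg3 ?t2 \<le> 1 / M"
      using avg3_hl_collide[OF fs fs[OF x]] by (auto simp: avg3_cmult avg3_const of_bool_def)
    also have "avg3 ?t1 = ?U * of_bool (u < N \<and> fs u = ?y)"
      by (simp only: avg3_cmult mult.commute)
    finally show "avg3 (\<lambda>\<alpha> \<beta> \<gamma>. of_bool (unm \<alpha> \<gamma> ?y) * of_bool (Fl \<alpha> \<beta> \<gamma> u = Fl \<alpha> \<beta> \<gamma> x)) \<le> ?U * of_bool (u < N \<and> fs u = ?y) + 2 / M"
      by simp
  qed
  also have "\<dots> = ?U * (I ?y / 2 ^ k) + 2 / M"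
    unfolding avg_add avg_cmult avg_card_fibre by (simp add: avg_pos_set)
  also have "?U * (I ?y / 2 ^ k) \<le> 2 * 2 ^ k / (M * I ?y) * (I ?y / 2 ^ k)"
    using avg_unm[OF x] I_pos[OF x] by (intro mult_right_mono) auto
  also have "\<dots> = 2 / M"
    using I_pos[OF x] by (simp add: field_simps)
  finally show ?thesis
    by simp
qed

text \<open>A marked value is a success, and otherwise the clusters succeed with probability at
  least \<open>(1 - m * dlt) / 2\<close>. In both cases the success is at least \<open>1 / 2\<close>
  minus \<open>m / 2\<close> times \<open>?d\<close>, and \<open>m\<close> times the average of
  \<open>?d\<close> is at most \<open>1 / 4 + 1 / 8\<close>.\<close>

lemma block_success:
  assumes x: "x < N"
  shows "1 / 4 \<le> avg (W b BL) (\<lambda>xs. of_bool (bgood ((!) xs) x))"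
proof -
  let ?y = "fs x"
  have ch: "chains k e M m t (Fl \<alpha> \<beta> \<gamma>) x" for \<alpha> \<beta> \<gamma>
    using bounds N x by unfold_locales (auto simp: Fl_def hl_less hl'_less)
  let ?d = "\<lambda>\<alpha> \<beta> \<gamma>. of_bool (unm \<alpha> \<gamma> ?y) * chains.dlt k e t (Fl \<alpha> \<beta> \<gamma>) x"
  have lam0: "0 \<le> chains.lam k (Fl \<alpha> \<beta> \<gamma>)" for \<alpha> \<beta> \<gamma>
    unfolding chains.lam_def[OF ch] by (intro avg_nonneg) simp
  have "avg3 ?d \<le> avg3 (\<lambda>\<alpha> \<beta> \<gamma>. (4 * real t) * (of_bool (unm \<alpha> \<gamma> ?y) * chains.wst k (Fl \<alpha> \<beta> \<gamma>) x) +
      ((16 * real t ^ 2) * chains.lam k (Fl \<alpha> \<beta> \<gamma>) + 1 / 2 ^ e))"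
    using lam0 by (intro avg3_mono) (auto simp: chains.dlt_def[OF ch] of_bool_def)
  also have "\<dots> \<le> (4 * real t) * (4 / M) + ((16 * real t ^ 2) * (7 / M) + 1 / 2 ^ e)"
    unfolding avg3_add avg3_cmult avg3_const by (intro add_mono mult_left_mono avg_wst[OF x] avg_lam order_refl) auto
  also have "\<dots> \<le> 128 * real t ^ 2 / M + 1 / 2 ^ e"
  proof -
    have "real t \<le> real t ^ 2"
      using bounds(2) by (simp add: power2_eq_square)
    then have "16 * real t + 112 * real t ^ 2 \<le> 128 * real t ^ 2"
      by simp
    from divide_right_mono[OF this, of "real M"] show ?thesis
      by (simp add: add_divide_distrib)
  qed
  finally have "real m * avg3 ?d \<le> real m * (128 * real t ^ 2 / M + 1 / 2 ^ e)"
    by (intro mult_left_mono) auto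
  also have "\<dots> = 128 * (real m * real t ^ 2 / M) + real m / 2 ^ e"
    by (simp add: algebra_simps)
  also have "real m * real t ^ 2 / M = 1 / 512"
  proof -
    have "real M = real (m * t ^ 2 * 512)"
      by (simp only: mt2M)
    then show ?thesis
      using bounds by (simp add: field_simps)
  qed
  also have "real m / 2 ^ e = 1 / 8"
  proof -
    have "(2::real) ^ e = real (8 * m)"
      unfolding mE by simp
    then show ?thesis
      using bounds by simp
  qed
  finally have dm: "real m * avg3 ?d \<le> 1 / 2"
    by simp
  have "1 / 4 \<le> 1 / 2 - real m / 2 * avg3 ?d"
    using dm by simp
  also have "\<dots> = avg3 (\<lambda>\<alpha> \<beta> \<gamma>. 1 / 2 + (- (real m / 2)) * ?d \<alpha> \<beta> \<gamma>)"
    unfolding avg3_add avg3_cmult avg3_const by simp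
  also have "\<dots> \<le> avg3 (\<lambda>\<alpha> \<beta> \<gamma>. avg (W b ((q + 1) * K)) (\<lambda>T. of_bool (bgood ((!) (\<alpha> @ (\<beta> @ (\<gamma> @ T)))) x)))"
  proof (rule avg3_mono)
    fix \<alpha> \<beta> \<gamma> assume A: "\<alpha> \<in> W b (w + 1)" "\<beta> \<in> W b (k + 1)" "\<gamma> \<in> W b M"
    let ?X = "\<lambda>T. (!) (\<alpha> @ (\<beta> @ (\<gamma> @ T)))"
    have HT: "HT (?X T) = tab N fs (hl \<alpha>) (\<lambda>i. take_bit k (\<gamma> ! i)) M" if "T \<in> W b ((q + 1) * K)" for T
      unfolding HT_def using append_parts[OF A that] by (intro tab_cong) auto
    have F: "F (?X T) = Fl \<alpha> \<beta> \<gamma>" if "T \<in> W b ((q + 1) * K)" for T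
      using append_parts[OF A that] HT[OF that] by (auto simp: F_def Fl_def unm_def)
    have g: "bgood (?X T) x \<longleftrightarrow> \<not> unm \<alpha> \<gamma> ?y \<or> (\<exists>i<2 ^ q. chains.hits e M m t (Fl \<alpha> \<beta> \<gamma>) x (hrow k q K T i))"
      if "T \<in> W b ((q + 1) * K)" for T
      unfolding bgood_def F[OF that] HT[OF that] append_parts(1,4)[OF A that] unm_def by simp
    have eq: "avg (W b ((q + 1) * K)) (\<lambda>T. of_bool (bgood (?X T) x)) =
      avg (W b ((q + 1) * K)) (\<lambda>T. of_bool (\<not> unm \<alpha> \<gamma> ?y \<or> (\<exists>i<2 ^ q. chains.hits e M m t (Fl \<alpha> \<beta> \<gamma>) x (hrow k q K T i))))"
      by (intro avg_cong refl arg_cong[where f = of_bool] g)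
    show "1 / 2 + (- (real m / 2)) * ?d \<alpha> \<beta> \<gamma> \<le> avg (W b ((q + 1) * K)) (\<lambda>T. of_bool (bgood (?X T) x))"
    proof (cases "unm \<alpha> \<gamma> ?y")
      case True
      have "(1 - real m * chains.dlt k e t (Fl \<alpha> \<beta> \<gamma>) x) / 2 \<le>
          avg (W b ((q + 1) * (M + m))) (\<lambda>T. of_bool (\<exists>i<2 ^ q. chains.hits e M m t (Fl \<alpha> \<beta> \<gamma>) x (hrow k q (M + m) T i)))"
        by (rule chains.clusters_lower[OF ch lmt bounds(4) k])
      then show ?thesis
        unfolding eq using True by (simp add: K_def diff_divide_distrib)
    next
      case False
      then show ?thesis
        unfolding eq by (simp add: avg_const)
    qed
  qed
  also have "\<dots> = avg (W b BL) (\<lambda>xs. of_bool (bgood ((!) xs) x))"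
    unfolding avg3_def BL_def by (simp only: avg_W_append)
  finally show ?thesis .
qed

end

section \<open>Independent repetitions\<close>

lemma avg_blocks:
  "avg (W b (R * B)) (\<lambda>xs. \<Prod>r<R. \<phi> (take B (drop (r * B) xs))) = avg (W b B) \<phi> ^ R"
proof (induction R)
  case (Suc R)
  have "avg (W b (Suc R * B)) (\<lambda>xs. \<Prod>r<Suc R. \<phi> (take B (drop (r * B) xs))) =
    avg (W b B) (\<lambda>xs. avg (W b (R * B)) (\<lambda>ys. \<phi> xs * (\<Prod>r<R. \<phi> (take B (drop (r * B) ys)))))"
    unfolding mult_Suc avg_W_append
    by (intro avg_cong refl) (simp add: prod.lessThan_Suc_shift length_W del: prod.lessThan_Suc)
  also have "\<dots> = avg (W b B) (\<lambda>xs. avg (W b B) \<phi> ^ R * \<phi> xs)"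
    by (intro avg_cong refl) (subst avg_cmult, subst Suc.IH, rule mult.commute)
  also have "\<dots> = avg (W b B) \<phi> ^ R * avg (W b B) \<phi>"
    by (rule avg_cmult)
  finally show ?case
    by (simp only: power_Suc mult.commute)
qed (simp add: avg_single)

section \<open>One set of random blocks for the functions of all levels\<close>

locale lev = prm +
  fixes f :: "nat \<Rightarrow> nat"
  assumes f: "\<And>x. x < N \<Longrightarrow> f x < 2 ^ w"
begin

definition fsh :: "nat \<Rightarrow> nat \<Rightarrow> nat" where
  "fsh sh x = drop_bit sh (f x)"

lemma fsh_blk: "blk b w N k kt (fsh sh)"
proof
  fix x assume "x < N"
  have "drop_bit sh (f x) \<le> f x"
    by (simp add: drop_bit_eq_div)
  then show "fsh sh x < 2 ^ w"
    using f[OF \<open>x < N\<close>] by (simp add: fsh_def)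
qed

definition bX :: "nat list \<Rightarrow> nat \<Rightarrow> nat \<Rightarrow> nat" where
  "bX xs r = (!) (take BL (drop (r * BL) xs))"

definition allgood :: "nat \<Rightarrow> nat list \<Rightarrow> bool" where
  "allgood R xs \<longleftrightarrow> (\<forall>sh\<le>w. \<forall>x<N. \<exists>r<R. blk.bgood w N k kt (fsh sh) (bX xs r) x)"

lemma fail_prob:
  assumes "x < N"
  shows "avg (W b (R * BL)) (\<lambda>xs. of_bool (\<forall>r<R. \<not> blk.bgood w N k kt (fsh sh) (bX xs r) x)) \<le> (3 / 4) ^ R"
proof -
  have prod: "(\<Prod>r<R. of_bool (P r) :: real) = of_bool (\<forall>r<R. P r)" for P :: "nat \<Rightarrow> bool" and R
    by (induction R) (auto simp: less_Suc_eq)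
  let ?p = "avg (W b BL) (\<lambda>xs. of_bool (\<not> blk.bgood w N k kt (fsh sh) ((!) xs) x))"
  have "?p = 1 - avg (W b BL) (\<lambda>xs. of_bool (blk.bgood w N k kt (fsh sh) ((!) xs) x))"
    by (simp add: of_bool_not_iff avg_diff avg_const)
  then have "?p \<le> 3 / 4"
    using blk.block_success[OF fsh_blk[of sh] assms] by simp
  moreover have "0 \<le> ?p"
    by (intro avg_nonneg) simp
  ultimately have "?p ^ R \<le> (3 / 4) ^ R"
    by (intro power_mono)
  then show ?thesis
    unfolding avg_blocks[symmetric] prod bX_def .
qed

lemma allgood_prob: "1 - real (w + 1) * real N * (3 / 4) ^ R \<le> avg (W b (R * BL)) (\<lambda>xs. of_bool (allgood R xs))"
proof -
  let ?bad = "\<lambda>sh x xs. of_bool (\<forall>r<R. \<not> blk.bgood w N k kt (fsh sh) (bX xs r) x) :: real"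
  have point: "1 - (\<Sum>sh\<in>{..w}. \<Sum>x<N. ?bad sh x xs) \<le> of_bool (allgood R xs)" for xs
  proof (cases "allgood R xs")
    case True
    have "0 \<le> (\<Sum>sh\<in>{..w}. \<Sum>x<N. ?bad sh x xs)"
      by (intro sum_nonneg) simp
    then show ?thesis
      using True by simp
  next
    case False
    then obtain sh x where *: "sh \<le> w" "x < N" "?bad sh x xs = 1"
      by (auto simp: allgood_def)
    have "?bad sh x xs \<le> (\<Sum>x<N. ?bad sh x xs)"
      using * by (intro member_le_sum[of x _ "\<lambda>x. ?bad sh x xs"]) auto
    also have "\<dots> \<le> (\<Sum>sh\<in>{..w}. \<Sum>x<N. ?bad sh x xs)"
      using * by (intro member_le_sum[of sh _ "\<lambda>sh. \<Sum>x<N. ?bad sh x xs"]) (auto intro!: sum_nonneg)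
    finally have "1 \<le> (\<Sum>sh\<in>{..w}. \<Sum>x<N. ?bad sh x xs)"
      unfolding *(3) .
    then show ?thesis
      using False by simp
  qed
  have "1 - real (w + 1) * real N * (3 / 4) ^ R = 1 - (\<Sum>sh\<in>{..w}. \<Sum>x<N. (3 / 4) ^ R)"
    by simp
  also have "\<dots> \<le> 1 - (\<Sum>sh\<in>{..w}. \<Sum>x<N. avg (W b (R * BL)) (?bad sh x))"
    by (intro diff_mono sum_mono fail_prob) auto
  also have "\<dots> = avg (W b (R * BL)) (\<lambda>xs. 1 - (\<Sum>sh\<in>{..w}. \<Sum>x<N. ?bad sh x xs))"
    by (simp only: avg_diff avg_sum avg_const[OF finite_W W_nonempty])
  also have "\<dots> \<le> avg (W b (R * BL)) (\<lambda>xs. of_bool (allgood R xs))"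
    by (intro avg_mono point)
  finally show ?thesis .
qed

text \<open>Three repetitions all fail with probability at most \<open>27 / 64\<close>, less than
  \<open>1 / 2\<close>. So \<open>w\<close> triples pay for the levels, \<open>k\<close> triples for
  the arguments, and \<open>c * k\<close> triples remain for the error
  \<open>1 / N powr \<kappa>\<close>.\<close>

lemma allgood_high_prob:
  assumes "0 < \<kappa>" "\<kappa> \<le> real c"
  shows "1 - 1 / real N powr \<kappa> \<le> avg (W b (3 * ((c + 1) * k + w) * BL)) (\<lambda>xs. of_bool (allgood (3 * ((c + 1) * k + w)) xs))"
proof -
  have Nk: "real N \<le> 2 ^ k"
    using N by (metis of_nat_le_iff of_nat_numeral of_nat_power)
  have "real (w + 1) * real N * (3 / 4) ^ (3 * ((c + 1) * k + w)) \<le> 2 ^ w * 2 ^ k * (1 / 2) ^ ((c + 1) * k + w)"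
  proof (intro mult_mono)
    have "w + 1 \<le> 2 ^ w"
      by (induction w) auto
    then show "real (w + 1) \<le> 2 ^ w"
      by (metis of_nat_le_iff of_nat_numeral of_nat_power)
    show "real N \<le> 2 ^ k"
      by (rule Nk)
    show "(3 / 4 :: real) ^ (3 * ((c + 1) * k + w)) \<le> (1 / 2) ^ ((c + 1) * k + w)"
      unfolding power_mult by (intro power_mono) (simp_all add: power3_eq_cube)
  qed auto
  also have "\<dots> = (1 / 2) ^ (c * k)"
    by (simp add: power_add power_one_over field_simps)
  also have "\<dots> = 1 / (2 ^ k) powr real c"
    by (simp add: powr_realpow power_mult power_one_over mult.commute[of c])
  also have "\<dots> \<le> 1 / real N powr \<kappa>"
  proof -
    have "real N powr \<kappa> \<le> real N powr real c"
      using N assms by (intro powr_mono) auto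
    also have "\<dots> \<le> (2 ^ k) powr real c"
      using N by (intro powr_mono2) (use Nk in auto)
    finally show ?thesis
      using N by (intro divide_left_mono) auto
  qed
  finally show ?thesis
    using allgood_prob[of "3 * ((c + 1) * k + w)"] by linarith
qed

end

section \<open>The loop that draws the random words\<close>

lemma rand_loop_step:
  assumes code: "code P p [Rand 92, Store 90 92, Arith Add 90 90 93, JumpLess 90 91 p]"
    and regs: "r 90 = a" "r 93 = 1" "a + 1 < 2 ^ b"
  shows "rand_run b sub P (4 + T) \<lparr>pc = p, reg = r, mem = m, clock = k\<rparr> =
    bind_pmf (pmf_of_set {..<2 ^ b}) (\<lambda>v. rand_run b sub P T
      \<lparr>pc = if a + 1 < r 91 then p else p + 4, reg = r(92 := v, 90 := a + 1), mem = m(a := v), clock = k + 4\<rparr>)"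
proof -
  have S4: "i + 4 = Suc (Suc (Suc (Suc i)))" for i :: nat
    by simp
  have l: "Suc (Suc (Suc p)) < length P" "P ! p = Rand 92" "P ! Suc p = Store 90 92" "P ! Suc (Suc p) = Arith Add 90 90 93"
    "P ! Suc (Suc (Suc p)) = JumpLess 90 91 p"
    using code by (auto simp: code_Cons code_single)
  have "rand_run b sub P (3 + T) (step b sub P v \<lparr>pc = p, reg = r, mem = m, clock = k\<rparr>) =
    rand_run b sub P T \<lparr>pc = if a + 1 < r 91 then p else p + 4, reg = r(92 := v, 90 := a + 1), mem = m(a := v), clock = k + 4\<rparr>" for v
  proof (rule rch_rand_run)
    have 0: "step b sub P v \<lparr>pc = p, reg = r, mem = m, clock = k\<rparr> = \<lparr>pc = Suc p, reg = r(92 := v), mem = m, clock = Suc k\<rparr>"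
      using l by (simp add: step_def halted_def set_reg_def)
    have 1: "rch b sub P (Suc n) \<lparr>pc = Suc p, reg = r(92 := v), mem = m, clock = Suc k\<rparr> c"
      if "rch b sub P n \<lparr>pc = Suc (Suc p), reg = r(92 := v), mem = m(a := v), clock = Suc (Suc k)\<rparr> c" for n c
      using that l regs by (intro rchS) (simp_all add: S4)
    have 2: "rch b sub P (Suc n) \<lparr>pc = Suc (Suc p), reg = r(92 := v), mem = m(a := v), clock = Suc (Suc k)\<rparr> c"
      if "rch b sub P n \<lparr>pc = Suc (Suc (Suc p)), reg = r(92 := v, 90 := a + 1), mem = m(a := v), clock = Suc (Suc (Suc k))\<rparr> c" for n c
      using that l regs by (intro rchS) (simp_all add: S4 set_reg_def)
    have 3: "rch b sub P (Suc n) \<lparr>pc = Suc (Suc (Suc p)), reg = r(92 := v, 90 := a + 1), mem = m(a := v), clock = Suc (Suc (Suc k))\<rparr> c"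
      if "rch b sub P n \<lparr>pc = if a + 1 < r 91 then p else p + 4, reg = r(92 := v, 90 := a + 1), mem = m(a := v), clock = k + 4\<rparr> c" for n c
      using that l regs by (intro rchS) (auto simp: S4 split: if_splits)
    show "rch b sub P 3 (step b sub P v \<lparr>pc = p, reg = r, mem = m, clock = k\<rparr>)
      \<lparr>pc = if a + 1 < r 91 then p else p + 4, reg = r(92 := v, 90 := a + 1), mem = m(a := v), clock = k + 4\<rparr>"
      unfolding 0 numeral_3_eq_3 by (intro 1 2 3 rch0)
  qed
  moreover have "4 + T = Suc (3 + T)"
    by simp
  ultimately show ?thesis
    by (simp only: rand_run.simps)
qed

text \<open>Reasoning backwards about a lower bound: \<open>G xs\<close> is what the continuation
  guarantees after the words \<open>xs\<close>. The loop is tested at its end and draws at least one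
  word, whence \<open>Suc n\<close>.\<close>

lemma rand_loop:
  assumes code: "code P p [Rand 92, Store 90 92, Arith Add 90 90 93, JumpLess 90 91 p]"
    and regs: "r 90 = a" "r 91 = a + Suc n" "r 93 = 1" "a + Suc n < 2 ^ b"
    and G: "\<And>xs r'. xs \<in> W b (Suc n) \<Longrightarrow> (\<And>i. i \<noteq> 90 \<Longrightarrow> i \<noteq> 92 \<Longrightarrow> r' i = r i) \<Longrightarrow>
      G xs \<le> measure_pmf.prob (rand_run b sub P T \<lparr>pc = p + 4, reg = r',
        mem = (\<lambda>c. if a \<le> c \<and> c < a + Suc n then xs ! (c - a) else m c), clock = k + 4 * Suc n\<rparr>) S"
  shows "avg (W b (Suc n)) G \<le>
    measure_pmf.prob (rand_run b sub P (4 * Suc n + T) \<lparr>pc = p, reg = r, mem = m, clock = k\<rparr>) S"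
  using regs G
proof (induction n arbitrary: a r m k G)
  case (0 a r m k G)
  have "rand_run b sub P (4 + T) \<lparr>pc = p, reg = r, mem = m, clock = k\<rparr> = bind_pmf (pmf_of_set {..<2 ^ b})
      (\<lambda>v. rand_run b sub P T \<lparr>pc = p + 4, reg = r(92 := v, 90 := a + 1), mem = m(a := v), clock = k + 4\<rparr>)"
    using 0 by (subst rand_loop_step[OF code, where a = a]) simp_all
  moreover have "avg (W b (Suc 0)) G \<le> avg {..<2 ^ b} (\<lambda>v. measure_pmf.prob
      (rand_run b sub P T \<lparr>pc = p + 4, reg = r(92 := v, 90 := a + 1), mem = m(a := v), clock = k + 4\<rparr>) S)"
    unfolding avg_W_1
  proof (rule avg_mono)
    fix v :: nat assume "v \<in> {..<2 ^ b}"
    then have "[v] \<in> W b (Suc 0)" by (simp add: W_def)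
    have "G [v] \<le> measure_pmf.prob (rand_run b sub P T \<lparr>pc = p + 4, reg = r(92 := v, 90 := a + 1),
        mem = (\<lambda>c. if a \<le> c \<and> c < a + Suc 0 then [v] ! (c - a) else m c), clock = k + 4 * Suc 0\<rparr>) S"
      by (rule 0(5)[OF \<open>[v] \<in> _\<close>]) simp
    moreover have "(\<lambda>c. if a \<le> c \<and> c < a + Suc 0 then [v] ! (c - a) else m c) = m(a := v)"
      by auto
    ultimately show "G [v] \<le> measure_pmf.prob (rand_run b sub P T \<lparr>pc = p + 4, reg = r(92 := v, 90 := a + 1), mem = m(a := v), clock = k + 4\<rparr>) S"
      by simp
  qed
  ultimately show ?case
    by (simp add: prob_bind_pmf_of_set lessThan_empty_iff)
next
  case (Suc n a r m k G)
  let ?c = "\<lambda>v. \<lparr>pc = p, reg = r(92 := v, 90 := a + 1), mem = m(a := v), clock = k + 4\<rparr>"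
  have "rand_run b sub P (4 + (4 * Suc n + T)) \<lparr>pc = p, reg = r, mem = m, clock = k\<rparr> = bind_pmf (pmf_of_set {..<2 ^ b})
      (\<lambda>v. rand_run b sub P (4 * Suc n + T) (?c v))"
    using Suc.prems by (subst rand_loop_step[OF code, where a = a]) simp_all
  moreover have "avg (W b (Suc (Suc n))) G \<le> avg {..<2 ^ b} (\<lambda>v. measure_pmf.prob (rand_run b sub P (4 * Suc n + T) (?c v)) S)"
    unfolding avg_W_Suc[of b "Suc n"]
  proof (rule avg_mono)
    fix v :: nat assume v: "v \<in> {..<2 ^ b}"
    show "avg (W b (Suc n)) (\<lambda>xs. G (v # xs)) \<le> measure_pmf.prob (rand_run b sub P (4 * Suc n + T) (?c v)) S"
    proof (rule Suc.IH)
      fix xs r' assume xs: "xs \<in> W b (Suc n)" and r': "\<And>i. i \<noteq> 90 \<Longrightarrow> i \<noteq> 92 \<Longrightarrow> r' i = (r(92 := v, 90 := a + 1)) i"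
      have "v # xs \<in> W b (Suc (Suc n))"
        using v xs by (simp add: W_def)
      moreover have "r' i = r i" if "i \<noteq> 90" "i \<noteq> 92" for i
        using r'[OF that] that by simp
      ultimately have "G (v # xs) \<le> measure_pmf.prob (rand_run b sub P T \<lparr>pc = p + 4, reg = r',
        mem = (\<lambda>c. if a \<le> c \<and> c < a + Suc (Suc n) then (v # xs) ! (c - a) else m c), clock = k + 4 * Suc (Suc n)\<rparr>) S"
        by (rule Suc.prems(5))
      moreover have "(\<lambda>c. if a \<le> c \<and> c < a + Suc (Suc n) then (v # xs) ! (c - a) else m c) =
         (\<lambda>c. if a + 1 \<le> c \<and> c < a + 1 + Suc n then xs ! (c - (a + 1)) else (m(a := v)) c)"
        by (auto simp: fun_eq_iff nth_Cons' Suc_le_eq)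
      moreover have "k + 4 * Suc (Suc n) = k + 4 + 4 * Suc n"
        by simp
      ultimately show "G (v # xs) \<le> measure_pmf.prob (rand_run b sub P T \<lparr>pc = p + 4, reg = r',
        mem = (\<lambda>c. if a + 1 \<le> c \<and> c < a + 1 + Suc n then xs ! (c - (a + 1)) else (m(a := v)) c), clock = k + 4 + 4 * Suc n\<rparr>) S"
        by (simp only:)
    qed (use Suc.prems in auto)
  qed
  ultimately show ?case
    by (simp add: prob_bind_pmf_of_set lessThan_empty_iff add.assoc)
qed

section \<open>Evaluation of the hash functions and of a chain step\<close>

text \<open>Registers: 3 to 29 hold the parameters, 30 the level (number of bits dropped from the values),
  31 and 32 the addresses of the random and of the computed part of the current block, 33 the value
  that is searched for, 34 whether it was found, 35 its preimage, 36 the repetition, 40 the cluster.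
  A chain step and everything that it uses change only registers from 50 on.\<close>

definition "HX = Asg 70 (Ld (V 71)) ;; Asg 76 (V 71) ;;
  For 75 73 0 (Asg 76 (Bin Add (V 76) (V 72)) ;;
    Asg 70 (Bin Xor (V 70) (Bin Mul (Bin And (Bin ShiftR (V 74) (V 75)) (C 1)) (Ld (V 76)))))"
definition "HV = Asg 71 (V 31) ;; Asg 72 (C 1) ;; Asg 73 (V 4) ;; Asg 74 (V 60) ;; HX ;; Asg 61 (Bin And (V 70) (V 9))"
definition "HU = Asg 71 (Bin Add (V 31) (V 20)) ;; Asg 72 (C 1) ;; Asg 73 (V 5) ;; Asg 74 (V 60) ;; HX ;; Asg 61 (Bin And (V 70) (V 9))"
definition "GZ = Asg 71 (Bin Add (V 31) (Bin Add (V 25) (V 60))) ;; Asg 72 (V 16) ;; Asg 73 (V 13) ;; Asg 74 (V 40) ;; HX ;; Asg 61 (Bin And (V 70) (V 6))"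
text \<open>Words are compared for equality through their exclusive or. Register 55 records that the
  argument has an unmarked value; in all other cases the hash of the argument is taken.\<close>

definition "FMc = Asg 55 (C 0) ;;
  If (V 50) (V 3) (Cal 52 (V 50) ;; Asg 52 (Bin ShiftR (V 52) (V 30)) ;; Asg 60 (V 52) ;; HV ;; Asg 51 (V 61) ;;
    Asg 53 (Ld (Bin Add (V 32) (V 61))) ;; Cal 54 (V 53) ;; Asg 54 (Bin ShiftR (V 54) (V 30)) ;;
    If (V 55) (Bin Xor (V 54) (V 52)) (Asg 55 (C 1)) Skip) Skip ;;
  If (V 55) (C 1) (Asg 60 (V 50) ;; HU ;; Asg 51 (V 61)) Skip"
definition "STEP = FMc ;; Asg 60 (V 51) ;; GZ ;; Asg 50 (V 61)"
definition "CHK = If (V 50) (V 3) (Cal 46 (V 50) ;; Asg 46 (Bin ShiftR (V 46) (V 30)) ;;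
   If (Bin Xor (V 46) (V 33)) (C 1) (Asg 34 (C 1) ;; Asg 35 (V 50)) Skip) Skip"

text \<open>The limit numbers stand for kinds of loops: 0 for polylogarithmic ones, 1 for samples, 2
  for clusters, 3 for the steps of a chain, 4 for all chains of a block.\<close>

locale env = ram b N f sub \<tau> lm + lev b w N k kt f
  for b N f sub \<tau> lm w k kt +
  fixes reps :: nat
  assumes Nb: "N < 2 ^ b"
    and lm0: "w < lm 0" "k \<le> lm 0" "q \<le> lm 0" "reps \<le> lm 0"
    and lmL: "M \<le> lm 1" "2 ^ q \<le> lm 2" "t \<le> lm 3" "2 ^ q * m \<le> lm 4"
begin

definition "lE = (2::nat) ^ q * 2 ^ e"
text \<open>The computed part of a block: the hash table, the ends, and the numbers of the chains.
  The 8 in \<open>d0\<close> leaves room for a header of parameters in front of the random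
  words.\<close>

definition "DB = M + (lE + lE)"
definition "d0 = 8 + reps * BL"
definition "tot = d0 + (w + 1) * reps * DB"

definition par :: "(nat \<Rightarrow> nat) \<Rightarrow> bool" where
  "par s \<longleftrightarrow> s 3 = N \<and> s 4 = w \<and> s 5 = k \<and> s 6 = mask k \<and> s 7 = reps \<and> s 8 = M \<and> s 9 = mask mu \<and>
    s 10 = m \<and> s 11 = t \<and> s 12 = 2 ^ q \<and> s 13 = q \<and> s 14 = 2 ^ e \<and> s 15 = mask e \<and> s 16 = K \<and> s 17 = lE \<and>
    s 18 = BL \<and> s 19 = DB \<and> s 20 = w + 1 \<and> s 21 = 2 ^ q * m \<and> s 22 = d0 \<and> s 23 = kt \<and>
    s 24 = w + k + 2 \<and> s 25 = w + k + 2 + M \<and> s 27 = k - 3 * kt \<and> s 28 = mask (k - 3 * kt)"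

definition ctx :: "nat \<Rightarrow> nat \<Rightarrow> nat \<Rightarrow> (nat \<Rightarrow> nat) \<Rightarrow> bool" where
  "ctx sh rb db s \<longleftrightarrow> par s \<and> s 30 = sh \<and> s 31 = rb \<and> s 32 = db"

lemma par_cong: "par s \<Longrightarrow> (\<And>r. r < 30 \<Longrightarrow> s' r = s r) \<Longrightarrow> par s'"
  by (simp add: par_def)

lemma ctx_cong: "ctx sh rb db s \<Longrightarrow> (\<And>r. r < 33 \<Longrightarrow> s' r = s r) \<Longrightarrow> ctx sh rb db s'"
  by (simp add: ctx_def par_def)

lemma parD:
  assumes "par s"
  shows "s 3 = N" "s 4 = w" "s 5 = k" "s 6 = mask k" "s 7 = reps" "s 8 = M" "s 9 = mask mu"
    "s 10 = m" "s 11 = t" "s 12 = 2 ^ q" "s 13 = q" "s 14 = 2 ^ e" "s 15 = mask e" "s 16 = K" "s 17 = lE"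
    "s 18 = BL" "s 19 = DB" "s 20 = w + 1" "s 21 = 2 ^ q * m" "s 22 = d0" "s 23 = kt"
    "s 24 = w + k + 2" "s 25 = w + k + 2 + M" "s 27 = k - 3 * kt" "s 28 = mask (k - 3 * kt)"
  using assms unfolding par_def by blast+

lemma ctxD:
  assumes "ctx sh rb db s"
  shows "par s" "s 30 = sh" "s 31 = rb" "s 32 = db"
  using assms unfolding ctx_def by blast+

lemmas [simp] = b_gt_0

lemmas exc_simps = exc.simps(1-6)

lemma exc_HX:
  assumes "s 71 + s 73 * s 72 < 2 ^ b" "s 73 \<le> lm 0" "\<And>c. c \<le> s 73 \<Longrightarrow> mm (s 71 + c * s 72) < 2 ^ b"
  shows "exc HX s mm (\<lambda>s' m'. m' = mm \<and> s' 70 = hx (\<lambda>i. mm (s 71 + i)) (s 72) (s 73) (s 74) \<and> (\<forall>r<70. s' r = s r))"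
proof -
  have bit: "drop_bit c v mod 2 * x mod 2 ^ b = (if bit v c then x else 0)" if "x < 2 ^ b" for c v x :: nat
    using that by (simp add: bit_iff_odd_drop_bit mod_2_eq_odd)
  show ?thesis
    unfolding HX_def exc_simps
  proof (rule exc_For[where J = "\<lambda>j s' m'. m' = mm \<and> s' 70 = hx (\<lambda>i. mm (s 71 + i)) (s 72) j (s 74) \<and> s' 76 = s 71 + j * s 72 \<and>
      s' 71 = s 71 \<and> s' 72 = s 72 \<and> s' 74 = s 74 \<and> (\<forall>r<70. s' r = s r)"], goal_cases)
    case (3 j s' m')
    have j: "Suc j \<le> s 73"
      using 3(1) by simp
    then have "Suc j * s 72 \<le> s 73 * s 72"
      by (rule mult_le_mono1)
    then have "(s 71 + j * s 72 + s 72) mod 2 ^ b = s 71 + (s 72 + j * s 72)"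
      using assms(1) by (subst mod_less) simp_all
    then show ?case
      using 3 assms(3)[OF j] b1 by (simp add: bit add.assoc)
  qed (use assms in auto)
qed

definition rok :: "nat \<Rightarrow> (nat \<Rightarrow> nat) \<Rightarrow> (nat \<Rightarrow> nat) \<Rightarrow> bool" where
  "rok rb X mm \<longleftrightarrow> (\<forall>i<BL. mm (rb + i) = X i \<and> X i < 2 ^ b)"

lemma rokD: "rok rb X mm \<Longrightarrow> i < BL \<Longrightarrow> mm (rb + i) = X i" "rok rb X mm \<Longrightarrow> i < BL \<Longrightarrow> X i < 2 ^ b"
  by (auto simp: rok_def)

lemma BL_eq: "BL = w + k + 2 + M + q * K + K"
  by (simp add: BL_def)

lemma exc_HV:
  assumes "ctx sh rb db s" "rok rb X mm" "rb + BL < 2 ^ b"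
  shows "exc HV s mm (\<lambda>s' m'. m' = mm \<and> s' 61 = h X (s 60) \<and> (\<forall>r<61. s' r = s r))"
proof -
  have eq: "hx (\<lambda>i. mm (rb + i)) 1 w v = hx X 1 w v" for v
    using BL_eq by (intro hx_cong rokD(1)[OF assms(2)]) simp
  have lt: "mm (rb + c) < 2 ^ b" if "c \<le> w" for c
    using that rokD[OF assms(2), of c] BL_eq by simp
  show ?thesis
    unfolding HV_def exc_simps
    by (rule exc_mono[OF exc_HX])
      (use assms(3) BL_eq lm0 lt eq in \<open>auto simp: ctxD[OF assms(1)] parD[OF ctxD(1)[OF assms(1)]] h_def take_bit_eq_mask\<close>)
qed

lemma exc_HU:
  assumes "ctx sh rb db s" "rok rb X mm" "rb + BL < 2 ^ b"
  shows "exc HU s mm (\<lambda>s' m'. m' = mm \<and> s' 61 = h' X (s 60) \<and> (\<forall>r<61. s' r = s r))"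
proof -
  have eq: "hx (\<lambda>i. mm (Suc (rb + (w + i)))) 1 k v = hx (\<lambda>i. X (Suc (w + i))) 1 k v" for v
    using BL_eq rokD(1)[OF assms(2), of "Suc (w + c)" for c] by (intro hx_cong) simp
  have lt: "mm (Suc (rb + (w + c))) < 2 ^ b" if "c \<le> k" for c
    using that rokD[OF assms(2), of "Suc (w + c)"] BL_eq by simp
  show ?thesis
    unfolding HU_def exc_simps
    by (rule exc_mono[OF exc_HX])
      (use assms(3) BL_eq lm0 lt eq in \<open>auto simp: ctxD[OF assms(1)] parD[OF ctxD(1)[OF assms(1)]] h'_def take_bit_eq_mask add.assoc\<close>)
qed

lemma exc_GZ:
  assumes "ctx sh rb db s" "rok rb X mm" "rb + BL < 2 ^ b" "s 60 < K"
  shows "exc GZ s mm (\<lambda>s' m'. m' = mm \<and> s' 61 = gg X (s 40) (s 60) \<and> (\<forall>r<61. s' r = s r))"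
proof -
  have lt0: "w + k + 2 + M + s 60 + c * K < BL" if "c \<le> q" for c
    using assms(4) mult_le_mono1[OF that, of K] BL_eq by linarith
  have eq: "hx (\<lambda>i. mm (rb + (w + k + 2 + M + s 60) + i)) K q v = hx (\<lambda>c. X (w + k + 2 + M + s 60 + c)) K q v" for v
    using lt0 rokD(1)[OF assms(2), of "w + k + 2 + M + s 60 + c" for c] by (intro hx_cong) (simp add: add.assoc)
  have lt: "mm (rb + (w + k + 2 + M + s 60) + c * K) < 2 ^ b" if "c \<le> q" for c
    using lt0[OF that] rokD[OF assms(2), of "w + k + 2 + M + s 60 + c * K"] by (simp add: add.assoc)
  have a: "(rb + (w + k + 2 + M + s 60) mod 2 ^ b) mod 2 ^ b = rb + (w + k + 2 + M + s 60)"
    "rb + (w + k + 2 + M + s 60) + q * K < 2 ^ b"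
    using lt0[of q] assms(3) by simp_all
  show ?thesis
    unfolding GZ_def exc_simps
    by (rule exc_mono[OF exc_HX])
      (use lm0 lt eq a in \<open>auto simp: ctxD[OF assms(1)] parD[OF ctxD(1)[OF assms(1)]] gg_def take_bit_eq_mask\<close>)
qed

abbreviation "HTs sh \<equiv> blk.HT w N k kt (fsh sh)"
abbreviation "FF sh \<equiv> blk.F w N k kt (fsh sh)"

lemma HTs_eq: "HTs sh X = tab N (fsh sh) (h X) (smp X) M"
  by (rule blk.HT_def[OF fsh_blk])

lemma FF_eq: "FF sh X u = (if u < N \<and> fsh sh (HTs sh X (h X (fsh sh u))) \<noteq> fsh sh u then h X (fsh sh u) else h' X u)"
  by (rule blk.F_def[OF fsh_blk])

lemma FF_less: "FF sh X u < M"
  by (simp add: FF_eq h_less h'_less)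

lemma HTs_less: "HTs sh X z < N"
  unfolding HTs_eq using N by (intro tab_less) simp

definition bmem :: "nat \<Rightarrow> nat \<Rightarrow> nat \<Rightarrow> (nat \<Rightarrow> nat) \<Rightarrow> (nat \<Rightarrow> nat) \<Rightarrow> bool" where
  "bmem sh rb db X mm \<longleftrightarrow> rok rb X mm \<and> rb + BL < 2 ^ b \<and> db + DB < 2 ^ b \<and> (\<forall>z<M. mm (db + z) = HTs sh X z)"

lemma xor_eq_0: "x XOR y = 0 \<longleftrightarrow> x = (y::nat)"
  by (metis xor.right_neutral xor_cancel xor_self_eq xor.commute)

lemma xor_pos_iff: "0 < x XOR y \<longleftrightarrow> x \<noteq> (y::nat)"
  by (metis xor_eq_0 neq0_conv)

lemma exc_FMc:
  assumes "ctx sh rb db s" "bmem sh rb db X mm"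
  shows "exc FMc s mm (\<lambda>s' m'. m' = mm \<and> s' 51 = FF sh X (s 50) \<and> (\<forall>r<51. s' r = s r))"
proof -
  have rok: "rok rb X mm" "rb + BL < 2 ^ b"
    using assms(2) by (auto simp: bmem_def)
  have HT: "mm ((db + z) mod 2 ^ b) = HTs sh X z" if "z < M" for z
    using that assms(2) by (simp add: bmem_def DB_def)
  have s: "s 3 = N" "s 30 = sh" "s 32 = db"
    by (simp_all add: ctxD[OF assms(1)] parD[OF ctxD(1)[OF assms(1)]])
  have U: "exc HU s1 mm (\<lambda>s2 m2. exc (Asg 51 (V 61)) s2 m2 (\<lambda>s' m'. m' = mm \<and> s' 51 = FF sh X (s 50) \<and> (\<forall>r<51. s' r = s r)))"
    if "\<And>r. r < 51 \<Longrightarrow> s1 r = s r" "s1 60 = s 50" "FF sh X (s 50) = h' X (s 50)" for s1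
    using that by (intro exc_mono[OF exc_HU[OF ctx_cong[OF assms(1)] rok]]) auto
  show ?thesis
  proof (cases "s 50 < N")
    case False
    then show ?thesis
      unfolding FMc_def exc_simps using b1 s U[of "s(55 := 0, 60 := s 50)"] by (simp add: FF_eq)
  next
    case True
    show ?thesis
      unfolding FMc_def exc_simps(5)
    proof (simp add: s True del: Not_eq_iff, rule exc_mono[OF exc_HV[OF ctx_cong[OF assms(1)] rok]], simp, goal_cases)
      case (1 s1 m1)
      then have p: "m1 = mm" "s1 61 = h X (fsh sh (s 50))" "s1 52 = fsh sh (s 50)" "s1 32 = db" "s1 30 = sh" "s1 50 = s 50" "s1 55 = 0"
        "\<And>r. r < 51 \<Longrightarrow> s1 r = s r"
        using s by (simp_all add: fsh_def)
      show ?case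
        using U FF_eq[of sh X "s 50"] True
        by (auto simp: p HT h_less HTs_less xor_pos_iff xor_eq_0 fsh_def[symmetric])
    qed
  qed
qed

lemma exc_STEP:
  assumes "ctx sh rb db s" "bmem sh rb db X mm"
  shows "exc STEP s mm (\<lambda>s' m'. m' = mm \<and> s' 50 = gg X (s 40) (FF sh X (s 50)) \<and> (\<forall>r<50. s' r = s r))"
proof -
  have rok: "rok rb X mm" "rb + BL < 2 ^ b"
    using assms(2) by (auto simp: bmem_def)
  have "FF sh X u < K" for u
    using FF_less[of sh X u] by (simp add: K_def)
  then show ?thesis
    unfolding STEP_def exc_simps(5)
    by (intro exc_mono[OF exc_FMc[OF assms]])
      (auto intro!: exc_mono[OF exc_GZ[OF ctx_cong[OF assms(1)] rok]])
qed

lemma exc_CHK: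
  assumes "ctx sh rb db s"
  shows "exc CHK s mm (\<lambda>s' m'. m' = mm \<and> (\<forall>r. r \<notin> {34, 35, 46} \<longrightarrow> s' r = s r) \<and>
    (if s 50 < N \<and> fsh sh (s 50) = s 33 then s' 34 = 1 \<and> s' 35 = s 50 else s' 34 = s 34 \<and> s' 35 = s 35))"
proof -
  have x: "x XOR y < Suc 0 \<longleftrightarrow> x = y" for x y :: nat
    using xor_pos_iff[of x y] by auto
  show ?thesis
    unfolding CHK_def exc_simps by (auto simp: ctxD[OF assms(1)] parD[OF ctxD(1)[OF assms(1)]] fsh_def x xor_eq_0)
qed

end

section \<open>Searching one block\<close>

definition "Q1 = Asg 60 (V 33) ;; HV ;; Asg 60 (V 61) ;; GZ ;; Asg 50 (V 61)"
definition "LK = If (V 47) (C 1) (Asg 49 (Bin Add (V 48) (Bin And (V 50) (V 15))) ;;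
  If (Bin Xor (Ld (V 49)) (V 50)) (C 1) (Asg 47 (Ld (Bin Add (V 49) (V 17)))) Skip) Skip"
definition "L1 = For 41 11 3 (LK ;; STEP)"
definition "L2 = For 41 11 3 (CHK ;; STEP)"
definition "QD = If (C 0) (V 47) (Asg 60 (Bin Sub (Bin Add (V 8) (V 47)) (C 1)) ;; GZ ;; Asg 50 (V 61) ;; L2) Skip"
definition "QC = Q1 ;; Asg 47 (C 0) ;; Asg 48 (Bin Add (Bin Add (V 32) (V 8)) (Bin Mul (V 40) (V 14))) ;; L1 ;; QD"
definition "QB = Asg 60 (V 33) ;; HV ;; Asg 50 (Ld (Bin Add (V 32) (V 61))) ;; CHK ;; For 40 12 2 QC"

context env
begin

section \<open>Chains, the table of their ends, and the walk of a search\<close>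

definition chg :: "nat \<Rightarrow> (nat \<Rightarrow> nat) \<Rightarrow> nat \<Rightarrow> nat \<Rightarrow> nat \<Rightarrow> nat" where
  "chg sh X i j c = ((\<lambda>u. gg X i (FF sh X u)) ^^ c) (gg X i (M + j))"

lemma chg_0: "chg sh X i j 0 = gg X i (M + j)"
  and chg_Suc: "chg sh X i j (Suc c) = gg X i (FF sh X (chg sh X i j c))"
  by (simp_all add: chg_def)

lemma chains: "x < N \<Longrightarrow> chains k e M m t (FF sh X) x"
  using bounds N FF_less by unfold_locales auto

lemma row_nth: "z < K \<Longrightarrow> row X i ! z = gg X i z"
  by (simp add: row_def)

lemma chn_row: "j < m \<Longrightarrow> x < N \<Longrightarrow> chains.chn M (FF sh X) (row X i) j c = chg sh X i j c"
proof (induction c)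
  case 0
  then show ?case
    by (simp add: chains.chn_0[OF chains] chg_0 row_nth K_def)
next
  case (Suc c)
  have "FF sh X u < K" for u
    using FF_less[of sh X u] by (simp add: K_def)
  then show ?case
    using Suc by (simp add: chains.chn_Suc[OF chains] chg_Suc row_nth)
qed

text \<open>The content of the table of chain ends after \<open>r\<close> chains: at the place given by the low bits of
  the end, the end itself, and \<open>lE\<close> places behind it the number of the chain plus one.\<close>

fun em :: "nat \<Rightarrow> (nat \<Rightarrow> nat) \<Rightarrow> nat \<Rightarrow> nat \<Rightarrow> nat" where
  "em sh X 0 = (\<lambda>_. 0)"
| "em sh X (Suc r) = (let v = chg sh X (r div m) (r mod m) t; a = r div m * 2 ^ e + take_bit e v
     in (em sh X r)(a := v, a + lE := Suc (r mod m)))"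

lemma slot_less: "(i::nat) < 2 ^ q \<Longrightarrow> s < 2 ^ e \<Longrightarrow> i * 2 ^ e + s < lE"
  using mult_le_mono1[of "Suc i" "2 ^ q" "2 ^ e"] by (simp add: lE_def)

lemma slot_eq: "s < 2 ^ e \<Longrightarrow> s' < 2 ^ e \<Longrightarrow> i * 2 ^ e + s = i' * 2 ^ e + s' \<longleftrightarrow> i = i' \<and> s = (s' :: nat)"
  by (metis add.commute div_mult_self1 div_less add_0 mod_mult_self1 mod_less power_not_zero zero_neq_numeral)

text \<open>A later chain may overwrite a slot, but it replaces both cells, so an occupied slot
  always describes a single chain.\<close>

lemma em_entry:
  assumes "i < 2 ^ q" "s < 2 ^ e" "r \<le> 2 ^ q * m"
  shows "em sh X r (i * 2 ^ e + s + lE) = 0 \<or>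
    (\<exists>j<m. em sh X r (i * 2 ^ e + s + lE) = Suc j \<and> em sh X r (i * 2 ^ e + s) = chg sh X i j t \<and> take_bit e (chg sh X i j t) = s)"
  using assms(3)
proof (induction r)
  case (Suc r)
  define v where "v = chg sh X (r div m) (r mod m) t"
  define a where "a = r div m * 2 ^ e + take_bit e v"
  have "r div m < 2 ^ q"
    using Suc.prems by (simp add: less_mult_imp_div_less)
  then have a: "a < lE"
    unfolding a_def by (intro slot_less) simp_all
  have s: "i * 2 ^ e + s < lE"
    by (rule slot_less[OF assms(1,2)])
  have em: "em sh X (Suc r) = (em sh X r)(a := v, a + lE := Suc (r mod m))"
    by (simp add: v_def a_def Let_def)
  show ?case
  proof (cases "a = i * 2 ^ e + s")
    case True
    then have "r div m = i" "take_bit e v = s"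
      using slot_eq[of "take_bit e v" s "r div m" i] assms(2) by (simp_all add: a_def)
    then show ?thesis
      using True s a bounds(1) unfolding em v_def by (intro disjI2 exI[of _ "r mod m"]) auto
  next
    case False
    then show ?thesis
      using Suc a s unfolding em by auto
  qed
qed simp

text \<open>Slots are never emptied, because stored numbers are increased by one. Together with
  \<open>em_entry\<close>, a chain whose end differs in its low bits from all others of its cluster
  is still found in its slot.\<close>

lemma em_nonzero:
  assumes "i < 2 ^ q" "j < m" "i * m + j < r" "r \<le> 2 ^ q * m"
  shows "em sh X r (i * 2 ^ e + take_bit e (chg sh X i j t) + lE) \<noteq> 0"
  using assms(3,4)
proof (induction r)
  case (Suc r)
  have "i * 2 ^ e + take_bit e (chg sh X i j t) < lE"
    using assms by (intro slot_less) simp_all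
  moreover have "(i * m + j) div m = i" "(i * m + j) mod m = j"
    using assms(2) by simp_all
  moreover have "r div m * 2 ^ e + take_bit e (chg sh X (r div m) (r mod m) t) < lE"
    using Suc.prems by (intro slot_less) (simp_all add: less_mult_imp_div_less)
  ultimately show ?case
    using Suc by (cases "r = i * m + j") (auto simp: Let_def)
qed simp

text \<open>If \<open>x\<close> is a preimage of the unmarked value \<open>p\<close>, then
  \<open>F x\<close> is \<open>h X p\<close>, so this walk starts at the successor of
  \<open>x\<close> although \<open>x\<close> is unknown.\<close>

definition wk :: "nat \<Rightarrow> (nat \<Rightarrow> nat) \<Rightarrow> nat \<Rightarrow> nat \<Rightarrow> nat \<Rightarrow> nat" where
  "wk sh X i p c = ((\<lambda>u. gg X i (FF sh X u)) ^^ c) (gg X i (h X p))"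

lemma wk_0: "wk sh X i p 0 = gg X i (h X p)"
  and wk_Suc: "wk sh X i p (Suc c) = gg X i (FF sh X (wk sh X i p c))"
  by (simp_all add: wk_def)

abbreviation "ems sh X \<equiv> em sh X (2 ^ q * m)"

text \<open>The chain number plus one at the first match, and 0 as long as there is none. Keeping a
  single match limits a cluster to two walks of \<open>t\<close> steps.\<close>

fun fm :: "nat \<Rightarrow> (nat \<Rightarrow> nat) \<Rightarrow> nat \<Rightarrow> nat \<Rightarrow> nat \<Rightarrow> nat" where
  "fm sh X i p 0 = 0"
| "fm sh X i p (Suc c) = (let a = i * 2 ^ e + take_bit e (wk sh X i p c) in
     if fm sh X i p c = 0 \<and> ems sh X a = wk sh X i p c then ems sh X (a + lE) else fm sh X i p c)"

lemma fm_le: "i < 2 ^ q \<Longrightarrow> fm sh X i p c \<le> m"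
proof (induction c)
  case (Suc c)
  then show ?case
    using em_entry[of i "take_bit e (wk sh X i p c)" "2 ^ q * m" sh X] by (auto simp: Let_def)
qed simp

text \<open>A match before the end of chain \<open>j\<close> would identify an inner point of it
  with the end of some chain, which the distinctness in \<open>hit\<close> excludes; so no false
  alarm comes first. At the end of chain \<open>j\<close> the slot is still its own, as no other end
  shares its low bits.\<close>

lemma fm_hit:
  assumes i: "i < 2 ^ q" and x: "x < N" "fsh sh x = p" and um: "fsh sh (HTs sh X (h X p)) \<noteq> p"
    and ja: "j < m" "a < t" and hit: "chains.hit e M m t (FF sh X) x (row X i) j a"
  shows "fm sh X i p t = Suc j" and "chg sh X i j a = x"
proof -
  interpret c: chains k e M m t "FF sh X" x
    by (rule chains[OF x(1)])
  note hD = c.hit_D[OF hit]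
  have cr: "c.chn (row X i) j c = chg sh X i j c" if "j < m" for j c
    by (rule chn_row[OF that x(1)])
  obtain j0 where j0: "j0 < m" "j0 \<noteq> j"
    using c.exists_other by blast
  show xa: "chg sh X i j a = x"
    using hD(1)[OF j0] ja cr by simp
  have inj: "c = c'" if "c \<le> t" "c' \<le> t" "FF sh X (chg sh X i j c) = FF sh X (chg sh X i j c')" for c c'
    using hD(2)[OF j0 _ that(1,2)] that ja cr by simp
  have sep: "FF sh X (chg sh X i j c) \<noteq> FF sh X (chg sh X i j' c')" if "c \<le> t" "c' \<le> t" "j' < m" "j' \<noteq> j" for c c' j'
    using hD(3)[OF that(3,4) _ that(1,2)] that ja cr by simp
  have ends: "take_bit e (chg sh X i j t) \<noteq> take_bit e (chg sh X i j' t)" if "j' < m" "j' \<noteq> j" for j'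
    using hD(4)[OF that] that ja cr by simp
  have "FF sh X x = h X p"
    using x um by (simp add: FF_eq)
  then have w: "wk sh X i p s = chg sh X i j (Suc (a + s))" for s
    by (induction s) (simp_all add: wk_0 wk_Suc chg_Suc xa)
  have zero: "fm sh X i p s = 0" if "s \<le> t - Suc a" for s
    using that
  proof (induction s)
    case (Suc s)
    let ?u = "wk sh X i p s"
    let ?a = "i * 2 ^ e + take_bit e ?u"
    have "ems sh X (?a + lE) = 0 \<or> ems sh X ?a \<noteq> ?u"
    proof (rule ccontr)
      assume "\<not> ?thesis"
      then obtain j' where j': "j' < m" "?u = chg sh X i j' t"
        using em_entry[OF i, of "take_bit e ?u" "2 ^ q * m" sh X] by auto
      have "Suc (a + s) < t"
        using Suc.prems ja by simp
      then show False
        using inj[of "Suc (a + s)" t] sep[of "Suc (a + s)" t j'] j' unfolding w by (cases "j' = j") auto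
    qed
    then show ?case
      using Suc by (auto simp: Let_def)
  qed simp
  have last: "fm sh X i p (Suc (t - Suc a)) = Suc j"
  proof -
    have u: "wk sh X i p (t - Suc a) = chg sh X i j t"
      unfolding w using ja by simp
    have "i * m + j < 2 ^ q * m"
      using mult_le_mono1[of "Suc i" "2 ^ q" m] i ja(1) by simp
    from em_nonzero[OF i ja(1) this order_refl, of sh X] em_entry[OF i, of "take_bit e (chg sh X i j t)" "2 ^ q * m" sh X]
    obtain j' where "j' < m" "ems sh X (i * 2 ^ e + take_bit e (chg sh X i j t) + lE) = Suc j'"
      "ems sh X (i * 2 ^ e + take_bit e (chg sh X i j t)) = chg sh X i j' t" "take_bit e (chg sh X i j' t) = take_bit e (chg sh X i j t)"
      by auto
    moreover from this have "j' = j"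
      using ends[of j'] by force
    ultimately show ?thesis
      using zero[of "t - Suc a"] by (simp add: u Let_def)
  qed
  have "fm sh X i p (Suc (t - Suc a) + d) = Suc j" for d
    by (induction d) (use last in \<open>auto simp: Let_def\<close>)
  from this[of a] show "fm sh X i p t = Suc j"
    using ja by simp
qed

definition qmem :: "nat \<Rightarrow> nat \<Rightarrow> nat \<Rightarrow> (nat \<Rightarrow> nat) \<Rightarrow> (nat \<Rightarrow> nat) \<Rightarrow> bool" where
  "qmem sh rb db X mm \<longleftrightarrow> bmem sh rb db X mm \<and> (\<forall>a<lE + lE. mm (db + M + a) = ems sh X a)"

lemma qmemD:
  assumes "qmem sh rb db X mm"
  shows "bmem sh rb db X mm" "rok rb X mm" "rb + BL < 2 ^ b" "db + DB < 2 ^ b"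
    "\<And>z. z < M \<Longrightarrow> mm (db + z) = HTs sh X z" "\<And>a. a < lE + lE \<Longrightarrow> mm (db + M + a) = ems sh X a"
  using assms by (auto simp: qmem_def bmem_def)

lemma exc_Q1:
  assumes "ctx sh rb db s" "qmem sh rb db X mm"
  shows "exc Q1 s mm (\<lambda>s' m'. m' = mm \<and> s' 50 = gg X (s 40) (h X (s 33)) \<and> (\<forall>r<50. s' r = s r))"
proof -
  have "h X v < K" for v
    using h_less[of X v] by (simp add: K_def)
  then show ?thesis
    unfolding Q1_def exc_simps
    by (intro exc_mono[OF exc_HV[OF ctx_cong[OF assms(1)] qmemD(2,3)[OF assms(2)]]])
      (auto intro!: exc_mono[OF exc_GZ[OF ctx_cong[OF assms(1)] qmemD(2,3)[OF assms(2)]]])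
qed

lemma exc_LK:
  assumes c: "ctx sh rb db s" and q: "qmem sh rb db X mm" and i: "i < 2 ^ q" and s: "s 48 = db + M + i * 2 ^ e"
  shows "exc LK s mm (\<lambda>s' m'. m' = mm \<and> (\<forall>r. r \<notin> {47, 49} \<longrightarrow> s' r = s r) \<and>
    s' 47 = (let a = i * 2 ^ e + take_bit e (s 50) in
      if s 47 = 0 \<and> ems sh X a = s 50 then ems sh X (a + lE) else s 47))"
proof -
  let ?a = "i * 2 ^ e + take_bit e (s 50)"
  have a: "?a < lE"
    using i by (intro slot_less) simp_all
  have and_eq: "s 50 AND mask e = take_bit e (s 50)"
    by (simp add: take_bit_eq_mask)
  have 1: "(db + M + i * 2 ^ e + take_bit e (s 50)) mod 2 ^ b = db + M + ?a"
    using a qmemD(4)[OF q] by (subst mod_less) (simp_all add: DB_def)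
  have 2: "(db + M + ?a + lE) mod 2 ^ b = db + M + (?a + lE)"
    using a qmemD(4)[OF q] by (subst mod_less) (simp_all add: DB_def)
  have 3: "mm (db + M + ?a) = ems sh X ?a" "mm (db + M + (?a + lE)) = ems sh X (?a + lE)"
    using a by (simp_all only: qmemD(6)[OF q])
  show ?thesis
    unfolding LK_def exc_simps
    by (simp only: ev.simps apply_binop.simps s parD[OF ctxD(1)[OF c]] and_eq fun_upd_same fun_upd_apply 1)
      (simp add: s parD[OF ctxD(1)[OF c]] and_eq 1 2 3 Let_def xor_eq_0)
qed

lemma exc_L1:
  assumes c: "ctx sh rb db s" and q: "qmem sh rb db X mm" and i: "s 40 < 2 ^ q" and s: "s 48 = db + M + s 40 * 2 ^ e"
    and w: "s 47 = 0" "s 50 = wk sh X (s 40) p 0"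
  shows "exc L1 s mm (\<lambda>s' m'. m' = mm \<and> s' 47 = fm sh X (s 40) p t \<and> (\<forall>r<50. r \<notin> {41, 47, 49} \<longrightarrow> s' r = s r))"
  unfolding L1_def
proof (rule exc_For[where J = "\<lambda>j s' m'. m' = mm \<and> s' 47 = fm sh X (s 40) p j \<and> s' 50 = wk sh X (s 40) p j \<and>
     (\<forall>r<50. r \<notin> {41, 47, 49} \<longrightarrow> s' r = s r)"], goal_cases)
  case (3 j s' m')
  then have *: "m' = mm" "s' 47 = fm sh X (s 40) p j" "s' 50 = wk sh X (s 40) p j" "s' 41 = j" "s' 40 = s 40"
    "s' 48 = db + M + s 40 * 2 ^ e" "s' 11 = s 11" "\<And>r. r < 50 \<Longrightarrow> r \<notin> {41, 47, 49} \<Longrightarrow> s' r = s r"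
    using s by auto
  have c': "ctx sh rb db s'"
    using * by (intro ctx_cong[OF c]) simp
  show ?case
    unfolding exc_simps *(1)
  proof (rule exc_mono[OF exc_LK[OF c' q i *(6)]], goal_cases)
    case (1 s1 m1)
    have c1: "ctx sh rb db s1"
      using 1 by (intro ctx_cong[OF c']) simp
    show ?case
      using 1 qmemD(1)[OF q] *
      by (auto simp: wk_Suc Let_def intro!: exc_mono[OF exc_STEP[OF c1]])
  qed
qed (use w parD[OF ctxD(1)[OF c]] lmL in auto)

text \<open>Soundness for arbitrary random words: registers 34 and 35 change only to a verified
  preimage. Completeness is stated separately, under \<open>bgood\<close> or
  \<open>cgood\<close>.\<close>

definition fnd :: "nat \<Rightarrow> (nat \<Rightarrow> nat) \<Rightarrow> (nat \<Rightarrow> nat) \<Rightarrow> bool" where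
  "fnd sh s s' \<longleftrightarrow> s' 34 = s 34 \<and> s' 35 = s 35 \<or> s' 34 = 1 \<and> s' 35 < N \<and> fsh sh (s' 35) = s 33"

lemma fnd_trans: "fnd sh s s1 \<Longrightarrow> fnd sh s1 s2 \<Longrightarrow> s1 33 = s 33 \<Longrightarrow> fnd sh s s2"
  by (auto simp: fnd_def)

lemma fnd_found: "fnd sh s s' \<Longrightarrow> s 34 = 1 \<Longrightarrow> s' 34 = 1"
  by (auto simp: fnd_def)

lemma fnd_upd: "r \<notin> {34, 35} \<Longrightarrow> fnd sh s (s'(r := v)) = fnd sh s s'"
  by (simp add: fnd_def)

lemma exc_L2:
  assumes c: "ctx sh rb db s" and q: "qmem sh rb db X mm" and w: "s 50 = chg sh X (s 40) j0 0"
  shows "exc L2 s mm (\<lambda>s' m'. m' = mm \<and> fnd sh s s' \<and>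
    ((\<exists>a<t. chg sh X (s 40) j0 a < N \<and> fsh sh (chg sh X (s 40) j0 a) = s 33) \<longrightarrow> s' 34 = 1) \<and>
    (\<forall>r<50. r \<notin> {34, 35, 41, 46} \<longrightarrow> s' r = s r))"
  unfolding L2_def
proof (rule exc_For[where J = "\<lambda>j s' m'. m' = mm \<and> s' 50 = chg sh X (s 40) j0 j \<and> fnd sh s s' \<and>
    ((\<exists>a<j. chg sh X (s 40) j0 a < N \<and> fsh sh (chg sh X (s 40) j0 a) = s 33) \<longrightarrow> s' 34 = 1) \<and>
     (\<forall>r<50. r \<notin> {34, 35, 41, 46} \<longrightarrow> s' r = s r)"], goal_cases)
  case (3 j s' m')
  then have *: "m' = mm" "s' 50 = chg sh X (s 40) j0 j" "s' 41 = j" "s' 40 = s 40" "s' 33 = s 33" "s' 11 = s 11"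
     "\<And>r. r < 50 \<Longrightarrow> r \<notin> {34, 35, 41, 46} \<Longrightarrow> s' r = s r"
    by auto
  have c': "ctx sh rb db s'"
    using * by (intro ctx_cong[OF c]) simp
  show ?case
    unfolding exc_simps *(1)
  proof (rule exc_mono[OF exc_CHK[OF c']], goal_cases)
    case (1 s1 m1)
    then have p: "m1 = mm" "s1 50 = chg sh X (s 40) j0 j" "s1 40 = s 40" "s1 41 = j" "s1 11 = s 11"
      "\<And>r. r < 50 \<Longrightarrow> r \<notin> {34, 35, 41, 46} \<Longrightarrow> s1 r = s r"
      using * by auto
    have c1: "ctx sh rb db s1"
      using p by (intro ctx_cong[OF c]) simp
    have f: "fnd sh s s1" "(\<exists>a<Suc j. chg sh X (s 40) j0 a < N \<and> fsh sh (chg sh X (s 40) j0 a) = s 33) \<longrightarrow> s1 34 = 1"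
      using 1 3(2) * unfolding fnd_def less_Suc_eq by (auto split: if_splits)
    show ?case
      unfolding p(1)
    proof (rule exc_mono[OF exc_STEP[OF c1 qmemD(1)[OF q]]], goal_cases)
      case (1 s2 m2)
      then have "s2 34 = s1 34" "s2 35 = s1 35" "\<And>r. r < 50 \<Longrightarrow> s2 r = s1 r" "m2 = mm" "s2 50 = chg sh X (s 40) j0 (Suc j)"
        using p by (auto simp: chg_Suc)
      then show ?case
        using f p by (simp add: fnd_def)
    qed
  qed
qed (use w parD[OF ctxD(1)[OF c]] lmL in \<open>auto simp: fnd_def\<close>)

definition cgood :: "nat \<Rightarrow> (nat \<Rightarrow> nat) \<Rightarrow> nat \<Rightarrow> nat \<Rightarrow> bool" where
  "cgood sh X i p \<longleftrightarrow> (\<exists>x<N. fsh sh x = p \<and> fsh sh (HTs sh X (h X p)) \<noteq> p \<and> chains.hits e M m t (FF sh X) x (row X i))"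

text \<open>The chain named by the match is traversed from its start and each point is tested, since
  the match does not tell at which position \<open>x\<close> lies.\<close>

lemma exc_QC:
  assumes c: "ctx sh rb db s" and q: "qmem sh rb db X mm" and i: "s 40 < 2 ^ q"
  shows "exc QC s mm (\<lambda>s' m'. m' = mm \<and> fnd sh s s' \<and> (cgood sh X (s 40) (s 33) \<longrightarrow> s' 34 = 1) \<and>
    (\<forall>r<41. r \<notin> {34, 35} \<longrightarrow> s' r = s r))"
  unfolding QC_def exc_simps
proof (rule exc_mono[OF exc_Q1[OF c q]], goal_cases)
  case (1 s1 m1)
  let ?p = "s 33"
  have a: "s 40 * 2 ^ e < lE"
    using slot_less[OF i, of 0] by simp
  have m: "(db + M) mod 2 ^ b = db + M" "(s 40 * 2 ^ e) mod 2 ^ b = s 40 * 2 ^ e" "(db + M + s 40 * 2 ^ e) mod 2 ^ b = db + M + s 40 * 2 ^ e"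
    using a qmemD(4)[OF q] by (simp_all add: DB_def)
  let ?s2 = "s1(47 := 0, 48 := db + M + s 40 * 2 ^ e)"
  have s1: "m1 = mm" "s1 40 = s 40" "s1 32 = db" "s1 8 = M" "s1 14 = 2 ^ e" "s1 50 = wk sh X (s 40) ?p 0"
    "\<And>r. r < 50 \<Longrightarrow> s1 r = s r"
    using 1 ctxD[OF c] parD[OF ctxD(1)[OF c]] by (auto simp: wk_0)
  have c2: "ctx sh rb db ?s2"
    using s1 by (intro ctx_cong[OF c]) simp
  have "exc L1 ?s2 mm (\<lambda>sa ma. exc QD sa ma
     (\<lambda>s' m'. m' = mm \<and> fnd sh s s' \<and> (cgood sh X (s 40) (s 33) \<longrightarrow> s' 34 = 1) \<and> (\<forall>r<41. r \<notin> {34, 35} \<longrightarrow> s' r = s r)))"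
  proof (rule exc_mono[OF exc_L1[OF c2 q, where p = ?p]], goal_cases)
    case (5 s3 m3)
    then have s3: "m3 = mm" "s3 47 = fm sh X (s 40) ?p t" "s3 40 = s 40" "s3 8 = M" "s3 33 = s 33" "s3 34 = s1 34" "s3 35 = s1 35"
       "\<And>r. r < 50 \<Longrightarrow> r \<notin> {41, 47, 48, 49} \<Longrightarrow> s3 r = s1 r"
      using s1 by auto
    have c3: "ctx sh rb db s3"
      using s3 s1 by (intro ctx_cong[OF c]) simp
    have gd: "\<exists>x<N. \<exists>j a. fsh sh x = ?p \<and> fm sh X (s 40) ?p t = Suc j \<and> a < t \<and> chg sh X (s 40) j a = x" if "cgood sh X (s 40) ?p"
    proof -
      from that obtain x where x: "x < N" "fsh sh x = ?p" "fsh sh (HTs sh X (h X ?p)) \<noteq> ?p" "chains.hits e M m t (FF sh X) x (row X (s 40))"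
        by (auto simp: cgood_def)
      then obtain j a where "j < m" "a < t" "chains.hit e M m t (FF sh X) x (row X (s 40)) j a"
        by (auto simp: chains.hits_def[OF chains[OF x(1)]])
      then show ?thesis
        using fm_hit[OF i x(1-3)] x by blast
    qed
    show ?case
    proof (cases "fm sh X (s 40) ?p t")
      case 0
      then have "\<not> cgood sh X (s 40) ?p"
        using gd by force
      then show ?thesis
        unfolding QD_def exc_simps using 0 s3 s1 by (simp add: fnd_def)
    next
      case (Suc j)
      then have j: "j < m"
        using fm_le[OF i, of sh X ?p t] by simp
      have "M + m < 2 ^ b"
        using qmemD(3)[OF q] BL_eq by (simp add: K_def)
      then have sub: "((M + Suc j) mod 2 ^ b + 2 ^ b - Suc 0) mod 2 ^ b = M + j" "M + j < K"
        using j by (simp_all add: K_def)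
      have c4: "ctx sh rb db (s3(60 := M + j))"
        using s3 s1 by (intro ctx_cong[OF c]) simp
      show ?thesis
        unfolding QD_def exc_simps s3(1)
      proof (simp add: s3 Suc sub del: mult_Suc add_Suc_right, rule exc_mono[OF exc_GZ[OF c4 qmemD(2,3)[OF q]]], goal_cases)
        case (2 s5 m5)
        then have s5: "m5 = mm" "s5 61 = chg sh X (s 40) j 0" "\<And>r. r < 61 \<Longrightarrow> s5 r = (s3(60 := M + j)) r"
          using s3 by (auto simp: chg_0)
        have s5': "s5 40 = s 40" "s5 33 = ?p" "s5 34 = s1 34" "s5 35 = s1 35"
          using s5 s3 by simp_all
        have c5: "ctx sh rb db (s5(50 := s5 61))"
          using s5 s3 s1 by (intro ctx_cong[OF c]) simp
        show ?case
          unfolding s5(1)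
        proof (rule exc_mono[OF exc_L2[OF c5 q, where ?j0.0 = j]], goal_cases)
          case (2 s6 m6)
          have "cgood sh X (s 40) ?p \<Longrightarrow> s6 34 = 1"
            using gd Suc 2 s5' by auto
          then show ?case
            using 2 s5 s5' s3 s1 by (auto simp: fnd_def)
        qed (simp add: s5 s5')
      qed (simp add: sub)
    qed
  qed (use i s1 in auto)
  then show ?case
    by (simp add: s1 m)
qed

lemma exc_QB:
  assumes c: "ctx sh rb db s" and q: "qmem sh rb db X mm"
  shows "exc QB s mm (\<lambda>s' m'. m' = mm \<and> fnd sh s s' \<and>
    ((\<exists>x<N. fsh sh x = s 33 \<and> blk.bgood w N k kt (fsh sh) X x) \<longrightarrow> s' 34 = 1) \<and>
    (\<forall>r<40. r \<notin> {34, 35} \<longrightarrow> s' r = s r))"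
  unfolding QB_def exc_simps
proof (rule exc_mono[OF exc_HV[OF ctx_cong[OF c] qmemD(2,3)[OF q]]], simp, goal_cases)
  case (1 s1 m1)
  let ?p = "s 33"
  let ?u = "HTs sh X (h X ?p)"
  have s1: "m1 = mm" "s1 61 = h X ?p" "s1 32 = db" "\<And>r. r < 60 \<Longrightarrow> s1 r = s r"
    using 1 ctxD[OF c] by auto
  have ld: "mm ((db + h X ?p) mod 2 ^ b) = ?u"
    using qmemD(4,5)[OF q] h_less[of X ?p] by (simp add: DB_def)
  have c2: "ctx sh rb db (s1(50 := ?u))"
    using s1 by (intro ctx_cong[OF c]) simp
  have "exc CHK (s1(50 := ?u)) mm (\<lambda>s2 m2. exc (For 40 12 2 QC) s2 m2
     (\<lambda>s' m'. m' = mm \<and> fnd sh s s' \<and> ((\<exists>x<N. fsh sh x = s 33 \<and> blk.bgood w N k kt (fsh sh) X x) \<longrightarrow> s' 34 = 1) \<and>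
    (\<forall>r<40. r \<notin> {34, 35} \<longrightarrow> s' r = s r)))"
  proof (rule exc_mono[OF exc_CHK[OF c2]], goal_cases)
    case (1 s2 m2)
    have s2: "m2 = mm" "\<And>r. r < 40 \<Longrightarrow> r \<notin> {34, 35} \<Longrightarrow> s2 r = s r" "fnd sh s s2" "fsh sh ?u = ?p \<Longrightarrow> s2 34 = 1"
      using 1 s1 HTs_less[of sh X "h X ?p"] by (auto simp: fnd_def split: if_splits)
    show ?case
    proof (rule exc_For[where J = "\<lambda>j s' m'. m' = mm \<and> fnd sh s s' \<and> (fsh sh ?u = ?p \<or> (\<exists>i<j. cgood sh X i ?p) \<longrightarrow> s' 34 = 1) \<and>
       (\<forall>r<40. r \<notin> {34, 35} \<longrightarrow> s' r = s r)"], goal_cases)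
      case (3 j s' m')
      have c3: "ctx sh rb db s'"
        using 3 by (intro ctx_cong[OF c]) simp
      have n: "s 12 = 2 ^ q" "s2 12 = 2 ^ q" "s' 12 = 2 ^ q" "s' 33 = s 33"
        using 3 s2 parD[OF ctxD(1)[OF c]] by auto
      then have j: "s' 40 < 2 ^ q"
        using 3 by simp
      have m': "m' = mm"
        using 3 by simp
      show ?case
        unfolding m'
      proof (rule exc_mono[OF exc_QC[OF c3 q j]], goal_cases)
        case (1 s4 m4)
        have s': "fnd sh s s'" "fsh sh ?u = ?p \<or> (\<exists>i<j. cgood sh X i ?p) \<longrightarrow> s' 34 = 1" "s' 40 = j"
          "\<And>r. r < 40 \<Longrightarrow> r \<notin> {34, 35} \<Longrightarrow> s' r = s r"
          using 3 by auto
        have s4: "fnd sh s' s4" "cgood sh X j ?p \<longrightarrow> s4 34 = 1" "m4 = mm" "s4 40 = j"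
          "\<And>r. r < 40 \<Longrightarrow> r \<notin> {34, 35} \<Longrightarrow> s4 r = s r"
          using 1 s'(3,4) n(4) by auto
        have f: "fnd sh s s4"
          using fnd_trans[OF s'(1) s4(1)] n by simp
        have "fsh sh ?u = ?p \<or> (\<exists>i<Suc j. cgood sh X i ?p) \<longrightarrow> s4 34 = 1"
          using s'(2) s4(2) fnd_found[OF s4(1)] unfolding less_Suc_eq by blast
        with f show ?case
          using s4 s2(2) by (simp add: fnd_upd)
      qed
    next
      case (4 s' m')
      have n: "s2 12 = 2 ^ q"
        using s2 parD[OF ctxD(1)[OF c]] by auto
      have imp: "fsh sh ?u = ?p \<or> (\<exists>i<2 ^ q. cgood sh X i ?p) \<longrightarrow> s' 34 = 1"
        using 4 n by simp
      have "s' 34 = 1" if x: "x < N" "fsh sh x = ?p" "blk.bgood w N k kt (fsh sh) X x" for x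
        using x(3) imp unfolding blk.bgood_def[OF fsh_blk] cgood_def x(2) using x(1,2) by blast
      then show ?case
        using 4 by auto
    qed (use s2 lmL parD[OF ctxD(1)[OF c]] in \<open>auto simp: fnd_def\<close>)
  qed
  then show ?case
    by (simp add: s1 ld)
qed

end

section \<open>Inversion and predecessor search\<close>

lemma drop_bit_less: "drop_bit s v < drop_bit s y \<Longrightarrow> v < (y::nat)"
  by (metis drop_bit_eq_div div_le_mono not_less)

text \<open>The witness is the highest bit in which \<open>v\<close> and \<open>y\<close> differ.\<close>

lemma exists_sibling: "v < (y::nat) \<Longrightarrow> \<exists>s. bit y s \<and> Suc (drop_bit s v) = drop_bit s y"
proof (induction y arbitrary: v rule: less_induct)
  case (less y)
  show ?case
  proof (cases "v div 2 < y div 2")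
    case True
    then have "y div 2 < y" by simp
    from less.IH[OF this True] obtain s where "bit (y div 2) s" "Suc (drop_bit s (v div 2)) = drop_bit s (y div 2)"
      by blast
    then show ?thesis
      by (intro exI[of _ "Suc s"]) (simp add: bit_Suc drop_bit_Suc)
  next
    case False
    then have "odd y" "Suc v = y"
      using less.prems by presburger+
    then show ?thesis
      by (intro exI[of _ 0]) (simp add: bit_0)
  qed
qed

section \<open>Programs for inversion over all repetitions and for the descent\<close>

definition "SETB = Asg 31 (Bin Add (C 8) (Bin Mul (V 36) (V 18))) ;;
  Asg 32 (Bin Add (V 22) (Bin Mul (Bin Add (Bin Mul (V 30) (V 7)) (V 36)) (V 19)))"
definition "INV = Asg 34 (C 0) ;; For 36 7 0 (SETB ;; QB)"
text \<open>At a set bit, subtracting 1 from the prefix of \<open>y\<close> clears its last bit and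
  gives the sibling below \<open>y\<close>. Register 37 tells whether a prefix has been found, 38
  and 39 hold it and its level.\<close>

definition "MQ1 = For 2 4 0 (If (V 37) (C 1) (If (C 0) (Bin And (Bin ShiftR (V 0) (V 2)) (C 1))
    (Asg 30 (V 2) ;; Asg 33 (Bin Sub (Bin ShiftR (V 0) (V 2)) (C 1)) ;; INV ;; Asg 37 (V 34) ;; Asg 38 (V 33) ;; Asg 39 (V 2)) Skip) Skip)"
text \<open>The loop runs \<open>w\<close> rounds whatever the starting level; once level 0 is
  reached, a round does nothing.\<close>

definition "MQ2 = For 2 4 0 (If (C 0) (V 39)
    (Asg 39 (Bin Sub (V 39) (C 1)) ;; Asg 30 (V 39) ;; Asg 33 (Bin Add (Bin Mul (V 38) (C 2)) (C 1)) ;; INV ;;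
     Asg 38 (Bin Add (Bin Mul (V 38) (C 2)) (V 34))) Skip)"
definition "MQ = Asg 30 (C 0) ;; Asg 33 (V 0) ;; INV ;; Asg 37 (V 34) ;; Asg 38 (V 0) ;; Asg 39 (C 0) ;; MQ1 ;;
  If (C 0) (V 37) (MQ2 ;; Asg 30 (C 0) ;; Asg 33 (V 38) ;; INV ;; Asg 0 (C 1) ;; Asg 1 (V 35)) (Asg 0 (C 0))"

locale env2 = env +
  assumes tot: "tot < 2 ^ b" and wb: "w \<le> b"
begin

text \<open>Random words are indexed by the repetition alone, computed parts by level and
  repetition.\<close>

definition "rbase rep = 8 + rep * BL"
definition "dbase sh rep = d0 + (sh * reps + rep) * DB"

lemma rbase_le: "rep < reps \<Longrightarrow> rbase rep + BL \<le> d0"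
  using mult_le_mono1[of "Suc rep" reps BL] by (simp add: rbase_def d0_def)

lemma dbase_le: "sh \<le> w \<Longrightarrow> rep < reps \<Longrightarrow> dbase sh rep + DB \<le> tot"
proof -
  assume "sh \<le> w" "rep < reps"
  then have "sh * reps + reps \<le> (w + 1) * reps"
    using mult_le_mono1[of "Suc sh" "w + 1" reps] by simp
  then have "Suc (sh * reps + rep) \<le> (w + 1) * reps"
    using \<open>rep < reps\<close> by linarith
  from mult_le_mono1[OF this, of DB] show ?thesis
    by (simp add: dbase_def tot_def)
qed

lemma d0_le: "d0 \<le> tot"
  by (simp add: tot_def)

lemma DB_pos: "1 \<le> DB"
  using bounds by (simp add: DB_def)

lemma exc_SETB:
  assumes P: "par s" and sh: "s 30 \<le> w" and rep: "s 36 < reps"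
    and Q: "\<And>s'. ctx (s 30) (rbase (s 36)) (dbase (s 30) (s 36)) s' \<Longrightarrow> (\<And>r. r \<notin> {31, 32} \<Longrightarrow> s' r = s r) \<Longrightarrow> Q s' mm"
  shows "exc SETB s mm Q"
proof -
  have r: "rbase (s 36) < 2 ^ b"
    using rbase_le[OF rep] d0_le tot by linarith
  have "0 < BL"
    using bounds by (simp add: BL_eq)
  then have d: "dbase (s 30) (s 36) < 2 ^ b"
    using dbase_le[OF sh rep] tot by linarith
  have m1: "8 mod 2 ^ b = (8::nat)" "(s 36 * BL) mod 2 ^ b = s 36 * BL" "(8 + s 36 * BL) mod 2 ^ b = rbase (s 36)"
    using r by (simp_all add: rbase_def)
  have "s 30 * reps + s 36 \<le> (s 30 * reps + s 36) * DB"
    using DB_pos by simp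
  then have m2: "(s 30 * reps) mod 2 ^ b = s 30 * reps" "(s 30 * reps + s 36) mod 2 ^ b = s 30 * reps + s 36"
    "((s 30 * reps + s 36) * DB) mod 2 ^ b = (s 30 * reps + s 36) * DB"
    "(d0 + (s 30 * reps + s 36) * DB) mod 2 ^ b = dbase (s 30) (s 36)"
    using d unfolding dbase_def by (intro mod_less; linarith)+
  have "exc SETB s mm Q = Q (s(31 := rbase (s 36), 32 := dbase (s 30) (s 36))) mm"
    unfolding SETB_def exc_simps by (simp add: parD[OF P] m1 m2)
  moreover have "Q (s(31 := rbase (s 36), 32 := dbase (s 30) (s 36))) mm"
    using par_cong[OF P] by (intro Q) (simp_all add: ctx_def)
  ultimately show ?thesis by simp
qed

definition built :: "nat list \<Rightarrow> (nat \<Rightarrow> nat) \<Rightarrow> bool" where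
  "built xs mm \<longleftrightarrow> (\<forall>sh\<le>w. \<forall>rep<reps. qmem sh (rbase rep) (dbase sh rep) (bX xs rep) mm)"

text \<open>The answer is exact in both directions: whatever is found has been verified, and
  \<open>allgood\<close> provides for each preimage a repetition that is good for it.\<close>

lemma exc_INV:
  assumes P: "par s" and sh: "s 30 \<le> w" and built: "built xs mm" and good: "allgood reps xs"
  shows "exc INV s mm (\<lambda>s' m'. m' = mm \<and> s' 34 = of_bool (\<exists>x<N. fsh (s 30) x = s 33) \<and>
    (s' 34 = 1 \<longrightarrow> s' 35 < N \<and> fsh (s 30) (s' 35) = s 33) \<and> (\<forall>r<40. r \<notin> {31, 32, 34, 35, 36} \<longrightarrow> s' r = s r))"
  unfolding INV_def exc_simps
proof (rule exc_For[where J = "\<lambda>j s' m'. m' = mm \<and> fnd (s 30) (s(34 := 0)) s' \<and>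
    ((\<exists>x<N. fsh (s 30) x = s 33 \<and> (\<exists>rep<j. blk.bgood w N k kt (fsh (s 30)) (bX xs rep) x)) \<longrightarrow> s' 34 = 1) \<and>
    (\<forall>r<40. r \<notin> {31, 32, 34, 35, 36} \<longrightarrow> s' r = s r)"], goal_cases)
  case (3 j s' m')
  have s': "m' = mm" "s' 36 = j" "s' 30 = s 30" "s' 33 = s 33" "fnd (s 30) (s(34 := 0)) s'"
    "(\<exists>x<N. fsh (s 30) x = s 33 \<and> (\<exists>rep<j. blk.bgood w N k kt (fsh (s 30)) (bX xs rep) x)) \<longrightarrow> s' 34 = 1"
    "\<And>r. r < 40 \<Longrightarrow> r \<notin> {31, 32, 34, 35, 36} \<Longrightarrow> s' r = s r"
    using 3 by auto
  have j: "j < reps"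
    using 3(1) parD[OF P] by simp
  have P': "par s'"
    using s' by (intro par_cong[OF P]) auto
  show ?case
    unfolding exc_simps s'(1)
  proof (rule exc_SETB[OF P'], goal_cases)
    case (3 s1)
    have q: "qmem (s 30) (rbase j) (dbase (s 30) j) (bX xs j) mm"
      using built sh j by (simp add: built_def)
    have s1: "s1 33 = s 33" "s1 36 = j" "\<And>r. r \<notin> {31, 32} \<Longrightarrow> s1 r = s' r" "ctx (s 30) (rbase j) (dbase (s 30) j) s1"
      using 3 s' by auto
    show ?case
    proof (rule exc_mono[OF exc_QB[OF s1(4) q]], goal_cases)
      case (1 s2 m2)
      then have s2: "m2 = mm" "fnd (s 30) s1 s2" "\<And>r. r < 40 \<Longrightarrow> r \<notin> {34, 35} \<Longrightarrow> s2 r = s1 r"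
        "(\<exists>x<N. fsh (s 30) x = s 33 \<and> blk.bgood w N k kt (fsh (s 30)) (bX xs j) x) \<longrightarrow> s2 34 = 1"
        using s1 by auto
      have "fnd (s 30) (s(34 := 0)) s1"
        using s'(5) s1(3) by (simp add: fnd_def)
      then have f: "fnd (s 30) (s(34 := 0)) s2"
        using fnd_trans[OF _ s2(2), of "s(34 := 0)"] s1(1) by simp
      have "s2 34 = 1" if "s' 34 = 1"
        using fnd_found[OF s2(2)] s1(3) that by simp
      then have "(\<exists>x<N. fsh (s 30) x = s 33 \<and> (\<exists>rep<Suc j. blk.bgood w N k kt (fsh (s 30)) (bX xs rep) x)) \<longrightarrow> s2 34 = 1"
        using s2(4) s'(6) unfolding less_Suc_eq by blast
      with f show ?case
        using s2 s1 s' by (simp add: fnd_upd)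
    qed
  qed (use s' sh j in auto)
next
  case (4 s' m')
  have "\<exists>rep<reps. blk.bgood w N k kt (fsh (s 30)) (bX xs rep) x" if "x < N" for x
    using good sh that by (simp add: allgood_def)
  then have "(\<exists>x<N. fsh (s 30) x = s 33) \<longrightarrow> s' 34 = 1"
    using 4 parD[OF P] by auto
  then show ?case
    using 4 by (auto simp: fnd_def)
qed (use parD[OF P] lm0 in \<open>auto simp: fnd_def\<close>)

text \<open>Invariant of the descent: \<open>p\<close> is the prefix of the predecessor of \<open>y\<close>.\<close>

definition cand :: "nat \<Rightarrow> nat \<Rightarrow> nat \<Rightarrow> bool" where
  "cand y lv p \<longleftrightarrow> lv \<le> w \<and> (\<exists>x<N. fsh lv x = p) \<and> (\<forall>v. drop_bit lv v = p \<longrightarrow> v \<le> y) \<and>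
    (\<forall>x<N. f x \<le> y \<longrightarrow> fsh lv x \<le> p)"

definition miss :: "nat \<Rightarrow> nat \<Rightarrow> bool" where
  "miss y j \<longleftrightarrow> (\<forall>x<N. f x \<noteq> y) \<and> (\<forall>s<j. bit y s \<longrightarrow> (\<forall>x<N. Suc (fsh s x) \<noteq> drop_bit s y))"

lemma miss_Suc: "miss y (Suc j) \<longleftrightarrow> miss y j \<and> (bit y j \<longrightarrow> (\<forall>x<N. Suc (fsh j x) \<noteq> drop_bit j y))"
  by (auto simp: miss_def less_Suc_eq)

text \<open>A value below \<open>y\<close> leaves the path of \<open>y\<close> at the sibling of
  some set bit \<open>s\<close>. By \<open>miss\<close>, \<open>s\<close> is not below
  \<open>j\<close>, so already at level \<open>j\<close> the prefix of the value is smaller than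
  that of \<open>y\<close>.\<close>

lemma cand_miss:
  assumes "miss y j" "bit y j" "x < N" "Suc (fsh j x) = drop_bit j y" "j < w"
  shows "cand y j (drop_bit j y - 1)"
  unfolding cand_def
proof (intro conjI allI impI)
  show "\<exists>x<N. fsh j x = drop_bit j y - 1"
    using assms(3,4) by (intro exI[of _ x]) auto
  show "v \<le> y" if "drop_bit j v = drop_bit j y - 1" for v
    using drop_bit_less[of j v y] that assms(4) by simp
  show "fsh j u \<le> drop_bit j y - 1" if u: "u < N" "f u \<le> y" for u
  proof -
    have "f u < y"
      using assms(1) u by (metis le_neq_implies_less miss_def)
    then obtain s where s: "bit y s" "Suc (drop_bit s (f u)) = drop_bit s y"
      using exists_sibling by blast
    then have "j \<le> s"
      using assms(1) u by (auto simp: miss_def fsh_def not_less[symmetric])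
    then have "drop_bit (s - j) (drop_bit j (f u)) < drop_bit (s - j) (drop_bit j y)"
      using s by simp
    from drop_bit_less[OF this] show ?thesis
      by (simp add: fsh_def)
  qed
qed (use assms in simp)

text \<open>All values with prefix \<open>p\<close> are at most \<open>y\<close>, so the larger half
  is the right one whenever it is occupied.\<close>

lemma cand_step:
  assumes "cand y (Suc lv) p"
  shows "cand y lv (p * 2 + of_bool (\<exists>x<N. fsh lv x = p * 2 + 1))"
proof -
  have half: "fsh (Suc lv) x = fsh lv x div 2" "drop_bit (Suc lv) v = drop_bit lv v div 2" for x and v :: nat
    by (simp_all only: fsh_def drop_bit_eq_div power_Suc2 div_mult2_eq)
  let ?p = "p * 2 + of_bool (\<exists>x<N. fsh lv x = p * 2 + 1) :: nat"
  have pd: "?p div 2 = p"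
    by simp
  obtain x where x: "x < N" "fsh lv x div 2 = p"
    using assms by (auto simp: cand_def half)
  show ?thesis
    unfolding cand_def
  proof (intro conjI allI impI)
    show "\<exists>x<N. fsh lv x = ?p"
    proof (cases "\<exists>x<N. fsh lv x = p * 2 + 1")
      case False
      then have "fsh lv x \<noteq> p * 2 + 1"
        using x by blast
      then have "fsh lv x = p * 2"
        using x(2) by presburger
      then show ?thesis
        using x(1) False by auto
    qed simp
    show "v \<le> y" if "drop_bit lv v = ?p" for v
      using assms half(2)[of v] pd that by (simp add: cand_def)
    show "fsh lv u \<le> ?p" if u: "u < N" "f u \<le> y" for u
    proof -
      have "fsh lv u div 2 \<le> p"
        using assms u by (simp add: cand_def half)
      then show ?thesis
        using u by (cases "fsh lv u = p * 2 + 1") auto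
    qed
  qed (use assms in \<open>simp add: cand_def\<close>)
qed

text \<open>Keeps the doubled prefix of the descent within a word.\<close>

lemma cand_less: "cand y lv p \<Longrightarrow> p * 2 ^ lv < 2 ^ w"
proof -
  assume "cand y lv p"
  then obtain x where "x < N" "f x div 2 ^ lv = p"
    by (auto simp: cand_def fsh_def drop_bit_eq_div)
  then show ?thesis
    using f[of x] div_times_less_eq_dividend[of "f x" "2 ^ lv"] by auto
qed

lemma exc_MQ1:
  assumes P: "par s" and built: "built xs mm" and good: "allgood reps xs"
    and y: "s 0 = y" "y < 2 ^ w"
    and st: "s 37 = 1 \<and> cand y (s 39) (s 38) \<or> s 37 = 0 \<and> miss y 0"
  shows "exc MQ1 s mm (\<lambda>s' m'. m' = mm \<and> par s' \<and> (s' 37 = 1 \<and> cand y (s' 39) (s' 38) \<or> s' 37 = 0 \<and> miss y w))"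
  unfolding MQ1_def
proof (rule exc_For[where J = "\<lambda>j s' m'. m' = mm \<and> par s' \<and> s' 0 = y \<and> (s' 37 = 1 \<and> cand y (s' 39) (s' 38) \<or> s' 37 = 0 \<and> miss y j)"], goal_cases)
  case (3 j s' m')
  then have s': "m' = mm" "par s'" "s' 0 = y" "s' 37 = 1 \<and> cand y (s' 39) (s' 38) \<or> s' 37 = 0 \<and> miss y j" "s' 2 = j" "s' 4 = w"
    "j < w" "s 4 = w"
    using parD[OF P] by auto
  have par_upd: "par (s''(2 := v)) = par s''" for s'' v
    by (simp add: par_def)
  have bit: "drop_bit j y mod 2 = of_bool (bit y j)"
    by (simp add: bit_iff_odd_drop_bit mod_2_eq_odd)
  show ?case
  proof (cases "s' 37 = 0 \<and> bit y j")
    case False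
    then show ?thesis
      unfolding exc_simps using s' bit by (auto simp: miss_Suc par_upd)
  next
    case True
    then have "0 < drop_bit j y"
      by (metis bit_iff_odd_drop_bit even_zero gr0I)
    moreover have "drop_bit j y < 2 ^ b"
      using y(2) wb by (metis drop_bit_eq_div div_le_dividend le_less_trans less_le_trans one_less_numeral_iff power_increasing_iff semiring_norm(76))
    ultimately have sub: "(drop_bit j y + 2 ^ b - Suc 0) mod 2 ^ b = drop_bit j y - 1" "0 < drop_bit j y"
      by (auto simp: add.commute[of "drop_bit j y"] mod_if)
    let ?s1 = "s'(30 := j, 33 := drop_bit j y - 1)"
    have P1: "par ?s1"
      using s'(2) by (rule par_cong) simp
    have inv: "exc INV ?s1 mm (\<lambda>sa ma. exc (Asg 37 (V 34) ;; Asg 38 (V 33) ;; Asg 39 (V 2)) sa ma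
       (\<lambda>s'' m''. s'' 2 = j \<and> s'' 4 = s 4 \<and> m'' = mm \<and> par (s''(2 := Suc j)) \<and> (s''(2 := Suc j)) 0 = y \<and>
         ((s''(2 := Suc j)) 37 = 1 \<and> cand y ((s''(2 := Suc j)) 39) ((s''(2 := Suc j)) 38) \<or> (s''(2 := Suc j)) 37 = 0 \<and> miss y (Suc j))))"
    proof (rule exc_mono[OF exc_INV[OF P1 _ built good]], goal_cases)
      case (2 sa ma)
      have sa: "ma = mm" "sa 34 = of_bool (\<exists>x<N. fsh j x = drop_bit j y - 1)" "sa 33 = drop_bit j y - 1" "sa 2 = j" "sa 0 = y"
        using 2 s' by auto
      have Pa: "par sa"
        using 2 by (intro par_cong[OF P1]) auto
      have Pa': "par (sa(37 := u, 38 := v, 39 := z))" for u v z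
        using Pa by (rule par_cong) simp
      have st: "sa 34 = 1 \<and> cand y j (drop_bit j y - 1) \<or> sa 34 = 0 \<and> miss y (Suc j)"
      proof (cases "\<exists>x<N. fsh j x = drop_bit j y - 1")
        case T: True
        then obtain x where "x < N" "Suc (fsh j x) = drop_bit j y"
          using sub(2) by auto
        then show ?thesis
          using cand_miss[of y j x] True s' T sa(2) by auto
      next
        case F: False
        then show ?thesis
          using sa(2) s' True sub(2) by (auto simp: miss_Suc)
      qed
      show ?case
        unfolding exc_simps using st sa Pa' Pa parD[OF Pa] s'(8) by (simp add: par_upd)
    qed (use s' in simp)
    then show ?thesis
      using True s' bit sub(1) by simp
  qed
next
  case 1
  show ?case
    using parD(2)[OF P] lm0 by simp
next
  case 2
  have "par (s(2 := 0))"
    using P by (simp add: par_def)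
  then show ?case
    using y st by simp
next
  case 4
  then show ?case
    using parD(2)[OF P] by simp
qed

lemma exc_MQ2:
  assumes P: "par s" and built: "built xs mm" and good: "allgood reps xs"
    and st: "cand y (s 39) (s 38)"
  shows "exc MQ2 s mm (\<lambda>s' m'. m' = mm \<and> par s' \<and> cand y 0 (s' 38))"
  unfolding MQ2_def
\<comment> \<open>The level drops in every round until it is 0; the last conjunct forces it to be 0
  after \<open>w\<close> rounds.\<close>
proof (rule exc_For[where J = "\<lambda>j s' m'. m' = mm \<and> par s' \<and> cand y (s' 39) (s' 38) \<and> s' 39 + j \<le> w + (if s' 39 = 0 then j else 0)"], goal_cases)
  case (3 j s' m')
  then have s': "m' = mm" "par s'" "cand y (s' 39) (s' 38)" "s' 39 + j \<le> w + (if s' 39 = 0 then j else 0)" "s' 2 = j" "s' 4 = w" "s 4 = w"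
    using parD[OF P] by auto
  have par_upd: "par (s''(2 := v)) = par s''" for s'' v
    by (simp add: par_def)
  show ?case
  proof (cases "s' 39")
    case 0
    then show ?thesis
      unfolding exc_simps using s' by (simp add: par_upd)
  next
    case (Suc lv)
    let ?p = "s' 38"
    have lv: "Suc lv \<le> w"
      using s'(3) Suc by (simp add: cand_def)
    have "?p * 2 \<le> ?p * 2 ^ Suc lv"
      by simp
    then have p: "?p * 2 < 2 ^ w"
      using cand_less[OF s'(3)] unfolding Suc by linarith
    have ev2: "even ((2::nat) ^ w)"
      using lv by (cases w) auto
    then have p': "?p * 2 + 1 < 2 ^ w"
      using p by (metis Suc_eq_plus1 Suc_lessI even_Suc even_mult_iff even_numeral)
    have wb': "(2::nat) ^ w \<le> 2 ^ b"
      using wb by simp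
    have m: "(?p * 2) mod 2 ^ b = ?p * 2" "(?p * 2 + 1) mod 2 ^ b = ?p * 2 + 1"
      using p p' wb' by - (rule mod_less, linarith)+
    have "1 < (2::nat) ^ w"
      using lv by (intro one_less_power) auto
    then have b2: "2 \<le> w \<or> w = 1" "1 \<le> w"
      using lv by auto
    have lb: "Suc lv < 2 ^ b"
      using less_exp[of w] lv wb' by linarith
    then have sub: "(Suc lv + 2 ^ b - Suc 0) mod 2 ^ b = lv"
      by simp
    have two: "?p * (2 mod 2 ^ b) mod 2 ^ b = ?p * 2"
      using m(1) by (simp add: mod_mult_right_eq)
    let ?s1 = "s'(39 := lv, 30 := lv, 33 := ?p * 2 + 1)"
    have P1: "par ?s1"
      using s'(2) by (rule par_cong) simp
    have "exc INV ?s1 mm (\<lambda>sa ma. exc (Asg 38 (Bin Add (Bin Mul (V 38) (C 2)) (V 34))) sa ma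
       (\<lambda>s'' m''. s'' 2 = j \<and> s'' 4 = s 4 \<and> m'' = mm \<and> par (s''(2 := Suc j)) \<and> cand y ((s''(2 := Suc j)) 39) ((s''(2 := Suc j)) 38) \<and>
          (s''(2 := Suc j)) 39 + Suc j \<le> w + (if (s''(2 := Suc j)) 39 = 0 then Suc j else 0)))"
    proof (rule exc_mono[OF exc_INV[OF P1 _ built good]], goal_cases)
      case (2 sa ma)
      have sa: "ma = mm" "sa 34 = of_bool (\<exists>x<N. fsh lv x = ?p * 2 + 1)" "sa 38 = ?p" "sa 39 = lv" "sa 2 = j"
        using 2 s' by auto
      have Pa: "par sa"
        using 2 by (intro par_cong[OF P1]) auto
      have c: "cand y lv (?p * 2 + sa 34)"
        unfolding sa(2) using s'(3) Suc by (intro cand_step) simp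
      have "sa 34 \<le> 1"
        by (simp add: sa(2))
      then have "(?p * 2 + sa 34) mod 2 ^ b = ?p * 2 + sa 34"
        using p' wb' by (intro mod_less) linarith
      moreover have "par (sa(38 := v))" for v
        using Pa by (rule par_cong) simp
      ultimately show ?case
        unfolding exc_simps using c sa(1,3-5) two s'(4,7) Suc parD[OF Pa] by (simp add: par_upd)
    qed (use lv in simp)
    then show ?thesis
      using Suc s' sub m two by simp
  qed
next
  case (4 s' m')
  then have "s' 39 = 0"
    using parD[OF P] by (simp split: if_splits)
  then show ?case
    using 4 by simp
next
  case 1
  show ?case
    using parD(2)[OF P] lm0 by simp
next
  case 2
  have "par (s(2 := 0))"
    using P by (simp add: par_def)
  then show ?case
    using st by (simp add: cand_def)
qed

lemma exc_MQ:
  assumes P: "par s" and built: "built xs mm" and good: "allgood reps xs"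
    and y: "s 0 = y" "y < 2 ^ w"
  shows "exc MQ s mm (\<lambda>s' m'. let V = {v \<in> f ` {..<N}. v \<le> y} in
    if V = {} then s' 0 = 0 else s' 0 = 1 \<and> s' 1 < N \<and> f (s' 1) = Max V)" (is "exc MQ s mm ?Q")
  unfolding MQ_def exc_simps(5)
proof -
  let ?R = "If (C 0) (V 37) (MQ2 ;; Asg 30 (C 0) ;; Asg 33 (V 38) ;; INV ;; Asg 0 (C 1) ;; Asg 1 (V 35)) (Asg 0 (C 0))"
  have P1: "par (s(30 := 0, 33 := y))"
    using P by (rule par_cong) simp
  have R: "exc ?R sa mm ?Q" if Pa: "par sa" and st: "sa 37 = 1 \<and> cand y (sa 39) (sa 38) \<or> sa 37 = 0 \<and> miss y w" for sa
  proof (cases "sa 37 = 0")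
    case True
    have "f x \<le> y \<Longrightarrow> x < N \<Longrightarrow> False" for x
    proof -
      assume x: "f x \<le> y" "x < N"
      then have "f x < y"
        using st True by (metis le_neq_implies_less miss_def zero_neq_one)
      then obtain s where s: "bit y s" "Suc (drop_bit s (f x)) = drop_bit s y"
        using exists_sibling by blast
      moreover have "s < w"
        using s(1) y(2) by (metis bit_take_bit_iff take_bit_nat_eq_self)
      ultimately show False
        using st True x by (auto simp: miss_def fsh_def)
    qed
    then show ?thesis
      using True by (auto simp: Let_def)
  next
    case False
    then have c: "cand y (sa 39) (sa 38)" "sa 37 = 1"
      using st by auto
    have "exc MQ2 sa mm (\<lambda>sb mb. exc (Asg 30 (C 0) ;; Asg 33 (V 38) ;; INV ;; Asg 0 (C 1) ;; Asg 1 (V 35)) sb mb ?Q)"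
    proof (rule exc_mono[OF exc_MQ2[OF Pa built good c(1)]], goal_cases)
      case (1 sb mb)
      then have sb: "mb = mm" "par sb" "cand y 0 (sb 38)"
        by auto
      then obtain x where x: "x < N" "fsh 0 x = sb 38"
        by (auto simp: cand_def)
      have P2: "par (sb(30 := 0, 33 := sb 38))"
        using sb(2) by (rule par_cong) simp
      have "sb 38 = Max {v \<in> f ` {..<N}. v \<le> y}" "{v \<in> f ` {..<N}. v \<le> y} \<noteq> {}"
      proof -
        have "sb 38 = f x"
          using x by (simp add: fsh_def)
        then have "sb 38 \<in> f ` {..<N}"
          using x by simp
        then have "sb 38 \<in> {v \<in> f ` {..<N}. v \<le> y}"
          using sb(3) x by (auto simp: cand_def fsh_def)
        moreover have "v \<le> sb 38" if "v \<in> {v \<in> f ` {..<N}. v \<le> y}" for v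
          using sb(3) that by (auto simp: cand_def fsh_def)
        ultimately show "sb 38 = Max {v \<in> f ` {..<N}. v \<le> y}" "{v \<in> f ` {..<N}. v \<le> y} \<noteq> {}"
          by (auto intro!: Max_eqI[symmetric])
      qed
      note mx = this
      have "exc INV (sb(30 := 0, 33 := sb 38)) mm (\<lambda>sc mc. exc (Asg 0 (C 1) ;; Asg 1 (V 35)) sc mc ?Q)"
      proof (rule exc_mono[OF exc_INV[OF P2 _ built good]], goal_cases)
        case (2 sc mc)
        moreover have "\<exists>x<N. fsh 0 x = sb 38"
          using x by blast
        ultimately have "sc 35 < N" "fsh 0 (sc 35) = sb 38"
          by simp_all
        then show ?case
          unfolding exc_simps using mx by (simp add: fsh_def Let_def)
      qed simp
      then show ?case
        by (simp add: sb(1))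
    qed
    then show ?thesis
      using c by simp
  qed
  have "exc INV (s(30 := 0, 33 := y)) mm (\<lambda>sa ma. exc (Asg 37 (V 34) ;; Asg 38 (V 0) ;; Asg 39 (C 0) ;; MQ1 ;; ?R) sa ma ?Q)"
  proof (rule exc_mono[OF exc_INV[OF P1 _ built good]], goal_cases)
    case (2 sa ma)
    let ?s2 = "sa(37 := sa 34, 38 := y, 39 := 0)"
    have sa: "ma = mm" "sa 34 = of_bool (\<exists>x<N. f x = y)" "sa 0 = y"
      using 2 y by (auto simp: fsh_def)
    have P2: "par ?s2"
      using 2 by (intro par_cong[OF P1]) auto
    have "?s2 37 = 1 \<and> cand y (?s2 39) (?s2 38) \<or> ?s2 37 = 0 \<and> miss y 0"
      using sa(2) by (auto simp: cand_def miss_def fsh_def)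
    from exc_MQ1[OF P2 built good _ y(2) this]
    have "exc MQ1 ?s2 mm (\<lambda>sb mb. exc ?R sb mb ?Q)"
    proof (rule exc_mono, goal_cases)
      case (2 sb mb)
      then show ?case
        using R[of sb] by (simp del: exc.simps(6))
    qed (use sa in simp)
    then show ?case
      by (simp add: sa del: exc.simps(6))
  qed simp
  then show "exc (Asg 30 (C 0)) s mm (\<lambda>s m. exc (Asg 33 (V 0)) s m (\<lambda>s m. exc INV s m (\<lambda>s m. exc (Asg 37 (V 34)) s m
      (\<lambda>s m. exc (Asg 38 (V 0)) s m (\<lambda>s m. exc (Asg 39 (C 0)) s m (\<lambda>s m. exc MQ1 s m (\<lambda>s m. exc ?R s m ?Q)))))))"
    by (simp add: y(1) del: exc.simps(6))
qed

end

section \<open>Construction of the blocks\<close>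

definition "BS = For 41 8 1 (Asg 50 (Bin And (Ld (Bin Add (V 31) (Bin Add (V 24) (V 41)))) (V 6)) ;;
  If (V 50) (V 3) (Cal 52 (V 50) ;; Asg 60 (Bin ShiftR (V 52) (V 30)) ;; HV ;; Sto (Bin Add (V 32) (V 61)) (V 50)) Skip)"
text \<open>One loop over all chains of a block: as \<open>m\<close> is a power of two, a shift and
  a mask split the index into cluster and chain.\<close>

definition "BC = For 41 21 4 (Asg 40 (Bin ShiftR (V 41) (V 27)) ;; Asg 42 (Bin And (V 41) (V 28)) ;; Asg 60 (Bin Add (V 8) (V 42)) ;; GZ ;;
  Asg 50 (V 61) ;; For 43 11 3 STEP ;; Asg 44 (Bin Add (Bin Add (V 32) (V 8)) (Bin Add (Bin Mul (V 40) (V 14)) (Bin And (V 50) (V 15)))) ;;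
  Sto (V 44) (V 50) ;; Sto (Bin Add (V 44) (V 17)) (Bin Add (V 42) (C 1)))"
definition "BB = BS ;; BC"
definition "BUILD = For 30 20 0 (For 36 7 0 (SETB ;; BB))"

context env2
begin

text \<open>Memory with an array \<open>g\<close> laid over \<open>n\<close> cells from
  \<open>a0\<close>. Both tables start as the zero function, in agreement with fresh memory.\<close>

definition over :: "nat \<Rightarrow> nat \<Rightarrow> (nat \<Rightarrow> nat) \<Rightarrow> (nat \<Rightarrow> nat) \<Rightarrow> nat \<Rightarrow> nat" where
  "over a0 n g mm = (\<lambda>a. if a0 \<le> a \<and> a < a0 + n then g (a - a0) else mm a)"

lemma over_upd: "i < n \<Longrightarrow> (over a0 n g mm)(a0 + i := v) = over a0 n (g(i := v)) mm"
  by (auto simp: over_def fun_eq_iff)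

lemma over_in: "i < n \<Longrightarrow> over a0 n g mm (a0 + i) = g i"
  and over_out: "a < a0 \<Longrightarrow> over a0 n g mm a = mm a" "a0 + n \<le> a \<Longrightarrow> over a0 n g mm a = mm a"
  by (auto simp: over_def)

lemma over_id: "(\<And>i. i < n \<Longrightarrow> mm (a0 + i) = g i) \<Longrightarrow> over a0 n g mm = mm"
  by (auto simp: over_def fun_eq_iff) (metis add.commute le_Suc_ex add_less_cancel_left diff_add_inverse)

lemma rok_over: "rok rb X mm \<Longrightarrow> rb + BL \<le> a0 \<Longrightarrow> rok rb X (over a0 n g mm)"
  by (simp add: rok_def over_def)

lemma exc_BS:
  assumes c: "ctx sh rb db s" and rok: "rok rb X mm" and le: "rb + BL \<le> db" "db + DB < 2 ^ b"
    and zero: "\<And>a. db \<le> a \<Longrightarrow> mm a = 0"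
  shows "exc BS s mm (\<lambda>s' m'. m' = over db M (HTs sh X) mm \<and> (\<forall>r<41. s' r = s r))"
  unfolding BS_def
proof (rule exc_For[where J = "\<lambda>j s' m'. m' = over db M (tab N (fsh sh) (h X) (smp X) j) mm \<and> (\<forall>r<41. s' r = s r)"], goal_cases)
  case (1)
  show ?case using lmL parD[OF ctxD(1)[OF c]] by simp
next
  case 2
  show ?case using zero by (simp add: over_id)
next
  case (4 s' m')
  then show ?case using parD[OF ctxD(1)[OF c]] by (simp add: HTs_eq)
next
  case (3 j s' m')
  let ?t = "tab N (fsh sh) (h X) (smp X)"
  let ?u = "smp X j"
  have j: "j < M" using 3(1) parD[OF ctxD(1)[OF c]] by simp
  have s': "m' = over db M (?t j) mm" "s' 41 = j" "s' 8 = s 8" "\<And>r. r < 41 \<Longrightarrow> s' r = s r"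
    using 3 by auto
  have c': "ctx sh rb db s'"
    using s' by (intro ctx_cong[OF c]) simp
  note p = parD[OF ctxD(1)[OF c']] ctxD[OF c']
  have rok': "rok rb X m'"
    unfolding s'(1) using rok le by (intro rok_over) simp
  have jb: "w + k + 2 + j < BL"
    using j BL_eq bounds by linarith
  then have ad: "(rb + (w + k + 2 + j) mod 2 ^ b) mod 2 ^ b = rb + (w + k + 2 + j)" "(w + k + 2 + j) mod 2 ^ b = w + k + 2 + j"
    "(rb + (w + k + 2 + j)) mod 2 ^ b = rb + (w + k + 2 + j)"
    using le by simp_all
  have ld: "m' (rb + (w + k + 2 + j)) AND mask k = ?u"
    using rokD(1)[OF rok' jb] by (simp add: smp_def take_bit_eq_mask)
  let ?s1 = "s'(50 := ?u)"
  have "exc (If (V 50) (V 3) (Cal 52 (V 50) ;; Asg 60 (Bin ShiftR (V 52) (V 30)) ;; HV ;; Sto (Bin Add (V 32) (V 61)) (V 50)) Skip) ?s1 m'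
     (\<lambda>s'' m''. s'' 41 = j \<and> s'' 8 = s 8 \<and> m'' = over db M (?t (Suc j)) mm \<and> (\<forall>r<41. (s''(41 := Suc j)) r = s r))"
  proof (cases "?u < N")
    case False
    then show ?thesis
      unfolding exc_simps using s' p by simp
  next
    case True
    let ?s2 = "?s1(52 := f ?u, 60 := fsh sh ?u)"
    have c2: "ctx sh rb db ?s2"
      by (intro ctx_cong[OF c']) simp
    have le': "rb + BL < 2 ^ b"
      using le by simp
    have "exc HV ?s2 m' (\<lambda>s3 m3. exc (Sto (Bin Add (V 32) (V 61)) (V 50)) s3 m3
       (\<lambda>s'' m''. s'' 41 = j \<and> s'' 8 = s 8 \<and> m'' = over db M (?t (Suc j)) mm \<and> (\<forall>r<41. (s''(41 := Suc j)) r = s r)))"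
    proof (rule exc_mono[OF exc_HV[OF c2 rok' le']], goal_cases)
      case (1 s3 m3)
      then have s3: "m3 = m'" "s3 61 = h X (fsh sh ?u)" "s3 50 = ?u" "s3 32 = db" "s3 41 = j" "s3 8 = s 8" "\<And>r. r < 41 \<Longrightarrow> s3 r = s r"
        using s' p by auto
      have "(db + h X (fsh sh ?u)) mod 2 ^ b = db + h X (fsh sh ?u)"
        using le h_less[of X "fsh sh ?u"] by (simp add: DB_def)
      then show ?case
        unfolding exc_simps using True by (simp add: s3 s'(1) over_upd h_less)
    qed
    then show ?thesis
      unfolding exc_simps using True p by (simp add: fsh_def)
  qed
  then show ?case
    by (simp only: exc.simps(2,5) ev.simps apply_binop.simps p s'(2) ad ld)
qed

lemma exc_walk:
  assumes c: "ctx sh rb db s" and bm: "bmem sh rb db X mm" and w: "s 50 = chg sh X (s 40) j 0"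
  shows "exc (For 43 11 3 STEP) s mm (\<lambda>s' m'. m' = mm \<and> s' 50 = chg sh X (s 40) j t \<and> (\<forall>r<43. s' r = s r))"
proof (rule exc_For[where J = "\<lambda>c s' m'. m' = mm \<and> s' 50 = chg sh X (s 40) j c \<and> (\<forall>r<43. s' r = s r)"], goal_cases)
  case (3 j' s' m')
  then have s': "m' = mm" "s' 50 = chg sh X (s 40) j j'" "s' 40 = s 40" "s' 43 = j'" "s' 11 = s 11" "\<And>r. r < 43 \<Longrightarrow> s' r = s r"
    by auto
  have c': "ctx sh rb db s'"
    using s' by (intro ctx_cong[OF c]) simp
  show ?case
    unfolding s'(1) by (rule exc_mono[OF exc_STEP[OF c' bm]]) (use s' in \<open>auto simp: chg_Suc\<close>)
qed (use w lmL parD[OF ctxD(1)[OF c]] in auto)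

lemma exc_BC:
  assumes c: "ctx sh rb db s" and bm: "bmem sh rb db X mm" and le: "rb + BL \<le> db"
    and zero: "\<And>a. db + M \<le> a \<Longrightarrow> mm a = 0"
  shows "exc BC s mm (\<lambda>s' m'. m' = over (db + M) (lE + lE) (ems sh X) mm \<and> (\<forall>r<40. s' r = s r))"
  unfolding BC_def
proof (rule exc_For[where J = "\<lambda>j s' m'. m' = over (db + M) (lE + lE) (em sh X j) mm \<and> (\<forall>r<40. s' r = s r)"], goal_cases)
  case (1)
  show ?case using lmL parD[OF ctxD(1)[OF c]] by simp
next
  case 2
  show ?case using zero by (simp add: over_id)
next
  case (4 s' m')
  then show ?case using parD[OF ctxD(1)[OF c]] by simp
next
  case (3 r s' m')
  have r: "r < 2 ^ q * m" using 3(1) parD[OF ctxD(1)[OF c]] by simp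
  have s': "m' = over (db + M) (lE + lE) (em sh X r) mm" "s' 41 = r" "\<And>r. r < 40 \<Longrightarrow> s' r = s r"
    using 3 by auto
  have c': "ctx sh rb db s'"
    using s' by (intro ctx_cong[OF c]) simp
  note p = parD[OF ctxD(1)[OF c']] ctxD[OF c']
  have s21: "s 21 = 2 ^ q * m"
    using parD[OF ctxD(1)[OF c]] by simp
  have rok: "rok rb X mm" "db + DB < 2 ^ b" "rb + BL < 2 ^ b"
    using bm by (auto simp: bmem_def)
  have bm': "bmem sh rb db X m'"
    using bm rok_over[OF rok(1), of "db + M" "lE + lE" "em sh X r"] le unfolding s'(1) bmem_def by (auto simp: over_out)
  then have rok': "rok rb X m'"
    by (simp add: bmem_def)
  let ?i = "r div m" and ?j = "r mod m"
  have i: "?i < 2 ^ q" and j: "?j < m"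
    using r bounds by (simp_all add: less_mult_imp_div_less)
  have dm: "drop_bit (k - 3 * kt) r = ?i" "r AND mask (k - 3 * kt) = ?j"
    by (simp_all add: drop_bit_eq_div m_def flip: take_bit_eq_mask take_bit_eq_mod)
  have Mj: "(M + ?j) mod 2 ^ b = M + ?j" "M + ?j < K"
    using j BL_eq rok(3) by (simp_all add: K_def)
  have E1: "ev b s' m' (Bin ShiftR (V 41) (V 27)) = ?i"
    by (simp add: s'(2) p dm)
  have E2: "ev b (s'(40 := ?i)) m' (Bin And (V 41) (V 28)) = ?j"
    by (simp add: s'(2) p dm)
  have E3: "ev b (s'(40 := ?i, 42 := ?j)) m' (Bin Add (V 8) (V 42)) = M + ?j"
    by (simp add: p Mj)
  let ?s1 = "s'(40 := ?i, 42 := ?j, 60 := M + ?j)"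
  have c1: "ctx sh rb db ?s1"
    by (intro ctx_cong[OF c']) simp
  let ?Q = "\<lambda>s'' m''. s'' 41 = r \<and> s'' 21 = s 21 \<and> m'' = over (db + M) (lE + lE) (em sh X (Suc r)) mm \<and> (\<forall>ra<40. (s''(41 := Suc r)) ra = s ra)"
  let ?C2 = "Asg 44 (Bin Add (Bin Add (V 32) (V 8)) (Bin Add (Bin Mul (V 40) (V 14)) (Bin And (V 50) (V 15)))) ;;
     Sto (V 44) (V 50) ;; Sto (Bin Add (V 44) (V 17)) (Bin Add (V 42) (C 1))"
  have "exc GZ ?s1 m' (\<lambda>s2 m2. exc (For 43 11 3 STEP) (s2(50 := s2 61)) m2 (\<lambda>s3 m3. exc ?C2 s3 m3 ?Q))"
  proof (rule exc_mono[OF exc_GZ[OF c1 rok' rok(3)]], goal_cases)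
    case 1
    show ?case using Mj by simp
  next
    case (2 s2 m2)
    then have s2: "m2 = m'" "s2 61 = chg sh X ?i ?j 0" "s2 40 = ?i" "s2 42 = ?j" "s2 41 = r" "\<And>r. r < 40 \<Longrightarrow> s2 r = s r"
      using s' by (auto simp: chg_0)
    have c2: "ctx sh rb db (s2(50 := s2 61))"
      using s2 by (intro ctx_cong[OF c]) simp
    show ?case
      unfolding s2(1)
    proof (rule exc_mono[OF exc_walk[OF c2 bm', where j = ?j]], goal_cases)
      case 1
      show ?case using s2 by simp
    next
      case (2 s3 m3)
      let ?v = "chg sh X ?i ?j t"
      let ?a = "?i * 2 ^ e + take_bit e ?v"
      have s3: "m3 = m'" "s3 50 = ?v" "s3 40 = ?i" "s3 42 = ?j" "s3 41 = r" "\<And>r. r < 40 \<Longrightarrow> s3 r = s r"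
        using 2 s2 by auto
      have c3: "ctx sh rb db s3"
        using s3 by (intro ctx_cong[OF c]) simp
      note p3 = parD[OF ctxD(1)[OF c3]] ctxD[OF c3]
      have a: "?a < lE"
        using i by (intro slot_less) simp_all
      have te: "?v AND mask e = take_bit e ?v"
        by (simp add: take_bit_eq_mask)
      have md: "(db + M) mod 2 ^ b = db + M" "(?i * 2 ^ e) mod 2 ^ b = ?i * 2 ^ e" "?a mod 2 ^ b = ?a" "(db + M + ?a) mod 2 ^ b = db + M + ?a"
        "(db + M + ?a + lE) mod 2 ^ b = db + M + (?a + lE)" "Suc ?j mod 2 ^ b = Suc ?j"
        using a rok(2,3) j BL_eq by (simp_all add: DB_def K_def)
      have e1: "em sh X (Suc r) = (em sh X r)(?a := ?v, ?a + lE := Suc ?j)"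
        by (simp add: Let_def)
      have e2: "(m'(db + M + ?a := ?v))(db + M + (?a + lE) := Suc ?j) = over (db + M) (lE + lE) (em sh X (Suc r)) mm"
        unfolding s'(1) e1 using a by (simp only: over_upd add_less_cancel_right trans_less_add1)
      have A: "ev b s3 m' (Bin Add (Bin Add (V 32) (V 8)) (Bin Add (Bin Mul (V 40) (V 14)) (Bin And (V 50) (V 15)))) = db + M + ?a"
        by (simp only: ev.simps apply_binop.simps s3 p3 te md)
      have S: "exc (Sto (V 44) (V 50) ;; Sto (Bin Add (V 44) (V 17)) (Bin Add (V 42) (C 1))) (s3(44 := aa)) m' Q =
          Q (s3(44 := aa)) ((m'(aa := va))(ab := Suc ja))"
        if "(aa + lE) mod 2 ^ b = ab" "s3 50 = va" "s3 42 = ja" "Suc ja mod 2 ^ b = Suc ja" for aa ab va ja Q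
        by (simp add: that p3)
      have C2: "exc ?C2 s3 m' Q = Q (s3(44 := db + M + ?a)) ((m'(db + M + ?a := ?v))(db + M + (?a + lE) := Suc ?j))" for Q
        unfolding exc.simps(5)[of "Asg 44 _"] exc.simps(2) A by (rule S[OF md(5) s3(2,4) md(6)])
      show ?case
        unfolding s3(1) C2 e2 by (simp add: s3(5,6) p3(19) s21 del: em.simps)
    qed
  qed
  then show ?case
    by (simp only: exc.simps(2,5) E1 E2 E3 ev.simps(1))
qed

lemma exc_BB:
  assumes c: "ctx sh rb db s" and rok: "rok rb X mm" and le: "rb + BL \<le> db" "db + DB < 2 ^ b"
    and zero: "\<And>a. db \<le> a \<Longrightarrow> mm a = 0"
  shows "exc BB s mm (\<lambda>s' m'. qmem sh rb db X m' \<and> (\<forall>a. a < db \<or> db + DB \<le> a \<longrightarrow> m' a = mm a) \<and> (\<forall>r<40. s' r = s r))"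
  unfolding BB_def exc_simps
proof (rule exc_mono[OF exc_BS[OF c rok le zero]], goal_cases)
  case (2 s1 m1)
  then have s1: "m1 = over db M (HTs sh X) mm" "\<And>r. r < 40 \<Longrightarrow> s1 r = s r"
    by auto
  have c1: "ctx sh rb db s1"
    using s1 by (intro ctx_cong[OF c]) simp
  have bm: "bmem sh rb db X m1"
    unfolding bmem_def s1(1) using le rok_over[OF rok, of db M] by (simp add: over_in)
  show ?case
  proof (rule exc_mono[OF exc_BC[OF c1 bm le(1)]], goal_cases)
    case 1
    then show ?case
      unfolding s1(1) using zero by (simp add: over_out)
  next
    case (2 s2 m2)
    then have s2: "m2 = over (db + M) (lE + lE) (ems sh X) m1" "\<And>r. r < 40 \<Longrightarrow> s2 r = s1 r"
      by auto
    have "bmem sh rb db X m2"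
      using bm rok_over[of rb X m1 "db + M" "lE + lE" "ems sh X"] le unfolding s2(1) bmem_def by (auto simp: over_out)
    then have "qmem sh rb db X m2"
      unfolding qmem_def s2(1) by (simp add: over_in)
    moreover have "m2 a = mm a" if "a < db \<or> db + DB \<le> a" for a
      using that unfolding s2(1) s1(1) DB_def by (auto simp: over_def)
    ultimately show ?case
      using s1 s2 by simp
  qed
qed simp

lemma qmem_cong:
  assumes "qmem sh rb db X mm" "rb + BL \<le> db" "\<And>a. a < db + DB \<Longrightarrow> m' a = mm a"
  shows "qmem sh rb db X m'"
  using assms unfolding qmem_def bmem_def rok_def DB_def by (auto simp: add.assoc)

lemma rbase_dbase: "rep < reps \<Longrightarrow> rbase rep + BL \<le> dbase sh rep'"
  using rbase_le[of rep] by (simp add: dbase_def)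

lemma dbase_Suc: "dbase sh (Suc rep) = dbase sh rep + DB"
  by (simp add: dbase_def)

lemma dbase_next: "dbase sh reps = dbase (Suc sh) 0"
  by (simp add: dbase_def)

lemma dbase_mono: "sh * reps + rep < sh' * reps + rep' \<Longrightarrow> dbase sh rep + DB \<le> dbase sh' rep'"
  using mult_le_mono1[of "Suc (sh * reps + rep)" "sh' * reps + rep'" DB] by (simp add: dbase_def)

text \<open>Carries the property from the final memory of the construction to the memory in which a
  query starts, as these agree below \<open>tot\<close>.\<close>

lemma built_cong: "built xs mm \<Longrightarrow> (\<And>a. a < tot \<Longrightarrow> m' a = mm a) \<Longrightarrow> built xs m'"
  unfolding built_def
proof (intro allI impI)
  fix sh rep assume *: "\<forall>sh\<le>w. \<forall>rep<reps. qmem sh (rbase rep) (dbase sh rep) (bX xs rep) mm" "\<And>a. a < tot \<Longrightarrow> m' a = mm a"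
    "sh \<le> w" "rep < reps"
  show "qmem sh (rbase rep) (dbase sh rep) (bX xs rep) m'"
    by (rule qmem_cong[of _ _ _ _ mm]) (use * rbase_dbase dbase_le[of sh rep] in auto)
qed

lemma exc_BUILD:
  assumes P: "par s" and rok: "\<And>rep. rep < reps \<Longrightarrow> rok (rbase rep) (bX xs rep) mm" and zero: "\<And>a. d0 \<le> a \<Longrightarrow> mm a = 0"
  shows "exc BUILD s mm (\<lambda>s' m'. par s' \<and> built xs m' \<and> (\<forall>a<d0. m' a = mm a))"
  unfolding BUILD_def
proof (rule exc_For[where J = "\<lambda>j s' m'. par s' \<and> (\<forall>a<d0. m' a = mm a) \<and> (\<forall>a\<ge>dbase j 0. m' a = 0) \<and>
    (\<forall>sh<j. \<forall>rep<reps. qmem sh (rbase rep) (dbase sh rep) (bX xs rep) m')"], goal_cases)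
  case 1
  show ?case using lm0 parD[OF P] by simp
next
  case 2
  show ?case using P zero by (auto simp: par_def dbase_def)
next
  case (4 s' m')
  then show ?case using parD[OF P] by (simp add: built_def less_Suc_eq_le)
next
  case (3 j s' m')
  then have s': "par s'" "\<And>a. a < d0 \<Longrightarrow> m' a = mm a" "\<And>a. dbase j 0 \<le> a \<Longrightarrow> m' a = 0" "s' 30 = j" "j \<le> w"
    "\<And>sh rep. sh < j \<Longrightarrow> rep < reps \<Longrightarrow> qmem sh (rbase rep) (dbase sh rep) (bX xs rep) m'"
    using parD[OF P] by auto
  show ?case
  proof (rule exc_For[where J = "\<lambda>i s'' m''. par s'' \<and> s'' 30 = j \<and> (\<forall>a<d0. m'' a = mm a) \<and> (\<forall>a\<ge>dbase j i. m'' a = 0) \<and>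
    (\<forall>sh<j. \<forall>rep<reps. qmem sh (rbase rep) (dbase sh rep) (bX xs rep) m'') \<and>
    (\<forall>rep<i. qmem j (rbase rep) (dbase j rep) (bX xs rep) m'')"], goal_cases)
    case 1
    show ?case using lm0 parD[OF s'(1)] by simp
  next
    case 2
    show ?case using s' by (simp add: par_def)
  next
    case (4 s2 m2)
    then have s2: "par s2" "s2 30 = j" "\<And>a. a < d0 \<Longrightarrow> m2 a = mm a" "\<And>a. dbase (Suc j) 0 \<le> a \<Longrightarrow> m2 a = 0"
      "\<And>sh rep. sh < j \<Longrightarrow> rep < reps \<Longrightarrow> qmem sh (rbase rep) (dbase sh rep) (bX xs rep) m2"
      "\<And>rep. rep < reps \<Longrightarrow> qmem j (rbase rep) (dbase j rep) (bX xs rep) m2"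
      using parD(5)[OF s'(1)] by (simp_all add: dbase_next)
    have "s2 20 = s 20"
      using parD(18)[OF s2(1)] parD(18)[OF P] by simp
    moreover have "par (s2(30 := Suc j))"
      using s2(1) by (simp add: par_def)
    moreover have "qmem sh (rbase rep) (dbase sh rep) (bX xs rep) m2" if "sh < Suc j" "rep < reps" for sh rep
      using that s2(5,6) by (cases "sh = j") auto
    ultimately show ?case
      using s2(2-4) by simp
  next
    case (3 i s1 m1)
    then have s1: "par s1" "s1 30 = j" "s1 36 = i" "i < reps" "\<And>a. a < d0 \<Longrightarrow> m1 a = mm a" "\<And>a. dbase j i \<le> a \<Longrightarrow> m1 a = 0"
      "\<And>sh rep. sh < j \<Longrightarrow> rep < reps \<Longrightarrow> qmem sh (rbase rep) (dbase sh rep) (bX xs rep) m1"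
      "\<And>rep. rep < i \<Longrightarrow> qmem j (rbase rep) (dbase j rep) (bX xs rep) m1"
      using parD[OF s'(1)] by auto
    show ?case
      unfolding exc_simps
    proof (rule exc_SETB[OF s1(1)], goal_cases)
      case (3 s2)
      then have c: "ctx j (rbase i) (dbase j i) s2" "s2 36 = i" "s2 7 = s1 7" using s1 by auto
      have "rok (rbase i) (bX xs i) m1"
        unfolding rok_def
      proof (intro allI impI)
        fix a assume "a < BL"
        then have "rbase i + a < d0"
          using rbase_le[OF s1(4)] by simp
        then show "m1 (rbase i + a) = bX xs i a \<and> bX xs i a < 2 ^ b"
          using s1(5) rok[OF s1(4)] \<open>a < BL\<close> by (simp add: rok_def)
      qed
      note r = this
      have db: "dbase j i + DB < 2 ^ b"
        using dbase_le[OF s'(5) s1(4)] tot by simp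
      show ?case
      proof (rule exc_mono[OF exc_BB[OF c(1) r rbase_dbase[OF s1(4)] db s1(6)]], goal_cases)
        case (2 s3 m3)
        then have s3: "qmem j (rbase i) (dbase j i) (bX xs i) m3" "\<And>a. a < dbase j i \<or> dbase j i + DB \<le> a \<Longrightarrow> m3 a = m1 a"
          "\<And>r. r < 40 \<Longrightarrow> s3 r = s2 r"
          by auto
        have old: "qmem sh (rbase rep) (dbase sh rep) (bX xs rep) m3"
          if "qmem sh (rbase rep) (dbase sh rep) (bX xs rep) m1" "rep < reps" "sh * reps + rep < j * reps + i" for sh rep
          by (rule qmem_cong[OF that(1) rbase_dbase[OF that(2)]]) (use dbase_mono[OF that(3)] s3(2) in simp)
        have d0: "d0 \<le> dbase j i"
          by (simp add: dbase_def)
        have "par s3"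
          using par_cong[OF ctxD(1)[OF c(1)]] s3(3) by simp
        moreover have "par (s3(36 := Suc i))"
          using calculation by (simp add: par_def)
        moreover have "s3 30 = j" "s3 36 = i" "s3 7 = s' 7"
          by (simp_all add: s3(3) c(2,3) ctxD(2)[OF c(1)] parD(5)[OF s1(1)] parD(5)[OF s'(1)])
        moreover have "m3 a = mm a" if "a < d0" for a
          using s3(2)[of a] s1(5)[OF that] that d0 by simp
        moreover have "m3 a = 0" if "dbase j (Suc i) \<le> a" for a
          using s3(2)[of a] s1(6)[of a] that by (simp add: dbase_Suc)
        moreover have "qmem sh (rbase rep) (dbase sh rep) (bX xs rep) m3" if "sh < j" "rep < reps" for sh rep
          using that s1(7)[OF that] mult_le_mono1[of "Suc sh" j reps] by (intro old) auto
        moreover have "qmem j (rbase rep) (dbase j rep) (bX xs rep) m3" if "rep < Suc i" for rep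
          using that s1(8)[of rep] s1(4) s3(1) by (cases "rep = i") (auto intro!: old)
        ultimately show ?case
          by simp
      qed simp
    qed (use s1 s' in auto)
  qed
qed

end

section \<open>Parameters and main programs\<close>

text \<open>Lets a program compare with \<open>2 ^ c\<close> without forming this power, which may
  exceed a word.\<close>

lemma shift_less_iff: "0 < drop_bit c N \<longleftrightarrow> 2 ^ c \<le> (N::nat)"
  by (simp add: drop_bit_eq_div div_greater_zero_iff)

text \<open>Run by construction and query alike, so that the header holds only the basic parameters
  and the derived ones are recomputed.\<close>

definition "PRM = Asg 6 (Bin Sub (Bin ShiftL (C 1) (V 5)) (C 1)) ;;
  Asg 8 (Bin ShiftL (C 1) (Bin Add (Bin Sub (V 5) (V 23)) (C 9))) ;;
  Asg 9 (Bin Sub (V 8) (C 1)) ;;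
  Asg 27 (Bin Sub (V 5) (Bin Mul (V 23) (C 3))) ;;
  Asg 10 (Bin ShiftL (C 1) (V 27)) ;;
  Asg 28 (Bin Sub (V 10) (C 1)) ;;
  Asg 11 (Bin ShiftL (C 1) (V 23)) ;;
  Asg 13 (Bin Mul (V 23) (C 2)) ;;
  Asg 12 (Bin ShiftL (C 1) (V 13)) ;;
  Asg 14 (Bin ShiftL (C 1) (Bin Add (V 27) (C 3))) ;;
  Asg 15 (Bin Sub (V 14) (C 1)) ;;
  Asg 16 (Bin Add (V 8) (V 10)) ;;
  Asg 17 (Bin Mul (V 12) (V 14)) ;;
  Asg 20 (Bin Add (V 4) (C 1)) ;;
  Asg 24 (Bin Add (Bin Add (V 4) (V 5)) (C 2)) ;;
  Asg 25 (Bin Add (V 24) (V 8)) ;;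
  Asg 18 (Bin Add (V 25) (Bin Mul (Bin Add (V 13) (C 1)) (V 16))) ;;
  Asg 19 (Bin Add (V 8) (Bin Add (V 17) (V 17))) ;;
  Asg 21 (Bin Mul (V 12) (V 10)) ;;
  Asg 22 (Bin Add (C 8) (Bin Mul (V 7) (V 18))) ;; Skip"

text \<open>\<open>k\<close> is the bit length of \<open>N\<close>, and \<open>2 ^ kt\<close> is the
  cube root of the received word \<open>A\<close> up to a factor 2.\<close>

locale env3 = env2 +
  fixes A c :: nat
  assumes kN: "2 ^ (k - 1) \<le> N" "N < 2 ^ k"
    and ktA: "8 ^ kt \<le> A" "A < 8 ^ Suc kt"
    and reps: "reps = 3 * ((c + 1) * k + w)"
    and lm6: "N \<le> lm 6"
begin

lemma reps1: "1 \<le> reps" "3 * k \<le> reps"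
  using reps kt by simp_all

lemma BL_le: "BL \<le> reps * BL" "reps \<le> reps * BL" "reps * BL + 8 = d0"
  using mult_le_mono1[OF reps1(1), of BL] mult_le_mono2[of 1 BL reps] by (simp_all add: d0_def BL_eq)

lemma DB_le: "DB \<le> (w + 1) * reps * DB" "(w + 1) * reps \<le> (w + 1) * reps * DB" "d0 + (w + 1) * reps * DB = tot"
  using mult_le_mono1[of 1 "(w + 1) * reps" DB] mult_le_mono2[OF DB_pos, of "(w + 1) * reps"] reps1(1) by (simp_all add: tot_def)

lemma M_ge: "512 \<le> M"
  using power_increasing[of 9 mu "2::nat"] by (simp add: M_def mu_def)

text \<open>Each quantity is bounded by the total size, so the single bound on \<open>tot\<close>
  excludes overflow.\<close>

lemma sizes: "reps < 2 ^ b" "BL < 2 ^ b" "DB < 2 ^ b" "d0 < 2 ^ b" "(w + 1) * reps < 2 ^ b" "512 < (2::nat) ^ b"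
proof -
  have "M \<le> DB"
    by (simp add: DB_def)
  then show "reps < 2 ^ b" "BL < 2 ^ b" "DB < 2 ^ b" "d0 < 2 ^ b" "(w + 1) * reps < 2 ^ b" "512 < (2::nat) ^ b"
    using BL_le DB_le tot M_ge by linarith+
qed

lemma exc_Asg: "ev b s mm x = v \<Longrightarrow> exc d (s(r := v)) mm Q \<Longrightarrow> exc (Asg r x ;; d) s mm Q"
  by simp

lemma sub_mod: "v \<le> u \<Longrightarrow> u < 2 ^ b \<Longrightarrow> (u + 2 ^ b - v) mod 2 ^ b = u - (v::nat)"
proof -
  assume "v \<le> u" "u < 2 ^ b"
  then have "u + 2 ^ b - v = u - v + 2 ^ b" "u - v < 2 ^ b"
    by linarith+
  then show ?thesis
    by (simp only: mod_add_self2 mod_less)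
qed

lemma exc_PRM:
  assumes s: "s 3 = N" "s 4 = w" "s 5 = k" "s 23 = kt" "s 7 = reps"
  shows "exc PRM s mm (\<lambda>s' m'. m' = mm \<and> par s' \<and> (\<forall>r<3. s' r = s r))"
proof -
  have B: "w + k + 2 + M + q * K + K < 2 ^ b" "M + (lE + lE) < 2 ^ b"
    using sizes(2,3) BL_eq by (simp_all add: DB_def)
  have kb: "k < 2 ^ b" "M < 2 ^ b" "K < 2 ^ b" "lE < 2 ^ b" "q * K + K < 2 ^ b"
    using B by simp_all
  have mK: "m < 2 ^ b" "m \<le> K"
    using kb(3) by (simp_all add: K_def)
  have eE: "2 ^ e \<le> lE" "2 ^ q \<le> lE"
    by (simp_all add: lE_def)
  have kk: "3 * kt < k" "kt < 2 ^ b" "kt * 3 < 2 ^ b" "kt < k"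
    using kt kb by simp_all
  have const: "9 mod 2 ^ b = (9::nat)" "3 mod 2 ^ b = (3::nat)" "2 mod 2 ^ b = (2::nat)" "8 mod 2 ^ b = (8::nat)" "1 mod 2 ^ b = (1::nat)" "Suc 0 mod 2 ^ b = Suc 0"
    using sizes(6) by simp_all
  have pb: "push_bit j (Suc 0) = 2 ^ j" for j
    by (simp add: push_bit_eq_mult)
  have pow: "(2::nat) ^ j mod 2 ^ b = 2 ^ j" if "2 ^ j < (2::nat) ^ b" for j
    using that by simp
  have msk: "(2 ^ j + 2 ^ b - Suc 0) mod 2 ^ b = mask j" if "2 ^ j < (2::nat) ^ b" for j
    using that sub_mod[of 1 "2 ^ j"] by (simp add: mask_eq_exp_minus_1)
  have nm: "(2 ^ k mod 2 ^ b + 2 ^ b - Suc 0) mod 2 ^ b = mask k" "push_bit k (Suc 0) = 2 ^ k"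
  proof -
    \<comment> \<open>For \<open>k = b\<close> the power wraps to 0, and subtracting 1 wraps again,
      to the word with all bits set.\<close>
    show "(2 ^ k mod 2 ^ b + 2 ^ b - Suc 0) mod 2 ^ b = mask k"
    proof (cases "k = b")
      case True
      then show ?thesis by (simp add: mask_eq_exp_minus_1)
    next
      case False
      then have "(2::nat) ^ k < 2 ^ b"
        using k by simp
      then show ?thesis
        using msk[of k] by simp
    qed
  qed (rule pb)
  have "k - kt + 9 = mu"
    by (simp add: mu_def)
  moreover have "mu < 2 ^ b"
    using bounds(6) kb(1) by linarith
  ultimately have eM: "2 ^ (((k + 2 ^ b - kt) mod 2 ^ b + 9) mod 2 ^ b) mod 2 ^ b = M" "9 mod 2 ^ b = (9::nat)"
    using kb kk const by (simp_all add: sub_mod M_def)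
  have sub1: "(M + 2 ^ b - Suc 0) mod 2 ^ b = mask mu"
    using msk[of mu] kb(2) by (simp add: M_def)
  have e27: "(kt * 3) mod 2 ^ b = kt * 3" "(k + 2 ^ b - kt * 3) mod 2 ^ b = k - 3 * kt" "3 mod 2 ^ b = (3::nat)"
    using kb(1) kk const by (simp_all add: sub_mod mult.commute)
  have em: "2 ^ (k - 3 * kt) mod 2 ^ b = m"
    using mK(1) by (simp add: m_def)
  have sub2: "(m + 2 ^ b - Suc 0) mod 2 ^ b = mask (k - 3 * kt)"
    using msk[of "k - 3 * kt"] mK(1) by (simp add: m_def)
  have et: "2 ^ kt mod 2 ^ b = t"
    using k kk(4) by (simp add: t_def)
  have eq: "(kt * 2) mod 2 ^ b = q" "2 mod 2 ^ b = (2::nat)"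
    using kk const by (simp_all add: q_def mult.commute)
  have el: "(2::nat) ^ q mod 2 ^ b = 2 ^ q"
    using eE kb(4) by (simp only: pow[OF le_less_trans])
  have ee: "(2::nat) ^ ((k - 3 * kt + 3) mod 2 ^ b) mod 2 ^ b = 2 ^ e" "3 mod 2 ^ b = (3::nat)"
  proof -
    have "e < 2 ^ b"
      using bounds(3) kb(1) by simp
    then have "(k - 3 * kt + 3) mod 2 ^ b = e"
      by (simp add: e_def)
    then show "(2::nat) ^ ((k - 3 * kt + 3) mod 2 ^ b) mod 2 ^ b = 2 ^ e"
      using eE kb(4) by (simp only: pow[OF le_less_trans])
  qed (rule const)
  have sub3: "(2 ^ e + 2 ^ b - Suc 0) mod 2 ^ b = mask e"
    using eE kb(4) by (intro msk) linarith
  have eK: "(M + m) mod 2 ^ b = K"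
    using kb(3) by (simp add: K_def)
  have elE: "(2 ^ q * 2 ^ e) mod 2 ^ b = lE"
    using kb(4) by (simp add: lE_def)
  have e20: "Suc w mod 2 ^ b = Suc w"
    using B by simp
  have e24: "(w + k) mod 2 ^ b = w + k" "(w + k + 2) mod 2 ^ b = w + k + 2" "Suc (Suc (w + k)) mod 2 ^ b = Suc (Suc (w + k))" "2 mod 2 ^ b = (2::nat)"
    using B const by simp_all
  have e25: "(w + k + 2 + M) mod 2 ^ b = w + k + 2 + M" "Suc (Suc (w + k + M)) mod 2 ^ b = Suc (Suc (w + k + M))"
    using B by simp_all
  have eBL: "Suc q mod 2 ^ b = Suc q" "(K + q * K) mod 2 ^ b = K + q * K" "Suc (Suc (w + k + M + (K + q * K))) mod 2 ^ b = BL"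
  proof -
    have "q \<le> q * K"
      using bounds(9) by simp
    then show "Suc q mod 2 ^ b = Suc q"
      using B bounds by (intro mod_less) linarith
  qed (use B BL_eq in simp_all)
  have eDB: "(lE + lE) mod 2 ^ b = lE + lE" "(M + (lE + lE)) mod 2 ^ b = DB"
    using B by (simp_all add: DB_def)
  have e21: "(2 ^ q * m) mod 2 ^ b = 2 ^ q * m"
  proof -
    have "2 ^ q * m \<le> lE"
      unfolding lE_def using mE by (intro mult_le_mono) auto
    then show ?thesis
      using kb(4) by (intro mod_less) linarith
  qed
  have ed0: "(reps * BL) mod 2 ^ b = reps * BL" "(8 + reps * BL) mod 2 ^ b = d0" "8 mod 2 ^ b = (8::nat)"
    using sizes(4) const by (simp_all add: d0_def)
  show ?thesis
    unfolding PRM_def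
    apply (rule exc_Asg[where v = "mask k"], simp add: s nm)
    apply (rule exc_Asg[where v = "M"], simp add: s eM)
    apply (rule exc_Asg[where v = "mask mu"], simp add: s sub1)
    apply (rule exc_Asg[where v = "k - 3 * kt"], simp add: s e27)
    apply (rule exc_Asg[where v = "m"], simp add: s em)
    apply (rule exc_Asg[where v = "mask (k - 3 * kt)"], simp add: s sub2)
    apply (rule exc_Asg[where v = "t"], simp add: s et)
    apply (rule exc_Asg[where v = "q"], simp add: s eq)
    apply (rule exc_Asg[where v = "2 ^ q"], simp add: s el)
    apply (rule exc_Asg[where v = "2 ^ e"], simp add: s ee)
    apply (rule exc_Asg[where v = "mask e"], simp add: s sub3)
    apply (rule exc_Asg[where v = "K"], simp add: s eK)
    apply (rule exc_Asg[where v = "lE"], simp add: s elE)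
    apply (rule exc_Asg[where v = "w + 1"], simp add: s e20)
    apply (rule exc_Asg[where v = "w + k + 2"], simp add: s e24)
    apply (rule exc_Asg[where v = "w + k + 2 + M"], simp add: s e25)
    apply (rule exc_Asg[where v = "BL"], simp add: s eBL)
    apply (rule exc_Asg[where v = "DB"], simp add: s eDB)
    apply (rule exc_Asg[where v = "2 ^ q * m"], simp add: s e21)
    apply (rule exc_Asg[where v = "d0"], simp add: s ed0)
    using s by (simp add: par_def)
qed

end

section \<open>Complete programs for construction and query\<close>

definition "SHR j = ((\<lambda>d. Asg 40 (Bin ShiftR (V 40) (C 1)) ;; d) ^^ j) Skip"
text \<open>The bit length of \<open>N\<close> is found in \<open>N\<close> rounds, which the linear
  construction time affords.\<close>

definition "KLOOP = For 41 3 6 (If (C 0) (Bin ShiftR (V 3) (V 41)) (Asg 5 (Bin Add (V 41) (C 1))) Skip)"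
definition "TLOOP = For 41 5 0 (If (Bin ShiftR (V 2) (Bin Mul (V 41) (C 3))) (C 1) Skip (Asg 23 (V 41)))"
definition "PREB c = Asg 3 (V 0) ;; Asg 4 (V 1) ;; Asg 5 (C 0) ;; KLOOP ;; Asg 23 (C 0) ;; TLOOP ;;
  Asg 7 (Bin Mul (C 3) (Bin Add (Bin Mul (C (c + 1)) (V 5)) (V 4))) ;; PRM ;;
  Sto (C 0) (C 1) ;; Sto (C 1) (V 3) ;; Sto (C 2) (V 4) ;; Sto (C 3) (V 5) ;; Sto (C 4) (V 23) ;; Sto (C 5) (V 7) ;;
  Asg 90 (C 8) ;; Asg 91 (V 22) ;; Asg 93 (C 1) ;; Asg 37 (C 1)"
text \<open>The loop that draws random words runs at least once; a small instance lets it write to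
  cell 2, behind the two words of the result.\<close>

definition "PRES = Asg 90 (C 2) ;; Asg 91 (C 3) ;; Asg 93 (C 1) ;; Asg 37 (C 0)"

text \<open>The instances with \<open>N < 2 ^ k0\<close> are solved by brute force. The bound is tested by single shifts,
  as \<open>k0\<close> need not fit into a word.\<close>

definition "PRE c k0 = Asg 40 (V 0) ;; SHR k0 ;; If (C 0) (V 40) (PREB c) PRES"
definition "POST = If (C 0) (V 37) (BUILD ;; Asg 0 (Bin Add (V 22) (Bin Mul (Bin Mul (V 20) (V 7)) (V 19))))
  (Sto (C 0) (C 0) ;; Sto (C 1) (V 0) ;; Asg 0 (C 2))"
definition "QS = Asg 3 (Ld (C 1)) ;; Asg 40 (C 0) ;; For 43 3 5 (Cal 44 (V 43) ;; If (V 0) (V 44) Skip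
  (If (V 40) (C 1) (Asg 40 (C 1) ;; Asg 41 (V 44) ;; Asg 42 (V 43)) (If (V 41) (V 44) (Asg 41 (V 44) ;; Asg 42 (V 43)) Skip))) ;;
  Asg 0 (V 40) ;; Asg 1 (V 42)"
definition "QRY = If (C 0) (Ld (C 0)) (Asg 3 (Ld (C 1)) ;; Asg 4 (Ld (C 2)) ;; Asg 5 (Ld (C 3)) ;; Asg 23 (Ld (C 4)) ;; Asg 7 (Ld (C 5)) ;;
  PRM ;; MQ) QS"

definition pred_ans :: "nat \<Rightarrow> (nat \<Rightarrow> nat) \<Rightarrow> nat \<Rightarrow> (nat \<Rightarrow> nat) \<Rightarrow> bool" where
  "pred_ans N f y s \<longleftrightarrow> (let V = {v \<in> f ` {..<N}. v \<le> y} in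
    if V = {} then s 0 = 0 else s 0 = 1 \<and> s 1 < N \<and> f (s 1) = Max V)"

context ram
begin

lemma exc_SHR: "(\<And>s'. s' 40 = drop_bit j (s 40) \<Longrightarrow> (\<And>r. r \<noteq> 40 \<Longrightarrow> s' r = s r) \<Longrightarrow> Q s' mm) \<Longrightarrow> exc (SHR j) s mm Q"
proof (induction j arbitrary: s)
  case 0
  then show ?case by (simp add: SHR_def)
next
  case (Suc j)
  have "exc (SHR j) (s(40 := drop_bit 1 (s 40))) mm Q"
    by (rule Suc.IH) (rule Suc.prems, simp_all add: drop_bit_Suc drop_bit_half)
  then show ?case
    by (simp add: SHR_def b_gt_0)
qed

lemma exc_QS:
  assumes m: "mm 1 = N" and s: "s 0 = y" and l: "N \<le> lm 5"
  shows "exc QS s mm (\<lambda>s' m'. pred_ans N f y s')"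
proof -
  have "exc (For 43 3 5 (Cal 44 (V 43) ;; If (V 0) (V 44) Skip
      (If (V 40) (C 1) (Asg 40 (C 1) ;; Asg 41 (V 44) ;; Asg 42 (V 43)) (If (V 41) (V 44) (Asg 41 (V 44) ;; Asg 42 (V 43)) Skip))))
    (s(3 := N, 40 := 0)) mm (\<lambda>s' m'. exc (Asg 0 (V 40) ;; Asg 1 (V 42)) s' m' (\<lambda>s' m'. pred_ans N f y s'))"
  proof (rule exc_For[where J = "\<lambda>j s' m'. s' 0 = y \<and> (s' 40 = 0 \<and> (\<forall>x<j. \<not> f x \<le> y) \<or>
      s' 40 = 1 \<and> s' 42 < j \<and> s' 41 = f (s' 42) \<and> s' 41 \<le> y \<and> (\<forall>x<j. f x \<le> y \<longrightarrow> f x \<le> s' 41))"], goal_cases)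
    case (3 j s' m')
    then show ?case
      by (auto simp: b_gt_0 less_Suc_eq not_less not_le)
  next
    case (4 s' m')
    then consider "s' 40 = 0" "\<forall>x<N. \<not> f x \<le> y" | "s' 40 = 1" "s' 42 < N" "s' 41 = f (s' 42)" "s' 41 \<le> y" "\<forall>x<N. f x \<le> y \<longrightarrow> f x \<le> s' 41"
      by auto
    then have "pred_ans N f y (s'(0 := s' 40, 1 := s' 42))"
    proof cases
      case 1
      then have "{v \<in> f ` {..<N}. v \<le> y} = {}" by auto
      then show ?thesis using 1 by (simp add: pred_ans_def)
    next
      case 2
      then have mx: "s' 41 \<in> {v \<in> f ` {..<N}. v \<le> y}" by auto
      have "Max {v \<in> f ` {..<N}. v \<le> y} = s' 41"
        using mx 2 by (intro Max_eqI) auto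
      moreover have "{v \<in> f ` {..<N}. v \<le> y} \<noteq> {}"
        using mx by blast
      ultimately show ?thesis using 2 by (simp add: pred_ans_def Let_def)
    qed
    then show ?case
      by simp
  qed (use s l in auto)
  then show ?thesis
    unfolding QS_def using m by (simp add: b_gt_0)
qed

lemma exc_rnc_start:
  assumes "exc c s m Q" "wfc c" "code P p (comp p c)" "agree s r"
  shows "\<exists>n s' m' r' k'. R P n \<lparr>pc = p, reg = r, mem = m, clock = k\<rparr> \<lparr>pc = p + csz c, reg = r', mem = m', clock = k'\<rparr> \<and>
    agree s' r' \<and> Q s' m' \<and> k' \<le> k + tb \<tau> lm c \<and> n + k \<le> k'"
proof -
  from exc_sound[OF assms] obtain n s' m' r' k' where
    *: "R P n \<lparr>pc = p, reg = r, mem = m, clock = k\<rparr> \<lparr>pc = p + csz c, reg = r', mem = m', clock = k'\<rparr>"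
    "agree s' r'" "Q s' m'" "k' \<le> k + tb \<tau> lm c"
    unfolding rnc_def by blast
  show ?thesis
    using * rch_clock[OF *(1)] by force
qed

text \<open>A deterministic part, the drawing of \<open>n + 1\<close> words, and another
  deterministic part. The first part ends with a condition on all states that the drawing may
  produce, and \<open>G\<close> selects the word lists for which the last part is
  guaranteed.\<close>

lemma build_prob:
  fixes G :: "nat list \<Rightarrow> bool"
  assumes e1: "exc c1 s0 m0 (\<lambda>s m. s 90 = a \<and> s 91 = a + Suc n \<and> s 93 = 1 \<and>
      (\<forall>xs\<in>W b (Suc n). \<forall>s'. G xs \<longrightarrow> (\<forall>r<100. r \<noteq> 90 \<longrightarrow> r \<noteq> 92 \<longrightarrow> s' r = s r) \<longrightarrow>
        exc c2 s' (\<lambda>c. if a \<le> c \<and> c < a + Suc n then xs ! (c - a) else m c) Post))"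
    and lt: "a + Suc n < 2 ^ b" and wf: "wfc c1" "wfc c2"
    and B: "B = comp 0 c1 @ [Rand 92, Store 90 92, Arith Add 90 90 93, JumpLess 90 91 (csz c1)] @ comp (csz c1 + 4) c2"
    and T: "tb \<tau> lm c1 + 4 * Suc n + tb \<tau> lm c2 \<le> T"
  shows "avg (W b (Suc n)) (\<lambda>xs. of_bool (G xs)) \<le>
    measure_pmf.prob (rand_run b sub B T \<lparr>pc = 0, reg = s0, mem = m0, clock = 0\<rparr>)
      {c. halted B c \<and> clock c \<le> T \<and> (\<exists>s. agree s (reg c) \<and> Post s (mem c))}" (is "_ \<le> measure_pmf.prob _ ?S")
proof -
  let ?p = "csz c1"
  let ?L = "[Rand 92, Store 90 92, Arith Add 90 90 93, JumpLess 90 91 ?p]"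
  have S4: "i + 4 = Suc (Suc (Suc (Suc i)))" for i :: nat
    by simp
  have ag: "agree r r" for r
    by (simp add: agree_def)
  have "code B 0 (comp 0 c1 @ (?L @ comp (?p + 4) c2))"
    unfolding B code_def by (intro exI[of _ "[]"]) simp
  then have cd: "code B 0 (comp 0 c1)" "code B ?p ?L" "code B (?p + 4) (comp (?p + 4) c2)"
    unfolding code_append by (simp_all add: S4)
  have len: "length B = ?p + 4 + csz c2"
    by (simp add: B)
  obtain n1 s1 m1 r1 k1 where 1: "R B n1 \<lparr>pc = 0, reg = s0, mem = m0, clock = 0\<rparr> \<lparr>pc = 0 + ?p, reg = r1, mem = m1, clock = k1\<rparr>"
    "agree s1 r1" "k1 \<le> 0 + tb \<tau> lm c1" "n1 + 0 \<le> k1"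
    and Q1: "s1 90 = a \<and> s1 91 = a + Suc n \<and> s1 93 = 1 \<and>
      (\<forall>xs\<in>W b (Suc n). \<forall>s'. G xs \<longrightarrow> (\<forall>r<100. r \<noteq> 90 \<longrightarrow> r \<noteq> 92 \<longrightarrow> s' r = s1 r) \<longrightarrow>
        exc c2 s' (\<lambda>c. if a \<le> c \<and> c < a + Suc n then xs ! (c - a) else m1 c) Post)"
    using exc_rnc_start[OF e1 wf(1) cd(1) ag, of 0] by (elim exE conjE) (rule that; assumption?; blast)
  have s1: "s1 90 = a" "s1 91 = a + Suc n" "s1 93 = 1"
    using Q1 by simp_all
  have s14: "exc c2 s' (\<lambda>c. if a \<le> c \<and> c < a + Suc n then xs ! (c - a) else m1 c) Post"
    if "xs \<in> W b (Suc n)" "G xs" "\<And>r. r < 100 \<Longrightarrow> r \<noteq> 90 \<Longrightarrow> r \<noteq> 92 \<Longrightarrow> s' r = s1 r" for xs s'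
    using Q1 that by blast
  \<comment> \<open>What remains of the step budget; the steps of a part are at most its
    time.\<close>
  define T2 where "T2 = T - n1 - 4 * Suc n"
  have T2: "T = n1 + (4 * Suc n + T2)" "tb \<tau> lm c2 \<le> T2"
    using T 1 by (simp_all add: T2_def)
  have r1: "r1 i = s1 i" if "i < 100" for i
    using 1(2) that by (simp add: agree_def)
  have "rand_run b sub B T \<lparr>pc = 0, reg = s0, mem = m0, clock = 0\<rparr> = rand_run b sub B (4 * Suc n + T2) \<lparr>pc = ?p, reg = r1, mem = m1, clock = k1\<rparr>"
    unfolding T2(1) using rch_rand_run[OF 1(1)] by simp
  moreover have "avg (W b (Suc n)) (\<lambda>xs. of_bool (G xs)) \<le>
      measure_pmf.prob (rand_run b sub B (4 * Suc n + T2) \<lparr>pc = ?p, reg = r1, mem = m1, clock = k1\<rparr>) ?S"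
  proof (rule rand_loop[OF cd(2)])
    fix xs r' assume xs: "xs \<in> W b (Suc n)" and r': "\<And>i. i \<noteq> 90 \<Longrightarrow> i \<noteq> 92 \<Longrightarrow> r' i = r1 i"
    let ?m = "\<lambda>c. if a \<le> c \<and> c < a + Suc n then xs ! (c - a) else m1 c"
    show "of_bool (G xs) \<le> measure_pmf.prob (rand_run b sub B T2 \<lparr>pc = ?p + 4, reg = r', mem = ?m, clock = k1 + 4 * Suc n\<rparr>) ?S"
    proof (cases "G xs")
      case True
      have e2: "exc c2 r' ?m Post"
        using s14[OF xs True] r' r1 by simp
      obtain n2 s2 m2 r2 k2 where 2: "R B n2 \<lparr>pc = ?p + 4, reg = r', mem = ?m, clock = k1 + 4 * Suc n\<rparr>
          \<lparr>pc = ?p + 4 + csz c2, reg = r2, mem = m2, clock = k2\<rparr>" "agree s2 r2" "Post s2 m2"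
          "k2 \<le> k1 + 4 * Suc n + tb \<tau> lm c2" "n2 + (k1 + 4 * Suc n) \<le> k2"
        using exc_rnc_start[OF e2 wf(2) cd(3) ag, of "k1 + 4 * Suc n"] by blast
      let ?c = "\<lparr>pc = ?p + 4 + csz c2, reg = r2, mem = m2, clock = k2\<rparr>"
      have "T2 = n2 + (T2 - n2)"
        using 2 T2 by simp
      then have "rand_run b sub B T2 \<lparr>pc = ?p + 4, reg = r', mem = ?m, clock = k1 + 4 * Suc n\<rparr> = rand_run b sub B (T2 - n2) ?c"
        using rch_rand_run[OF 2(1), of "T2 - n2"] by simp
      moreover have hc: "halted B ?c"
        by (simp add: halted_def len)
      moreover have "?c \<in> ?S"
        using hc 2 1 T by auto
      ultimately show ?thesis
        by (simp add: rand_run_halted measure_return)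
    qed simp
  qed (use s1 r1 lt in auto)
  ultimately show ?thesis by simp
qed

lemma query_answers:
  assumes e: "exc c (\<lambda>i. if i = 0 then y else 0) (\<lambda>a. if a < length D then D ! a else 0) (\<lambda>s m. pred_ans N f y s)"
    and wf: "wfc c" and t: "tb \<tau> lm c \<le> tq" and F: "sub = as_sub b F"
  shows "answers_pred_within b F (comp 0 c) D N f tq y"
proof -
  have cd: "code (comp 0 c) 0 (comp 0 c)"
    unfolding code_def by (intro exI[of _ "[]"]) simp
  have i: "init [y] D = \<lparr>pc = 0, reg = \<lambda>i. if i = 0 then y else 0, mem = \<lambda>a. if a < length D then D ! a else 0, clock = 0\<rparr>"
    by (auto simp: init_def)
  have ag: "agree (\<lambda>i. if i = 0 then y else 0) (\<lambda>i. if i = 0 then y else 0)"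
    by (simp add: agree_def)
  obtain n s' m' r' k' where *: "R (comp 0 c) n (init [y] D) \<lparr>pc = 0 + csz c, reg = r', mem = m', clock = k'\<rparr>"
    "agree s' r'" "pred_ans N f y s'" "k' \<le> 0 + tb \<tau> lm c"
    using exc_rnc_start[OF e wf cd ag, of 0] unfolding i by blast
  let ?c = "\<lparr>pc = 0 + csz c, reg = r', mem = m', clock = k'\<rparr>"
  have "halts_in b (as_sub b F) (comp 0 c) (init [y] D) ?c"
    unfolding halts_in_def using rch_step[OF *(1)] by (intro exI[of _ n]) (simp add: F halted_def)
  moreover have r': "reg ?c 0 = s' 0" "reg ?c 1 = s' 1"
    using *(2) by (simp_all add: agree_def)
  have "pred_ans N f y (reg ?c)"
    using *(3) unfolding pred_ans_def r' .
  moreover have "clock ?c \<le> tq"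
    using *(4) t by simp
  ultimately show ?thesis
    unfolding answers_pred_within_def pred_ans_def by blast
qed

end

definition "BLD c k0 = comp 0 (PRE c k0) @ [Rand 92, Store 90 92, Arith Add 90 90 93, JumpLess 90 91 (csz (PRE c k0))] @
  comp (csz (PRE c k0) + 4) POST"

lemma wfc_SHR: "wfc (SHR j)"
  by (induction j) (simp_all add: SHR_def)

lemma wfc_PRE: "wfc (PRE c k0)"
  by (simp add: PRE_def PREB_def PRES_def KLOOP_def TLOOP_def PRM_def wfc_SHR)

lemma wfc_POST: "wfc POST"
  by (simp add: POST_def BUILD_def SETB_def BB_def BS_def BC_def HV_def HX_def GZ_def STEP_def FMc_def HU_def)

lemma wfc_QRY: "wfc QRY"
  by (simp add: QRY_def QS_def PRM_def MQ_def MQ1_def MQ2_def INV_def SETB_def QB_def QC_def QD_def Q1_def L1_def L2_def LK_def CHK_def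
      HV_def HX_def GZ_def STEP_def FMc_def HU_def)

context env3
begin

lemma const_mod [simp]: "2 mod 2 ^ b = (2::nat)" "3 mod 2 ^ b = (3::nat)" "4 mod 2 ^ b = (4::nat)" "5 mod 2 ^ b = (5::nat)" "8 mod 2 ^ b = (8::nat)"
  using sizes(6) by simp_all

lemma bit_length: "2 ^ j \<le> N \<longleftrightarrow> j < k"
proof
  assume "2 ^ j \<le> N"
  then have "(2::nat) ^ j < 2 ^ k"
    using kN by linarith
  then show "j < k" by simp
next
  assume "j < k"
  then have "(2::nat) ^ j \<le> 2 ^ (k - 1)"
    using kt by (intro power_increasing) auto
  then show "2 ^ j \<le> N"
    using kN by linarith
qed

lemma exc_Asg_Seq: "ev b s mm x = v \<Longrightarrow> exc c1 (s(r := v)) mm (\<lambda>s m. exc c2 s m Q) \<Longrightarrow> exc (Asg r x ;; c1 ;; c2) s mm Q"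
  by simp

lemma exc_KLOOP:
  assumes "s 3 = N" "s 5 = 0"
  shows "exc KLOOP s mm (\<lambda>s' m'. m' = mm \<and> s' 5 = k \<and> (\<forall>r<40. r \<noteq> 5 \<longrightarrow> s' r = s r))"
  unfolding KLOOP_def
proof (rule exc_For[where J = "\<lambda>j s' m'. m' = mm \<and> s' 5 = min j k \<and> (\<forall>r<40. r \<noteq> 5 \<longrightarrow> s' r = s r)"], goal_cases)
  case (3 j s' m')
  then have j: "Suc j < 2 ^ b" "s' 3 = N" "s' 41 = j"
    using assms Nb by simp_all
  show ?case
    using 3 j assms by (auto simp: shift_less_iff bit_length)
next
  case (4 s' m')
  \<comment> \<open>The \<open>N\<close> rounds reach the bit length because
    \<open>k \<le> N\<close>.\<close>
  have "k < 2 ^ k"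
    by (rule less_exp)
  then have "k - 1 < 2 ^ (k - 1)"
    by simp
  then have "k \<le> N"
    using kN by linarith
  then show ?case
    using 4 assms by simp
qed (use assms lm6 in auto)

lemma exc_TLOOP:
  assumes "s 5 = k" "s 2 = A" "s 23 = 0"
  shows "exc TLOOP s mm (\<lambda>s' m'. m' = mm \<and> s' 23 = kt \<and> (\<forall>r<40. r \<noteq> 23 \<longrightarrow> s' r = s r))"
  unfolding TLOOP_def
\<comment> \<open>After \<open>j\<close> rounds the last exponent tested is \<open>j - 1\<close>;
  for \<open>j = 0\<close> truncated subtraction gives the initial 0.\<close>
proof (rule exc_For[where J = "\<lambda>j s' m'. m' = mm \<and> s' 23 = min (j - 1) kt \<and> (\<forall>r<40. r \<noteq> 23 \<longrightarrow> s' r = s r)"], goal_cases)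
  case (3 j s' m')
  then have j: "s' 2 = A" "s' 41 = j" "j < k"
    using assms by simp_all
  then have "j * 3 < 2 ^ b"
    using reps1 sizes(1) by linarith
  moreover have "(2::nat) ^ (j * 3) \<le> A \<longleftrightarrow> j \<le> kt"
  proof -
    have e: "(2::nat) ^ (j * 3) = 8 ^ j"
      by (simp add: power_mult mult.commute[of j])
    show ?thesis
    proof
      assume "2 ^ (j * 3) \<le> A"
      then have "(8::nat) ^ j < 8 ^ Suc kt"
        using ktA e by linarith
      then show "j \<le> kt"
        by (simp del: power_Suc)
    next
      assume "j \<le> kt"
      then have "(8::nat) ^ j \<le> 8 ^ kt"
        by (intro power_increasing) auto
      then show "2 ^ (j * 3) \<le> A"
        using ktA e by linarith
    qed
  qed
  ultimately have d: "(j * 3) mod 2 ^ b = j * 3" "drop_bit (j * 3) A < Suc 0 \<longleftrightarrow> \<not> j \<le> kt"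
    using shift_less_iff[of "j * 3" A] by auto
  show ?case
    using 3 j d assms by auto
next
  case (4 s' m')
  then show ?case
    using assms kt by auto
qed (use assms lm0 in auto)

definition hdr :: "(nat \<Rightarrow> nat) \<Rightarrow> bool" where
  "hdr mm \<longleftrightarrow> mm 0 = 1 \<and> mm 1 = N \<and> mm 2 = w \<and> mm 3 = k \<and> mm 4 = kt \<and> mm 5 = reps"

lemma exc_PREB:
  assumes s: "s 0 = N" "s 1 = w" "s 2 = A" and mm: "\<And>a. mm a = 0"
  shows "exc (PREB c) s mm (\<lambda>s' m'. par s' \<and> s' 90 = 8 \<and> s' 91 = d0 \<and> s' 93 = 1 \<and> s' 37 = 1 \<and> hdr m' \<and> (\<forall>a\<ge>8. m' a = 0))"
proof -
  let ?S = "Sto (C 0) (C 1) ;; Sto (C 1) (V 3) ;; Sto (C 2) (V 4) ;; Sto (C 3) (V 5) ;; Sto (C 4) (V 23) ;; Sto (C 5) (V 7) ;;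
    Asg 90 (C 8) ;; Asg 91 (V 22) ;; Asg 93 (C 1) ;; Asg 37 (C 1)"
  let ?Q = "\<lambda>s' m'. par s' \<and> s' 90 = 8 \<and> s' 91 = d0 \<and> s' 93 = 1 \<and> s' 37 = 1 \<and> hdr m' \<and> (\<forall>a\<ge>8. m' a = 0)"
  have S: "exc ?S s' mm ?Q" if "par s'" for s'
  proof -
    have p: "par (s'(90 := 8, 91 := d0, 93 := Suc 0, 37 := Suc 0))"
      using that by (rule par_cong) simp
    show ?thesis
      using p mm by (simp add: parD[OF that] hdr_def)
  qed
  have c: "Suc c mod 2 ^ b = Suc c" "(Suc c * k) mod 2 ^ b = Suc c * k" "(Suc c * k + w) mod 2 ^ b = Suc c * k + w"
    "(3 * (Suc c * k + w)) mod 2 ^ b = reps"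
  proof -
    have "Suc c * 1 \<le> Suc c * k"
      using kt by (intro mult_le_mono2) simp
    moreover have r: "3 * (Suc c * k + w) = reps"
      using reps by simp
    moreover have "x < B" "u < B" "u + w < B" "3 * (u + w) < B" if "x * 1 \<le> u" "3 * (u + w) = reps" "reps < B" for x u B
      using that by simp_all
    ultimately have "Suc c < 2 ^ b" "Suc c * k < 2 ^ b" "Suc c * k + w < 2 ^ b" "3 * (Suc c * k + w) < 2 ^ b"
      using sizes(1) by blast+
    then show "Suc c mod 2 ^ b = Suc c" "(Suc c * k) mod 2 ^ b = Suc c * k" "(Suc c * k + w) mod 2 ^ b = Suc c * k + w"
      "(3 * (Suc c * k + w)) mod 2 ^ b = reps"
      unfolding r[symmetric] by (simp_all only: mod_less)
  qed
  have 1: "exc PRM s1 mm (\<lambda>s2 m2. exc ?S s2 m2 ?Q)"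
    if "s1 3 = N" "s1 4 = w" "s1 5 = k" "s1 23 = kt" "s1 7 = reps" for s1
    using that S by (intro exc_mono[OF exc_PRM]) auto
  have 2: "exc TLOOP s1 mm (\<lambda>s2 m2. exc (Asg 7 (Bin Mul (C 3) (Bin Add (Bin Mul (C (c + 1)) (V 5)) (V 4))) ;; PRM ;; ?S) s2 m2 ?Q)"
    if "s1 3 = N" "s1 4 = w" "s1 5 = k" "s1 23 = 0" "s1 2 = A" for s1
  proof (rule exc_mono[OF exc_TLOOP[OF that(3,5,4)]])
    fix s2 m2 assume *: "m2 = mm \<and> s2 23 = kt \<and> (\<forall>r<40. r \<noteq> 23 \<longrightarrow> s2 r = s1 r)"
    then have v: "m2 = mm" "s2 23 = kt" "s2 3 = N" "s2 4 = w" "s2 5 = k"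
      using that by auto
    have "ev b s2 mm (Bin Mul (C 3) (Bin Add (Bin Mul (C (c + 1)) (V 5)) (V 4))) = reps"
      using c by (simp add: v del: mult_Suc)
    then show "exc (Asg 7 (Bin Mul (C 3) (Bin Add (Bin Mul (C (c + 1)) (V 5)) (V 4))) ;; PRM ;; ?S) s2 m2 ?Q"
      unfolding v(1) by (rule exc_Asg_Seq) (rule 1, simp_all add: v)
  qed
  have KL: "exc KLOOP (s(3 := N, 4 := w, 5 := 0)) mm (\<lambda>s2 m2. exc (Asg 23 (C 0) ;; TLOOP ;; Asg 7 (Bin Mul (C 3) (Bin Add (Bin Mul (C (c + 1)) (V 5)) (V 4))) ;; PRM ;; ?S) s2 m2 ?Q)"
  proof (rule exc_mono[OF exc_KLOOP])
    fix s2 m2 assume *: "m2 = mm \<and> s2 5 = k \<and> (\<forall>r<40. r \<noteq> 5 \<longrightarrow> s2 r = (s(3 := N, 4 := w, 5 := 0)) r)"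
    then have v: "m2 = mm" "s2 5 = k" "s2 3 = N" "s2 4 = w" "s2 2 = A"
      using s by auto
    show "exc (Asg 23 (C 0) ;; TLOOP ;; Asg 7 (Bin Mul (C 3) (Bin Add (Bin Mul (C (c + 1)) (V 5)) (V 4))) ;; PRM ;; ?S) s2 m2 ?Q"
      unfolding v(1) by (rule exc_Asg_Seq[where v = 0], simp) (rule 2, simp_all add: v)
  qed simp_all
  show ?thesis
    unfolding PREB_def
    by (rule exc_Asg[where v = N], simp add: s, rule exc_Asg[where v = w], simp add: s[unfolded One_nat_def], rule exc_Asg_Seq[where v = 0], simp, rule KL)
qed

lemma exc_POST:
  assumes P: "par s" and s: "s 37 = 1" and hdr: "hdr mm"
    and xs: "xs \<in> W b (reps * BL)" "\<And>i. i < reps * BL \<Longrightarrow> mm (8 + i) = xs ! i" and zero: "\<And>a. d0 \<le> a \<Longrightarrow> mm a = 0"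
  shows "exc POST s mm (\<lambda>s' m'. s' 0 = tot \<and> hdr m' \<and> built xs m')"
proof -
  have rok: "rok (rbase rep) (bX xs rep) mm" if "rep < reps" for rep
    unfolding rok_def
  proof (intro allI impI)
    fix i assume i: "i < BL"
    then have le: "rep * BL + i < reps * BL"
      using mult_le_mono1[of "Suc rep" reps BL] that by simp
    then have "bX xs rep i = xs ! (rep * BL + i)"
      using i that length_W[OF xs(1)] by (simp add: bX_def nth_drop)
    then show "mm (rbase rep + i) = bX xs rep i \<and> bX xs rep i < 2 ^ b"
      using xs(2)[OF le] nth_W[OF xs(1) le] by (simp add: rbase_def add.assoc)
  qed
  have "exc BUILD s mm (\<lambda>s' m'. exc (Asg 0 (Bin Add (V 22) (Bin Mul (Bin Mul (V 20) (V 7)) (V 19)))) s' m' (\<lambda>s' m'. s' 0 = tot \<and> hdr m' \<and> built xs m'))"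
  proof (rule exc_mono[OF exc_BUILD[OF P rok zero]])
    fix s' m' assume *: "par s' \<and> built xs m' \<and> (\<forall>a<d0. m' a = mm a)"
    then have h: "hdr m'"
      using hdr by (simp add: hdr_def d0_def)
    have md: "((w + 1) * reps) mod 2 ^ b = (w + 1) * reps" "((w + 1) * reps * DB) mod 2 ^ b = (w + 1) * reps * DB"
      "(d0 + (w + 1) * reps * DB) mod 2 ^ b = tot"
      using sizes(5) DB_le(3) tot by simp_all
    have "ev b s' m' (Bin Add (V 22) (Bin Mul (Bin Mul (V 20) (V 7)) (V 19))) = tot"
      using * by (simp only: ev.simps apply_binop.simps parD md)
    then show "exc (Asg 0 (Bin Add (V 22) (Bin Mul (Bin Mul (V 20) (V 7)) (V 19)))) s' m' (\<lambda>s' m'. s' 0 = tot \<and> hdr m' \<and> built xs m')"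
      using * h by simp
  qed
  then show ?thesis
    unfolding POST_def using s by simp
qed

lemma exc_QRY:
  assumes hdr: "hdr mm" and built: "built xs mm" and good: "allgood reps xs" and y: "y < 2 ^ w"
  shows "exc QRY (\<lambda>i. if i = 0 then y else 0) mm (\<lambda>s m. pred_ans N f y s)"
proof -
  have P: "exc PRM s1 mm (\<lambda>s2 m2. exc MQ s2 m2 (\<lambda>s m. pred_ans N f y s))"
    if "s1 3 = N" "s1 4 = w" "s1 5 = k" "s1 23 = kt" "s1 7 = reps" "s1 0 = y" for s1
  proof (rule exc_mono[OF exc_PRM[OF that(1-5)]])
    fix s2 m2 assume *: "m2 = mm \<and> par s2 \<and> (\<forall>r<3. s2 r = s1 r)"
    then show "exc MQ s2 m2 (\<lambda>s m. pred_ans N f y s)"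
      unfolding pred_ans_def using exc_MQ[OF _ built good _ y] that(6) by simp
  qed
  show ?thesis
    unfolding QRY_def using hdr P by (simp add: hdr_def)
qed

end

section \<open>Success probability for large and for small instances\<close>

context env3
begin

lemma exc_PRE_big:
  assumes s0: "s0 0 = N" "s0 1 = w" "s0 2 = A" and k0: "0 < drop_bit k0 N" and n: "reps * BL = Suc n"
  shows "exc (PRE c k0) s0 (\<lambda>_. 0) (\<lambda>s m. s 90 = 8 \<and> s 91 = 8 + Suc n \<and> s 93 = 1 \<and>
      (\<forall>xs\<in>W b (Suc n). \<forall>s'. allgood reps xs \<longrightarrow> (\<forall>r<100. r \<noteq> 90 \<longrightarrow> r \<noteq> 92 \<longrightarrow> s' r = s r) \<longrightarrow>
        exc POST s' (\<lambda>c. if 8 \<le> c \<and> c < 8 + Suc n then xs ! (c - 8) else m c)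
          (\<lambda>s m. s 0 = tot \<and> hdr m \<and> (\<exists>xs. allgood reps xs \<and> built xs m))))" (is "exc _ _ _ ?Q")
proof -
  have d0: "d0 = 8 + Suc n"
    by (simp add: d0_def n)
  have B: "exc (PREB c) s1 (\<lambda>_. 0) ?Q" if s1: "s1 0 = N" "s1 1 = w" "s1 2 = A" for s1
  proof (rule exc_mono[OF exc_PREB[OF s1]])
    fix s m assume *: "par s \<and> s 90 = 8 \<and> s 91 = d0 \<and> s 93 = 1 \<and> s 37 = 1 \<and> hdr m \<and> (\<forall>a\<ge>8. m a = 0)"
    have "exc POST s' (\<lambda>c. if 8 \<le> c \<and> c < 8 + Suc n then xs ! (c - 8) else m c)
        (\<lambda>s m. s 0 = tot \<and> hdr m \<and> (\<exists>xs. allgood reps xs \<and> built xs m))"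
      if xs: "xs \<in> W b (Suc n)" "allgood reps xs" and s': "\<forall>r<100. r \<noteq> 90 \<longrightarrow> r \<noteq> 92 \<longrightarrow> s' r = s r" for xs s'
    proof (rule exc_mono[OF exc_POST])
      show "par s'"
        by (rule par_cong[of s]) (use * s' in auto)
      show "s' 37 = 1"
        using * s' by simp
      show "hdr (\<lambda>c. if 8 \<le> c \<and> c < 8 + Suc n then xs ! (c - 8) else m c)"
        using * by (simp add: hdr_def)
      show "xs \<in> W b (reps * BL)"
        unfolding n by (rule xs(1))
      show "(if 8 \<le> 8 + i \<and> 8 + i < 8 + Suc n then xs ! (8 + i - 8) else m (8 + i)) = xs ! i" if "i < reps * BL" for i
        using that unfolding n by simp
      show "(if 8 \<le> a \<and> a < 8 + Suc n then xs ! (a - 8) else m a) = 0" if "d0 \<le> a" for a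
        using that * unfolding d0 by simp
    qed (use xs in blast)
    then show "?Q s m"
      using * d0 by simp
  qed simp
  have "exc (SHR k0) (s0(40 := N)) (\<lambda>_. 0) (\<lambda>s m. exc (If (C 0) (V 40) (PREB c) PRES) s m ?Q)"
  proof (rule exc_SHR)
    fix s' assume s': "s' 40 = drop_bit k0 ((s0(40 := N)) 40)" "\<And>r. r \<noteq> 40 \<Longrightarrow> s' r = (s0(40 := N)) r"
    have "exc (PREB c) s' (\<lambda>_. 0) ?Q"
      by (rule B) (use s' s0 in simp_all)
    then show "exc (If (C 0) (V 40) (PREB c) PRES) s' (\<lambda>_. 0) ?Q"
      unfolding exc.simps(6) ev.simps using s'(1) k0 by (simp only: mod_0 fun_upd_same if_True)
  qed
  then show ?thesis
    unfolding PRE_def exc.simps(2,5) ev.simps s0(1) .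
qed

text \<open>The single event \<open>allgood\<close> makes the queries for all \<open>y\<close>
  correct at once, so its probability bounds that of success.\<close>

lemma success_big:
  assumes F: "sub = as_sub b F" and \<kappa>: "0 < \<kappa>" "\<kappa> \<le> real c" and A: "A = nat \<lceil>real N powr \<alpha>\<rceil>" and k0: "0 < drop_bit k0 N"
    and T: "tb \<tau> lm (PRE c k0) + 4 * (reps * BL) + tb \<tau> lm POST \<le> tc" and S: "tot \<le> sp" and tq: "tb \<tau> lm QRY \<le> tq"
  shows "1 - 1 / real N powr \<kappa> \<le> success_prob b F (BLD c k0) (comp 0 QRY) \<alpha> N w f tc sp tq"
proof -
  let ?s0 = "\<lambda>i. if i < length (construction_input N w \<alpha>) then construction_input N w \<alpha> ! i else 0"
  let ?Post = "\<lambda>s m. s 0 = tot \<and> hdr m \<and> (\<exists>xs. allgood reps xs \<and> built xs m)"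
  have s0: "?s0 0 = N" "?s0 1 = w" "?s0 2 = A"
    by (simp_all add: construction_input_def A)
  have "0 < reps * BL"
    using reps1(1) bounds(7) BL_eq by simp
  then obtain n where n: "reps * BL = Suc n"
    using gr0_implies_Suc by blast
  have d0: "d0 = 8 + Suc n"
    by (simp add: d0_def n)
  note e1 = exc_PRE_big[where ?s0.0 = ?s0, OF s0 k0 n]
  have "1 - 1 / real N powr \<kappa> \<le> avg (W b (Suc n)) (\<lambda>xs. of_bool (allgood reps xs))"
    using allgood_high_prob[OF \<kappa>] unfolding reps[symmetric] n .
  also have "\<dots> \<le> measure_pmf.prob (rand_run b sub (BLD c k0) tc \<lparr>pc = 0, reg = ?s0, mem = \<lambda>_. 0, clock = 0\<rparr>)
      {c'. halted (BLD c k0) c' \<and> clock c' \<le> tc \<and> (\<exists>s. agree s (reg c') \<and> ?Post s (mem c'))}"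
    by (rule build_prob[where G = "allgood reps" and Post = ?Post and a = 8 and n = n and ?m0.0 = "\<lambda>_. 0" and ?s0.0 = ?s0,
          OF e1 _ wfc_PRE wfc_POST BLD_def]) (use T n d0 sizes(4) in simp_all)
  also have "\<dots> \<le> success_prob b F (BLD c k0) (comp 0 QRY) \<alpha> N w f tc sp tq"
  proof -
    have i: "init (construction_input N w \<alpha>) [] = \<lparr>pc = 0, reg = ?s0, mem = \<lambda>_. 0, clock = 0\<rparr>"
      by (simp add: init_def)
    have sub: "answers_pred_within b F (comp 0 QRY) (output_words c') N f tq y \<and> length (output_words c') \<le> sp"
      if ag: "agree s (reg c')" and post: "s 0 = tot" "hdr (mem c')" "allgood reps xs" "built xs (mem c')" and y: "y < 2 ^ w" for c' s xs y
    proof -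
      have o: "output_words c' = map (mem c') [0..<tot]"
        using ag post(1) by (simp add: output_words_def agree_def)
      let ?m = "\<lambda>a. if a < length (output_words c') then output_words c' ! a else 0"
      have m: "?m a = mem c' a" if "a < tot" for a
        using that by (simp add: o)
      have "8 \<le> tot"
        by (simp add: tot_def d0_def)
      then have mm: "?m 0 = mem c' 0" "?m 1 = mem c' 1" "?m 2 = mem c' 2" "?m 3 = mem c' 3" "?m 4 = mem c' 4" "?m 5 = mem c' 5"
        by (intro m; linarith)+
      have "hdr ?m"
        using post(2) unfolding hdr_def mm .
      moreover have "built xs ?m"
        using post(4) m by (rule built_cong)
      ultimately have "exc QRY (\<lambda>i. if i = 0 then y else 0) ?m (\<lambda>s m. pred_ans N f y s)"
        using exc_QRY post(3) y by blast
      from query_answers[OF this wfc_QRY tq F] show ?thesis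
        using S by (simp add: o)
    qed
    show ?thesis
      unfolding success_prob_def i F[symmetric] by (intro measure_pmf.finite_measure_mono) (use sub sub[of _ _ _ 0] in \<open>auto 0 3\<close>)
  qed
  finally show ?thesis .
qed

end

context ram
begin

lemma success_small:
  assumes F: "sub = as_sub b F" and N: "2 \<le> N" "N < 2 ^ b" "N \<le> lm 5" and k0: "drop_bit k0 N = 0"
    and T: "tb \<tau> lm (PRE c k0) + 4 + tb \<tau> lm POST \<le> tc" and S: "2 \<le> sp" and tq: "tb \<tau> lm QRY \<le> tq"
  shows "1 \<le> success_prob b F (BLD c k0) (comp 0 QRY) \<alpha> N w f tc sp tq"
proof -
  \<comment> \<open>\<open>2 \<le> N\<close> and \<open>N < 2 ^ b\<close> force at least two bits,
    so the constants 2 and 3 are words.\<close>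
  have "(2::nat) ^ 1 < 2 ^ b"
    using N by simp
  then have "1 < b"
    by (simp only: power_strict_increasing_iff[of "2::nat"])
  then have "(2::nat) ^ 2 \<le> 2 ^ b"
    by (intro power_increasing) auto
  then have b4: "4 \<le> (2::nat) ^ b"
    by simp
  then have cs: "2 mod 2 ^ b = (2::nat)" "3 mod 2 ^ b = (3::nat)"
    by simp_all
  have one: "1 mod 2 ^ b = (1::nat)" "0 mod 2 ^ b = (0::nat)"
    using b4 b_gt_0 by simp_all
  let ?s0 = "\<lambda>i. if i < length (construction_input N w \<alpha>) then construction_input N w \<alpha> ! i else 0"
  let ?Post = "\<lambda>s m. s 0 = 2 \<and> m 0 = 0 \<and> m 1 = N"
  have s0: "?s0 0 = N"
    by (simp add: construction_input_def)
  have post: "exc POST s' m ?Post" if "s' 37 = 0" "s' 0 = N" for s' m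
    unfolding POST_def using that by (simp add: cs b_gt_0)
  have e1: "exc (PRE c k0) ?s0 (\<lambda>_. 0) (\<lambda>s m. s 90 = 2 \<and> s 91 = 2 + Suc 0 \<and> s 93 = 1 \<and>
      (\<forall>xs\<in>W b (Suc 0). \<forall>s'. True \<longrightarrow> (\<forall>r<100. r \<noteq> 90 \<longrightarrow> r \<noteq> 92 \<longrightarrow> s' r = s r) \<longrightarrow>
        exc POST s' (\<lambda>c. if 2 \<le> c \<and> c < 2 + Suc 0 then xs ! (c - 2) else m c) ?Post))" (is "exc _ _ _ ?Q")
  proof -
    have "exc PRES s1 (\<lambda>_. 0) ?Q" if "s1 0 = N" for s1
    proof -
      let ?s2 = "s1(90 := 2, 91 := 3, 93 := 1, 37 := 0)"
      have "exc POST s' m ?Post" if "\<forall>r<100. r \<noteq> 90 \<longrightarrow> r \<noteq> 92 \<longrightarrow> s' r = ?s2 r" for s' m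
        using that \<open>s1 0 = N\<close> by (intro post) simp_all
      then have "?Q ?s2 (\<lambda>_. 0)"
        by simp
      moreover have "exc PRES s1 (\<lambda>_. 0) ?Q = ?Q ?s2 (\<lambda>_. 0)"
        unfolding PRES_def exc.simps(2,5) ev.simps by (simp only: cs one)
      ultimately show ?thesis
        by simp
    qed
    then show ?thesis
      unfolding PRE_def exc.simps(5) using s0 k0 by (simp del: exc.simps(6)) (rule exc_SHR, simp)
  qed
  have "1 = avg (W b (Suc 0)) (\<lambda>xs. of_bool True)"
    by (simp add: avg_const)
  also have "\<dots> \<le> measure_pmf.prob (rand_run b sub (BLD c k0) tc \<lparr>pc = 0, reg = ?s0, mem = \<lambda>_. 0, clock = 0\<rparr>)
      {c'. halted (BLD c k0) c' \<and> clock c' \<le> tc \<and> (\<exists>s. agree s (reg c') \<and> ?Post s (mem c'))}"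
    by (rule build_prob[where G = "\<lambda>_. True" and Post = ?Post and a = 2 and n = 0 and ?m0.0 = "\<lambda>_. 0" and ?s0.0 = ?s0,
          OF e1 _ wfc_PRE wfc_POST BLD_def]) (use T b4 in simp_all)
  also have "\<dots> \<le> success_prob b F (BLD c k0) (comp 0 QRY) \<alpha> N w f tc sp tq"
  proof -
    have i: "init (construction_input N w \<alpha>) [] = \<lparr>pc = 0, reg = ?s0, mem = \<lambda>_. 0, clock = 0\<rparr>"
      by (simp add: init_def)
    have sub: "answers_pred_within b F (comp 0 QRY) (output_words c') N f tq y \<and> length (output_words c') \<le> sp"
      if ag: "agree s (reg c')" and post: "s 0 = 2" "mem c' 0 = 0" "mem c' 1 = N" for c' s y
    proof -
      have o: "output_words c' = map (mem c') [0..<2]"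
        using ag post(1) by (simp add: output_words_def agree_def)
      let ?m = "\<lambda>a. if a < length (output_words c') then output_words c' ! a else 0"
      have m: "?m 0 = 0" "?m 1 = N"
        using post by (simp_all add: o)
      have "exc QS (\<lambda>i. if i = 0 then y else 0) ?m (\<lambda>s m. pred_ans N f y s)"
        by (rule exc_QS) (use N m in simp_all)
      then have "exc QRY (\<lambda>i. if i = 0 then y else 0) ?m (\<lambda>s m. pred_ans N f y s)"
        unfolding QRY_def exc.simps(6) ev.simps using m(1) by (simp only: mod_0 less_irrefl if_False)
      from query_answers[OF this wfc_QRY tq F] show ?thesis
        using S by (simp add: o)
    qed
    show ?thesis
      unfolding success_prob_def i F[symmetric] by (intro measure_pmf.finite_measure_mono) (use sub in \<open>auto 0 3\<close>)
  qed
  finally show ?thesis .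
qed

end

section \<open>Soft-O bounds\<close>

definition so :: "real \<Rightarrow> (nat \<Rightarrow> nat) \<Rightarrow> bool" where
  "so x f \<longleftrightarrow> (\<lambda>N. real (f N)) \<in> soft_O (\<lambda>N. real N powr x)"

lemma so_iff: "so x f \<longleftrightarrow> (\<exists>k. (\<lambda>N. real (f N)) \<in> O(\<lambda>N. real N powr x * ln (real N) ^ k))"
  by (simp add: so_def soft_O_def)

lemma ln_ge_1: "eventually (\<lambda>N::nat. 1 \<le> ln (real N)) at_top"
  by real_asymp

lemma so_exp: "so x f \<Longrightarrow> x \<le> y \<Longrightarrow> so y f"
proof -
  assume "so x f" "x \<le> y"
  have "(\<lambda>N. real N powr x) \<in> O(\<lambda>N. real N powr y)"
  proof (rule bigoI[where c = 1])
    show "eventually (\<lambda>N. norm (real N powr x) \<le> 1 * norm (real N powr y)) at_top"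
      using eventually_ge_at_top[of 1] by eventually_elim (use \<open>x \<le> y\<close> in \<open>simp add: powr_mono\<close>)
  qed
  from landau_o.big.mult[OF this landau_o.big_refl] show ?thesis
    using \<open>so x f\<close> unfolding so_iff by (meson landau_o.big_trans)
qed

lemma so_log: "(\<lambda>N. real (f N)) \<in> O(\<lambda>N. real N powr x * ln (real N) ^ j) \<Longrightarrow> j \<le> k \<Longrightarrow>
   (\<lambda>N. real (f N)) \<in> O(\<lambda>N. real N powr x * ln (real N) ^ k)"
proof -
  assume f: "(\<lambda>N. real (f N)) \<in> O(\<lambda>N. real N powr x * ln (real N) ^ j)" and "j \<le> k"
  have "(\<lambda>N. ln (real N) ^ j) \<in> O(\<lambda>N. ln (real N) ^ k)"
  proof (rule bigoI[where c = 1])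
    show "eventually (\<lambda>N. norm (ln (real N) ^ j) \<le> 1 * norm (ln (real N) ^ k)) at_top"
      using ln_ge_1 by eventually_elim (use \<open>j \<le> k\<close> in \<open>simp add: power_increasing\<close>)
  qed
  from landau_o.big.mult[OF landau_o.big_refl this] show ?thesis
    using f by (meson landau_o.big_trans)
qed

lemma so_add: "so x f \<Longrightarrow> so x g \<Longrightarrow> so x (\<lambda>N. f N + g N)"
proof -
  assume "so x f" "so x g"
  then obtain j k where "(\<lambda>N. real (f N)) \<in> O(\<lambda>N. real N powr x * ln (real N) ^ j)" "(\<lambda>N. real (g N)) \<in> O(\<lambda>N. real N powr x * ln (real N) ^ k)"
    by (auto simp: so_iff)
  then have "(\<lambda>N. real (f N)) \<in> O(\<lambda>N. real N powr x * ln (real N) ^ (j + k))" "(\<lambda>N. real (g N)) \<in> O(\<lambda>N. real N powr x * ln (real N) ^ (j + k))"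
    by (auto intro: so_log)
  from sum_in_bigo(1)[OF this] show ?thesis
    by (auto simp: so_iff)
qed

lemma so_mult: "so x f \<Longrightarrow> so y g \<Longrightarrow> so (x + y) (\<lambda>N. f N * g N)"
proof -
  assume "so x f" "so y g"
  then obtain j k where "(\<lambda>N. real (f N)) \<in> O(\<lambda>N. real N powr x * ln (real N) ^ j)" "(\<lambda>N. real (g N)) \<in> O(\<lambda>N. real N powr y * ln (real N) ^ k)"
    by (auto simp: so_iff)
  from landau_o.big.mult[OF this] have "(\<lambda>N. real (f N * g N)) \<in> O(\<lambda>N. real N powr (x + y) * ln (real N) ^ (j + k))"
    by (simp add: powr_add power_add mult.assoc mult.left_commute)
  then show ?thesis
    by (auto simp: so_iff)
qed

lemma so_le_real:
  assumes "eventually (\<lambda>N. real (f N) \<le> c * (real N powr x * ln (real N) ^ k)) at_top"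
  shows "so x f"
  unfolding so_iff
proof (intro exI bigoI[where c = c])
  show "eventually (\<lambda>N. norm (real (f N)) \<le> c * norm (real N powr x * ln (real N) ^ k)) at_top"
    using assms ln_ge_1 by eventually_elim simp
qed

lemma so_mono: "so x g \<Longrightarrow> eventually (\<lambda>N. f N \<le> g N) at_top \<Longrightarrow> so x f"
proof -
  assume "so x g" and le: "eventually (\<lambda>N. f N \<le> g N) at_top"
  have "(\<lambda>N. real (f N)) \<in> O(\<lambda>N. real (g N))"
    by (rule bigoI[where c = 1]) (use le in \<open>auto elim: eventually_mono\<close>)
  then show ?thesis
    using \<open>so x g\<close> unfolding so_iff by (meson landau_o.big_trans)
qed

lemma so_const: "0 \<le> x \<Longrightarrow> so x (\<lambda>N. c)"
proof (rule so_exp[of 0])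
  show "so 0 (\<lambda>N. c)"
    by (rule so_le_real[where c = c and k = 0], rule eventually_mono[OF eventually_gt_at_top[of 0]]) simp
qed

lemma so_polylog: "(\<lambda>N. real (f N)) \<in> soft_O (\<lambda>_. 1) \<Longrightarrow> so 0 f"
proof -
  assume "(\<lambda>N. real (f N)) \<in> soft_O (\<lambda>_. 1)"
  then obtain k where k: "(\<lambda>N. real (f N)) \<in> O(\<lambda>N. ln (real N) ^ k)"
    by (auto simp: soft_O_def)
  have "(\<lambda>N. ln (real N) ^ k) \<in> O(\<lambda>N. real N powr 0 * ln (real N) ^ k)"
    by (rule bigoI[where c = 1], rule eventually_mono[OF eventually_gt_at_top[of 0]]) simp
  with k show ?thesis
    unfolding so_iff by (meson landau_o.big_trans)
qed

text \<open>Shows later that the size of the structure is representable: it is sublinear, and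
  \<open>N\<close> is below \<open>2 ^ b\<close>.\<close>

lemma so_less_linear:
  assumes "so x f" "x < 1"
  shows "eventually (\<lambda>N. f N \<le> N) at_top"
proof -
  obtain k where k: "(\<lambda>N. real (f N)) \<in> O(\<lambda>N. real N powr x * ln (real N) ^ k)"
    using assms by (auto simp: so_iff)
  have "(\<lambda>N. real N powr x * ln (real N) ^ k) \<in> o(\<lambda>N. real N)"
    using assms(2) by real_asymp
  then have "(\<lambda>N. real (f N)) \<in> o(\<lambda>N. real N)"
    using k by (meson landau_o.big_small_trans)
  from landau_o.smallD[OF this, of 1] show ?thesis
    by simp
qed

text \<open>The running time of a program is of order at most \<open>N powr x\<close> if the loop limits are of order
  \<open>N powr E L\<close>.\<close>

fun degle :: "(nat \<Rightarrow> real) \<Rightarrow> cmd \<Rightarrow> real \<Rightarrow> bool" where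
  "degle E (Seq c d) x \<longleftrightarrow> degle E c x \<and> degle E d x"
| "degle E (If _ _ c d) x \<longleftrightarrow> degle E c x \<and> degle E d x"
| "degle E (For i n L c) x \<longleftrightarrow> 0 \<le> x - E L \<and> degle E c (x - E L)"
| "degle E _ x \<longleftrightarrow> 0 \<le> x"

lemma degle_nonneg: "degle E c x \<Longrightarrow> (\<And>L. 0 \<le> E L) \<Longrightarrow> 0 \<le> x"
proof (induction c arbitrary: x)
  case (For i n L c)
  then show ?case
    by (metis add.commute add_nonneg_nonneg degle.simps(3) diff_add_cancel)
qed auto

lemma so_tb:
  assumes "so 0 \<tau>" "\<And>L. so (E L) (\<lambda>N. lm N L)" "\<And>L. 0 \<le> E L" "degle E c x"
  shows "so x (\<lambda>N. tb (\<tau> N) (lm N) c)"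
  using assms(4)
proof (induction c arbitrary: x)
  case (For i n L c)
  then have "so (x - E L) (\<lambda>N. tb (\<tau> N) (lm N) c + 3)"
    by (intro so_add so_const) auto
  from so_mult[OF assms(2) this, of L] have "so x (\<lambda>N. lm N L * (tb (\<tau> N) (lm N) c + 3))"
    by simp
  moreover have "0 \<le> x"
    using For.prems assms(3)[of L] by simp
  ultimately show ?case
    unfolding tb.simps by (intro so_add so_const)
next
  case (Cal r y)
  then show ?case
    unfolding tb.simps by (intro so_add so_const so_exp[OF assms(1)]) auto
next
  case (If y z c d)
  then show ?case
    using degle_nonneg[of E c x, OF _ assms(3)] unfolding tb.simps by (intro so_add so_const) auto
qed (auto intro!: so_add so_const)

section \<open>Choice of the parameters\<close>

text \<open>A halted configuration is a fixed point of \<open>step\<close>, so a run is constant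
  from its first halt on. This gives \<open>THE\<close> in \<open>as_sub\<close> its
  meaning.\<close>

lemma halts_in_unique:
  assumes "halts_in b sub p c c1" "halts_in b sub p c c2"
  shows "c1 = c2"
proof -
  have stop: "(step b sub p 0 ^^ d) c' = c'" if "halted p c'" for c' d
    by (induction d) (use that in \<open>auto simp: step_def\<close>)
  have main: "(step b sub p 0 ^^ n) c = (step b sub p 0 ^^ n') c" if "n \<le> n'" "halted p ((step b sub p 0 ^^ n) c)" for n n'
  proof -
    have "(step b sub p 0 ^^ n') c = (step b sub p 0 ^^ (n' - n)) ((step b sub p 0 ^^ n) c)"
      using that(1) funpow_add[of "n' - n" n "step b sub p 0"] by simp
    then show ?thesis
      using stop[OF that(2)] by simp
  qed
  show ?thesis
    using assms main unfolding halts_in_def by (metis nle_le)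
qed

lemma as_sub_computes:
  assumes "computes_within b F N f T" "x < N"
  shows "\<exists>t\<le>T. as_sub b F x = Some (f x, t)"
proof -
  obtain c where c: "halts_in b no_sub F (init [x] []) c" "reg c 0 = f x" "clock c \<le> T"
    using assms by (auto simp: computes_within_def)
  then have "(THE c. halts_in b no_sub F (init [x] []) c) = c"
    by (blast intro: the_equality halts_in_unique)
  then have "as_sub b F x = Some (f x, clock c)"
    using c by (auto simp: as_sub_def Let_def)
  then show ?thesis
    using c(3) by blast
qed

locale asym =
  fixes w b \<tau> :: "nat \<Rightarrow> nat" and \<alpha> \<kappa> :: real
  assumes w: "so 0 w" and \<tau>: "so 0 \<tau>"
    and wl: "\<And>n. n \<ge> 1 \<Longrightarrow> n < 2 ^ b n \<and> w n \<le> b n"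
    and \<alpha>: "0 < \<alpha>" "\<alpha> < 1" and \<kappa>: "0 < \<kappa>"
begin

definition "Af n = nat \<lceil>real n powr \<alpha>\<rceil>"
definition kf :: "nat \<Rightarrow> nat" where "kf n = (SOME k. 2 ^ (k - 1) \<le> n \<and> n < 2 ^ k)"
definition ktf :: "nat \<Rightarrow> nat" where "ktf n = (SOME j. 8 ^ j \<le> Af n \<and> Af n < 8 ^ Suc j)"
definition "cf = nat \<lceil>\<kappa>\<rceil>"
definition "repsf n = 3 * ((cf + 1) * kf n + w n)"
definition "Mf n = (2::nat) ^ (kf n - ktf n + 9)"
definition "mf n = (2::nat) ^ (kf n - 3 * ktf n)"
definition "qf n = 2 * ktf n"
definition "lEf n = (2::nat) ^ qf n * 2 ^ (kf n - 3 * ktf n + 3)"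
definition "BLf n = w n + kf n + 2 + Mf n + qf n * (Mf n + mf n) + (Mf n + mf n)"
definition "DBf n = Mf n + (lEf n + lEf n)"
definition "totf n = 8 + repsf n * BLf n + (w n + 1) * repsf n * DBf n"

lemma kf: "1 \<le> n \<Longrightarrow> 2 ^ (kf n - 1) \<le> n \<and> n < 2 ^ kf n"
  unfolding kf_def
proof (rule someI_ex)
  assume "1 \<le> n"
  then obtain d where "2 ^ d \<le> n" "n < 2 ^ (d + 1)"
    using ex_power_ivl1[of 2 n] by auto
  then show "\<exists>k. 2 ^ (k - 1) \<le> n \<and> n < 2 ^ k"
    by (intro exI[of _ "d + 1"]) simp
qed

lemma Af: "1 \<le> n \<Longrightarrow> real n powr \<alpha> \<le> real (Af n)" "1 \<le> n \<Longrightarrow> real (Af n) \<le> real n powr \<alpha> + 1" "1 \<le> n \<Longrightarrow> 1 \<le> Af n"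
proof -
  assume n: "1 \<le> n"
  then have 1: "1 \<le> real n powr \<alpha>"
    using \<alpha> by (simp add: ge_one_powr_ge_zero)
  then show a: "real n powr \<alpha> \<le> real (Af n)"
    unfolding Af_def by linarith
  show "real (Af n) \<le> real n powr \<alpha> + 1"
    using 1 unfolding Af_def by linarith
  have "1 \<le> real (Af n)"
    using 1 a by linarith
  then show "1 \<le> Af n"
    by simp
qed

lemma ktf: "1 \<le> n \<Longrightarrow> 8 ^ ktf n \<le> Af n \<and> Af n < 8 ^ Suc (ktf n)"
  unfolding ktf_def
proof (rule someI_ex)
  assume "1 \<le> n"
  then show "\<exists>j. 8 ^ j \<le> Af n \<and> Af n < 8 ^ Suc j"
    using ex_power_ivl1[of 8 "Af n"] Af(3) by auto
qed

lemma power3_le_imp_le: "x ^ 3 \<le> y ^ 3 \<Longrightarrow> 0 \<le> y \<Longrightarrow> x \<le> (y :: real)"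
  using power_le_imp_le_base[of x 2 y] by (simp add: numeral_3_eq_3 numeral_2_eq_2)

lemma powr_cube: "1 \<le> n \<Longrightarrow> (real n powr (\<alpha> / 3)) ^ 3 = real n powr \<alpha>"
  by (simp add: powr_power)

text \<open>Cubes are compared: \<open>Af n\<close> lies between \<open>8 ^ ktf n\<close> and 8
  times that, and rounding up costs at most a factor 2 because \<open>n powr \<alpha>\<close> is at
  least 1.\<close>

lemma t_bounds:
  assumes "1 \<le> n"
  shows "real (2 ^ ktf n) \<le> 2 * real n powr (\<alpha> / 3)" "real n powr (\<alpha> / 3) \<le> 2 * real (2 ^ ktf n)"
proof -
  have cube: "real (2 ^ ktf n) ^ 3 = real (8 ^ ktf n)"
    by (simp add: power_mult[symmetric] mult.commute[of _ 3]) (simp add: power_mult)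
  have 1: "1 \<le> real n powr \<alpha>"
    using assms \<alpha> by (simp add: ge_one_powr_ge_zero)
  have "real (8 ^ ktf n) \<le> real (Af n)"
    using ktf[OF assms] by (simp only: of_nat_le_iff)
  also have "\<dots> \<le> 8 * real n powr \<alpha>"
    using Af(2)[OF assms] 1 by linarith
  finally have "real (2 ^ ktf n) ^ 3 \<le> (2 * real n powr (\<alpha> / 3)) ^ 3"
    unfolding cube power_mult_distrib powr_cube[OF assms] by simp
  then show "real (2 ^ ktf n) \<le> 2 * real n powr (\<alpha> / 3)"
    by (rule power3_le_imp_le) simp
  have "real (Af n) < real (8 ^ Suc (ktf n))"
    using ktf[OF assms] by (simp only: of_nat_less_iff)
  then have "real n powr \<alpha> \<le> 8 * real (8 ^ ktf n)"
    using Af(1)[OF assms] by simp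
  then have "(real n powr (\<alpha> / 3)) ^ 3 \<le> (2 * real (2 ^ ktf n)) ^ 3"
    unfolding powr_cube[OF assms] power_mult_distrib cube by simp
  then show "real n powr (\<alpha> / 3) \<le> 2 * real (2 ^ ktf n)"
    by (rule power3_le_imp_le) simp
qed

lemma kt_le_k: "1 \<le> n \<Longrightarrow> ktf n \<le> kf n"
proof -
  assume n: "1 \<le> n"
  have "real n powr \<alpha> \<le> real n"
    using n \<alpha> powr_mono[of \<alpha> 1 "real n"] by simp
  then have "Af n \<le> n"
    unfolding Af_def by linarith
  have "(2::nat) ^ ktf n \<le> 8 ^ ktf n"
    by (rule power_mono) auto
  also have "\<dots> < 2 ^ kf n"
    using ktf[OF n] kf[OF n] \<open>Af n \<le> n\<close> by linarith
  finally show "ktf n \<le> kf n"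
    by simp
qed

lemma k2n: "1 \<le> n \<Longrightarrow> real (2 ^ kf n) \<le> 2 * real n"
proof -
  assume n: "1 \<le> n"
  have "kf n \<noteq> 0"
    using kf[OF n] n by (intro notI) simp
  then have "(2::nat) ^ kf n = 2 * 2 ^ (kf n - 1)"
    by (metis Suc_diff_1 neq0_conv power_Suc)
  then have "2 ^ kf n \<le> 2 * n"
    using kf[OF n] by simp
  then show "real (2 ^ kf n) \<le> 2 * real n"
    by (metis of_nat_le_iff of_nat_mult of_nat_numeral)
qed

lemma so_k: "so 0 kf"
proof (rule so_le_real[where c = 4 and k = 1])
  have "eventually (\<lambda>n::nat. 1 \<le> n) at_top"
    by (rule eventually_ge_at_top)
  then show "eventually (\<lambda>n. real (kf n) \<le> 4 * (real n powr 0 * ln (real n) ^ 1)) at_top"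
    using ln_ge_1
  proof eventually_elim
    case (elim n)
    have "ln (real (2 ^ kf n)) \<le> ln (2 * real n)"
      using k2n[OF elim(1)] elim(1) by (subst ln_le_cancel_iff) auto
    then have "real (kf n) * ln 2 \<le> ln 2 + ln (real n)"
      using elim(1) by (simp add: ln_mult ln_realpow)
    moreover have "real (kf n) * (1 / 2) \<le> real (kf n) * ln 2"
      using ln2_ge_two_thirds by (intro mult_left_mono) auto
    moreover have "ln 2 \<le> (1::real)"
      using ln_2_less_1 by simp
    ultimately show ?case
      using elim by simp
  qed
qed

section \<open>Growth of the block parameters\<close>

lemma so_t: "so (\<alpha> / 3) (\<lambda>n. 2 ^ ktf n)"
  by (rule so_le_real[where c = 2 and k = 0], rule eventually_mono[OF eventually_ge_at_top[of 1]]) (use t_bounds(1) in simp)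

lemma so_kt: "so 0 ktf"
  by (rule so_mono[OF so_k], rule eventually_mono[OF eventually_ge_at_top[of 1]]) (rule kt_le_k)

text \<open>\<open>Mf n\<close> times \<open>2 ^ ktf n\<close> is \<open>512 * 2 ^ kf n\<close>, at
  most \<open>1024 * n\<close>, and \<open>2 ^ ktf n\<close> is at least half of
  \<open>n powr (\<alpha> / 3)\<close>.\<close>

lemma so_M: "so (1 - \<alpha> / 3) Mf"
proof (rule so_le_real[where c = 2048 and k = 0], rule eventually_mono[OF eventually_ge_at_top[of 1]])
  fix n :: nat assume n: "1 \<le> n"
  let ?x = "real n powr (\<alpha> / 3)"
  have "Mf n * 2 ^ ktf n = 512 * 2 ^ kf n"
    using kt_le_k[OF n] by (simp add: Mf_def power_add[symmetric]) (simp add: power_add)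
  then have "real (Mf n) * real (2 ^ ktf n) = 512 * real (2 ^ kf n)"
    by (metis of_nat_mult of_nat_numeral)
  also have "\<dots> \<le> 1024 * real n"
    using k2n[OF n] by simp
  finally have "real (Mf n) * (2 * real (2 ^ ktf n)) \<le> 2048 * real n"
    by simp
  moreover have "real (Mf n) * ?x \<le> real (Mf n) * (2 * real (2 ^ ktf n))"
    using t_bounds(2)[OF n] by (intro mult_left_mono) auto
  ultimately have "real (Mf n) * ?x \<le> 2048 * real n"
    by linarith
  moreover have "0 < ?x"
    using n by simp
  ultimately have "real (Mf n) \<le> 2048 * real n / ?x"
    by (simp add: field_simps)
  also have "\<dots> = 2048 * real n powr (1 - \<alpha> / 3)"
    using n by (simp add: powr_diff)
  finally show "real (Mf n) \<le> 2048 * (real n powr (1 - \<alpha> / 3) * ln (real n) ^ 0)"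
    by simp
qed

lemma large_t: "eventually (\<lambda>n. 9 \<le> ktf n) at_top"
proof -
  have "eventually (\<lambda>n::nat. 8 ^ 9 \<le> real n powr \<alpha>) at_top"
    using \<alpha> by real_asymp
  then show ?thesis
    using eventually_ge_at_top[of 1]
  proof eventually_elim
    case (elim n)
    have "(8::real) ^ 9 \<le> real (Af n)"
      using elim(1) Af(1)[OF elim(2)] by linarith
    then have "8 ^ 9 \<le> Af n"
      by (metis of_nat_le_iff of_nat_numeral of_nat_power)
    then have "(8::nat) ^ 9 < 8 ^ Suc (ktf n)"
      using ktf[OF elim(2)] by linarith
    then have "9 < Suc (ktf n)"
      by (rule power_less_imp_less_exp[rotated]) simp
    then show ?case by simp
  qed
qed

text \<open>Rests on \<open>\<alpha> < 1\<close>: \<open>Af n\<close>, and with it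
  \<open>8 ^ ktf n\<close>, eventually drops below half of \<open>n\<close>.\<close>

lemma large_k: "eventually (\<lambda>n. 3 * ktf n + 1 \<le> kf n) at_top"
proof -
  have "eventually (\<lambda>n::nat. 2 * (real n powr \<alpha> + 1) \<le> real n) at_top"
    using \<alpha> by real_asymp
  then show ?thesis
    using eventually_ge_at_top[of 1]
  proof eventually_elim
    case (elim n)
    have "real (2 * Af n) \<le> real n"
      using elim(1) Af(2)[OF elim(2)] by simp
    then have "2 * Af n \<le> n"
      by linarith
    then have "2 * (8::nat) ^ ktf n < 2 ^ kf n"
      using ktf[OF elim(2)] kf[OF elim(2)] by linarith
    moreover have "2 * (8::nat) ^ ktf n = 2 ^ (3 * ktf n + 1)"
      by (simp add: power_mult)
    ultimately have "(2::nat) ^ (3 * ktf n + 1) < 2 ^ kf n"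
      by simp
    then have "3 * ktf n + 1 < kf n"
      by (rule power_less_imp_less_exp[rotated]) simp
    then show ?case by simp
  qed
qed

lemma so_m: "so (1 - \<alpha> / 3) mf"
  by (rule so_mono[OF so_M], rule eventuallyI) (auto simp: mf_def Mf_def intro!: power_increasing)

lemma so_lm: "so (1 - \<alpha> / 3) (\<lambda>n. 2 ^ qf n * mf n)"
  by (rule so_mono[OF so_M], rule eventually_mono[OF large_k]) (auto simp: mf_def Mf_def qf_def power_add[symmetric] intro!: power_increasing)

lemma so_lE: "so (1 - \<alpha> / 3) lEf"
  by (rule so_mono[OF so_M], rule eventually_mono[OF large_k]) (auto simp: lEf_def Mf_def qf_def power_add[symmetric] simp del: power_add_numeral intro!: power_increasing)

lemma so_0: "so 0 f \<Longrightarrow> so (1 - \<alpha> / 3) f"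
  using \<alpha> by (auto intro: so_exp)

lemma so_0_mult: "so 0 f \<Longrightarrow> so x g \<Longrightarrow> so x (\<lambda>n. f n * g n)"
  using so_mult[of 0 f x g] by simp

lemma so_q: "so 0 qf"
  unfolding qf_def by (intro so_0_mult so_const so_kt) simp

lemma so_reps: "so 0 repsf"
  unfolding repsf_def by (intro so_0_mult so_add so_const so_k w) simp_all

lemma so_BL: "so (1 - \<alpha> / 3) BLf"
  unfolding BLf_def using \<alpha> by (intro so_add so_0_mult so_q so_M so_m so_0[OF w] so_0[OF so_k] so_const) simp

lemma so_tot: "so (1 - \<alpha> / 3) totf"
  unfolding totf_def DBf_def using \<alpha>
  by (intro so_add so_0_mult so_reps so_BL so_M so_lE so_const w order_refl) simp_all

section \<open>Threshold for brute force and limits of the loops\<close>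

definition "big n \<longleftrightarrow> 9 \<le> ktf n \<and> 3 * ktf n + 1 \<le> kf n \<and> totf n < 2 ^ b n"

lemma ex_k0: "\<exists>k0. \<forall>n. 0 < drop_bit k0 n \<longrightarrow> big n"
proof -
  have "eventually (\<lambda>n. totf n \<le> n) at_top"
    using so_less_linear[OF so_tot] \<alpha> by simp
  then have "eventually big at_top"
    using large_t large_k eventually_ge_at_top[of 1]
  proof eventually_elim
    case (elim n)
    then show ?case
      using wl[of n] by (simp add: big_def)
  qed
  then obtain N0 where N0: "\<And>n. n \<ge> N0 \<Longrightarrow> big n"
    by (auto simp: eventually_at_top_linorder)
  \<comment> \<open>\<open>N0\<close> itself serves as the number of shifts, since
    \<open>2 ^ N0\<close> exceeds \<open>N0\<close>.\<close>
  have "big n" if "0 < drop_bit N0 n" for n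
    using that less_exp[of N0] unfolding shift_less_iff by (intro N0) linarith
  then show ?thesis by blast
qed

definition "k0 = (SOME k0. \<forall>n. 0 < drop_bit k0 n \<longrightarrow> big n)"

lemma k0: "0 < drop_bit k0 n \<Longrightarrow> big n"
  using someI_ex[OF ex_k0] unfolding k0_def by blast

text \<open>Limit 5 belongs to the brute-force search. The static bound charges both branches of a
  query, so this limit is set to 0 for large \<open>n\<close>, where the search is never
  run.\<close>

definition limit :: "nat \<Rightarrow> nat \<Rightarrow> nat" where "limit n L = (if L = 0 then (w n + 1) + (kf n + (qf n + repsf n)) else if L = 1 then Mf n else if L = 2 then 2 ^ qf n
  else if L = 3 then 2 ^ ktf n else if L = 4 then 2 ^ qf n * mf n else if L = 5 \<and> drop_bit k0 n = 0 \<or> L = 6 then n else 0)"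
text \<open>Cutting at the largest word makes every limit legal for every \<open>n\<close>; it
  changes nothing where a loop relies on its limit.\<close>

definition lmf :: "nat \<Rightarrow> nat \<Rightarrow> nat" where "lmf n L = min (2 ^ b n - 1) (limit n L)"
definition "ex L = (if L = 1 \<or> L = 4 then 1 - \<alpha> / 3 else if L = 2 then 2 * \<alpha> / 3 else if L = 3 then \<alpha> / 3 else if L = (6::nat) then 1 else 0)"

lemma so_lim: "so (ex L) (\<lambda>n. limit n L)"
proof -
  have q: "2 ^ qf n = 2 ^ ktf n * (2::nat) ^ ktf n" for n
    by (simp only: qf_def mult_2 power_add)
  have "2 * \<alpha> / 3 = \<alpha> / 3 + \<alpha> / 3"
    by simp
  then have l: "so (2 * \<alpha> / 3) (\<lambda>n. 2 ^ qf n)"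
    unfolding q using so_mult[OF so_t so_t] by simp
  have n: "so 1 (\<lambda>n. n)"
    by (rule so_le_real[where c = 1 and k = 0]) (auto intro: eventuallyI)
  have "eventually (\<lambda>n::nat. (if drop_bit k0 n = 0 then n else 0) \<le> 0) at_top"
    by (rule eventually_mono[OF eventually_ge_at_top[of "2 ^ k0"]]) (use shift_less_iff[of k0] in \<open>metis order_refl less_irrefl\<close>)
  then have s: "so 0 (\<lambda>n. if drop_bit k0 n = 0 then n else 0)"
    by (rule so_mono[OF so_const, rotated]) simp
  have z: "so 0 (\<lambda>n. (w n + 1) + (kf n + (qf n + repsf n)))"
    by (intro so_add w so_const so_k so_q so_reps order_refl)
  consider "L = 0" | "L = 1" | "L = 2" | "L = 3" | "L = 4" | "L = 5" | "L = 6" | "L > 6" by linarith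
  then show ?thesis
    by cases (use z so_M l so_t so_lm s n in \<open>simp_all add: limit_def ex_def so_const\<close>)
qed

lemma so_lmf: "so (ex L) (\<lambda>n. lmf n L)"
  by (rule so_mono[OF so_lim]) (simp add: lmf_def)

lemma ex_nonneg: "0 \<le> ex L"
  using \<alpha> by (simp add: ex_def)

lemma degle_SHR: "0 \<le> x \<Longrightarrow> degle E (SHR j) x"
  by (induction j) (simp_all add: SHR_def)

lemma degle_PRE: "degle ex (PRE cf k0) 1"
  by (simp add: PRE_def PREB_def PRES_def KLOOP_def TLOOP_def PRM_def degle_SHR ex_def)

text \<open>The dominant loops are the \<open>2 ^ q * m\<close> chains with \<open>t\<close> steps
  each, of exponents \<open>1 - \<alpha> / 3\<close> and \<open>\<alpha> / 3\<close>.\<close>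

lemma degle_POST: "degle ex POST 1"
  using \<alpha> by (simp add: POST_def BUILD_def SETB_def BB_def BS_def BC_def HV_def HX_def GZ_def STEP_def FMc_def HU_def ex_def)

text \<open>The dominant loops are the \<open>2 ^ q\<close> clusters with \<open>t\<close> steps
  each, of exponents \<open>2 * \<alpha> / 3\<close> and \<open>\<alpha> / 3\<close>.\<close>

lemma degle_QRY: "degle ex QRY \<alpha>"
  using \<alpha> by (simp add: QRY_def QS_def PRM_def MQ_def MQ1_def MQ2_def INV_def SETB_def QB_def QC_def QD_def Q1_def L1_def L2_def LK_def CHK_def
      HV_def HX_def GZ_def STEP_def FMc_def HU_def ex_def)

text \<open>The summands 1 here and 2 in \<open>sf\<close> cover small instances, which draw one
  word and store two.\<close>

definition "tcf n = tb (\<tau> n) (lmf n) (PRE cf k0) + 4 * (repsf n * BLf n + 1) + tb (\<tau> n) (lmf n) POST"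
definition "sf n = totf n + 2"
definition "tqf n = tb (\<tau> n) (lmf n) QRY"

lemma so_tc: "so 1 tcf"
proof -
  have "so 1 (\<lambda>n. repsf n * BLf n)"
    using \<alpha> by (intro so_exp[OF so_0_mult[OF so_reps so_BL]]) simp
  then show ?thesis
    unfolding tcf_def
    by (intro so_add so_0_mult[of "\<lambda>_. 4"] so_const so_tb[OF \<tau> so_lmf ex_nonneg] degle_PRE degle_POST) simp_all
qed

lemma so_s: "so (1 - \<alpha> / 3) sf"
  unfolding sf_def using \<alpha> by (intro so_add so_tot so_const) simp

lemma so_tq: "so \<alpha> tqf"
  unfolding tqf_def by (intro so_tb[OF \<tau> so_lmf ex_nonneg] degle_QRY)

lemma ram: 
  assumes n: "1 \<le> n" and F: "computes_within (b n) F n f (\<tau> n)"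
  shows "ram (b n) n f (as_sub (b n) F) (\<tau> n) (lmf n)"
proof
  show "1 \<le> b n"
    using wl[OF n] n by (cases "b n") auto
  show "lmf n L < 2 ^ b n" for L
    unfolding lmf_def by (simp add: min_less_iff_disj)
  show "\<exists>t\<le>\<tau> n. as_sub (b n) F x = Some (f x, t)" if "x < n" for x
    using as_sub_computes[OF F that] .
qed

lemma env3:
  assumes n: "1 \<le> n" and f: "f ` {..<n} \<subseteq> {..<2 ^ w n}" and F: "computes_within (b n) F n f (\<tau> n)" and big: "big n"
  shows "env3 (b n) n f (as_sub (b n) F) (\<tau> n) (lmf n) (w n) (kf n) (ktf n) (repsf n) (Af n) cf"
    and "prm.BL (w n) (kf n) (ktf n) = BLf n" and "env.tot (w n) (kf n) (ktf n) (repsf n) = totf n"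
proof -
  have B: "9 \<le> ktf n" "3 * ktf n + 1 \<le> kf n" "totf n < 2 ^ b n"
    using big by (auto simp: big_def)
  have reps: "1 \<le> repsf n"
    using B by (simp add: repsf_def)
  have "(w n + 1) * repsf n * DBf n \<le> totf n"
    by (simp add: totf_def)
  moreover have "1 * DBf n \<le> (w n + 1) * repsf n * DBf n"
    using reps by (intro mult_le_mono1) simp
  moreover have "(w n + 1) * repsf n * 1 \<le> (w n + 1) * repsf n * DBf n"
    by (intro mult_le_mono2) (simp add: DBf_def Mf_def Suc_le_eq)
  moreover have "1 * BLf n \<le> repsf n * BLf n" "repsf n * 1 \<le> repsf n * BLf n"
    using reps by (intro mult_le_mono1 mult_le_mono2; simp add: BLf_def)+
  moreover have "repsf n * BLf n + 8 \<le> totf n"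
    by (simp add: totf_def)
  ultimately have sz: "DBf n < 2 ^ b n" "BLf n < 2 ^ b n" "repsf n < 2 ^ b n" "repsf n + 8 < 2 ^ b n"
    using B(3) by linarith+
  have "Mf n < 2 ^ b n" "lEf n < 2 ^ b n"
    using sz(1) by (simp_all add: DBf_def)
  then have mu: "kf n - ktf n + 9 \<le> b n"
    by (simp add: Mf_def)
  have kb: "kf n \<le> b n"
  proof -
    have "(2::nat) ^ (kf n - 1) < 2 ^ b n"
      using kf[OF n] wl[OF n] by linarith
    then show ?thesis
      by simp
  qed
  have prm: "prm (b n) n (kf n) (ktf n)"
    by unfold_locales (use n kf[OF n] kb B mu in auto)
  have eqs: "prm.M (kf n) (ktf n) = Mf n" "prm.q (ktf n) = qf n" "prm.t (ktf n) = 2 ^ ktf n" "prm.m (kf n) (ktf n) = mf n"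
    "prm.K (kf n) (ktf n) = Mf n + mf n" "prm.e (kf n) (ktf n) = kf n - 3 * ktf n + 3"
    by (simp_all add: prm.M_def[OF prm] prm.mu_def[OF prm] prm.q_def[OF prm] prm.t_def[OF prm] prm.m_def[OF prm] prm.K_def[OF prm]
        prm.e_def[OF prm] Mf_def qf_def mf_def)
  show BL: "prm.BL (w n) (kf n) (ktf n) = BLf n"
    by (simp add: prm.BL_def[OF prm] eqs BLf_def)
  have lev: "lev (b n) (w n) n (kf n) (ktf n) f"
    by (intro lev.intro prm lev_axioms.intro) (use f in auto)
  have q: "qf n \<le> BLf n"
  proof -
    have "qf n * 1 \<le> qf n * (Mf n + mf n)"
      by (intro mult_le_mono2) (simp add: Mf_def Suc_le_eq)
    then show ?thesis
      unfolding BLf_def by linarith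
  qed
  have lim0: "limit n 0 < 2 ^ b n"
  proof -
    have "w n + 1 + (kf n + qf n) \<le> BLf n"
    proof -
      have "qf n * 1 \<le> qf n * (Mf n + mf n)"
        by (intro mult_le_mono2) (simp add: Mf_def Suc_le_eq)
      then show ?thesis
        unfolding BLf_def by linarith
    qed
    moreover have "repsf n + BLf n \<le> repsf n * BLf n + 1"
    proof -
      obtain r u where "repsf n = Suc r" "BLf n = Suc u"
        using reps by (metis BLf_def Suc_le_D One_nat_def add_2_eq_Suc' add_Suc_right add_Suc)
      then show ?thesis by simp
    qed
    moreover have "repsf n * BLf n + 8 \<le> totf n"
      by (simp add: totf_def)
    ultimately show ?thesis
      using B(3) unfolding limit_def by simp
  qed
  have l4: "2 ^ qf n * mf n \<le> lEf n" "2 ^ qf n \<le> lEf n" "2 ^ ktf n \<le> lEf n"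
  proof -
    show "2 ^ qf n * mf n \<le> lEf n" "2 ^ qf n \<le> lEf n"
      by (simp_all add: lEf_def mf_def)
    moreover have "(2::nat) ^ ktf n \<le> 2 ^ qf n"
      by (intro power_increasing) (simp_all add: qf_def)
    ultimately show "2 ^ ktf n \<le> lEf n"
      by linarith
  qed
  have big': "drop_bit k0 n = 0 \<Longrightarrow> limit n 5 \<le> n"
    by (simp add: limit_def)
  have lmf: "lmf n 0 = limit n 0" "lmf n 1 = Mf n" "lmf n 2 = 2 ^ qf n" "lmf n 3 = 2 ^ ktf n" "lmf n 4 = 2 ^ qf n * mf n" "lmf n 6 = n"
    using lim0 l4 \<open>Mf n < _\<close> \<open>lEf n < _\<close> wl[OF n] unfolding lmf_def by (auto simp: limit_def min_def)
  have env: "env (b n) n f (as_sub (b n) F) (\<tau> n) (lmf n) (w n) (kf n) (ktf n) (repsf n)"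
    by (intro env.intro ram[OF n F] lev env_axioms.intro) (use wl[OF n] in \<open>simp_all add: lmf lmf[unfolded One_nat_def] eqs\<close>, simp_all add: limit_def)
  show tot: "env.tot (w n) (kf n) (ktf n) (repsf n) = totf n"
    by (simp add: env.tot_def[OF env] env.d0_def[OF env] env.DB_def[OF env] env.lE_def[OF env] eqs BL totf_def DBf_def lEf_def)
  have env2: "env2 (b n) n f (as_sub (b n) F) (\<tau> n) (lmf n) (w n) (kf n) (ktf n) (repsf n)"
    by (intro env2.intro env env2_axioms.intro) (use wl[OF n] B(3) in \<open>simp_all add: tot\<close>)
  show "env3 (b n) n f (as_sub (b n) F) (\<tau> n) (lmf n) (w n) (kf n) (ktf n) (repsf n) (Af n) cf"
    by (intro env3.intro env2 env3_axioms.intro) (use kf[OF n] ktf[OF n] in \<open>simp_all add: repsf_def lmf\<close>)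
qed

lemma success:
  assumes n: "1 \<le> n" and f: "f ` {..<n} \<subseteq> {..<2 ^ w n}" and F: "computes_within (b n) F n f (\<tau> n)"
  shows "1 - 1 / real n powr \<kappa> \<le> success_prob (b n) F (BLD cf k0) (comp 0 QRY) \<alpha> n (w n) f (tcf n) (sf n) (tqf n)"
proof -
  consider "n = 1" | "2 \<le> n" "drop_bit k0 n = 0" | "2 \<le> n" "0 < drop_bit k0 n"
    using n by linarith
  then show ?thesis
  proof cases
    \<comment> \<open>For \<open>n = 1\<close> the claimed lower bound is 0.\<close>
    case 1
    then show ?thesis
      by (simp add: success_prob_def)
  next
    case 2
    have "lmf n 5 = n"
      using 2 wl[OF n] by (auto simp: lmf_def limit_def min_def)
    then have "1 \<le> success_prob (b n) F (BLD cf k0) (comp 0 QRY) \<alpha> n (w n) f (tcf n) (sf n) (tqf n)"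
      using 2 wl[OF n] by (intro ram.success_small[OF ram[OF n F] refl]) (simp_all add: tcf_def sf_def tqf_def)
    then show ?thesis
      by (smt (verit) divide_nonneg_nonneg powr_ge_zero)
  next
    case 3
    note E = env3[OF n f F k0[OF 3(2)]]
    show ?thesis
    proof (rule env3.success_big[OF E(1) refl \<kappa> _ Af_def 3(2)])
      show "\<kappa> \<le> real cf"
        unfolding cf_def by linarith
    qed (simp_all add: E(2,3) tcf_def sf_def tqf_def)
  qed
qed

end

theorem mainTheorem3:
  fixes w b \<tau> :: "nat \<Rightarrow> nat" and \<alpha> \<kappa> :: real
  assumes w_polylog: "(\<lambda>N. real (w N)) \<in> soft_O (\<lambda>_. 1)"
    and word_length_polylog: "(\<lambda>N. real (b N)) \<in> soft_O (\<lambda>_. 1)"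
    and word_length: "\<And>N. N \<ge> 1 \<Longrightarrow> N < 2 ^ b N \<and> w N \<le> b N"
    and eval_time: "(\<lambda>N. real (\<tau> N)) \<in> soft_O (\<lambda>_. 1)"
    and alpha: "0 < \<alpha>" "\<alpha> < 1"
    and kappa: "0 < \<kappa>"
  shows "\<exists>build query. deterministic query \<and>
    (\<exists>tc s tq :: nat \<Rightarrow> nat.
       (\<lambda>N. real (tc N)) \<in> soft_O (\<lambda>N. real N) \<and>
       (\<lambda>N. real (s N)) \<in> soft_O (\<lambda>N. real N powr (1 - \<alpha> / 3)) \<and>
       (\<lambda>N. real (tq N)) \<in> soft_O (\<lambda>N. real N powr \<alpha>) \<and>
       (\<forall>N\<ge>1. \<forall>f F. f ` {..<N} \<subseteq> {..<2 ^ w N} \<longrightarrow> computes_within (b N) F N f (\<tau> N) \<longrightarrow>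
          success_prob (b N) F build query \<alpha> N (w N) f (tc N) (s N) (tq N)
            \<ge> 1 - 1 / real N powr \<kappa>))"
proof -
  interpret asym w b \<tau> \<alpha> \<kappa>
    by unfold_locales (use so_polylog[OF w_polylog] so_polylog[OF eval_time] word_length alpha kappa in auto)
  have "(\<lambda>N. real (tcf N)) \<in> soft_O (\<lambda>N. real N)"
    using so_tc by (simp add: so_def)
  moreover have "(\<lambda>N. real (sf N)) \<in> soft_O (\<lambda>N. real N powr (1 - \<alpha> / 3))"
    using so_s by (simp add: so_def)
  moreover have "(\<lambda>N. real (tqf N)) \<in> soft_O (\<lambda>N. real N powr \<alpha>)"
    using so_tq by (simp add: so_def)
  ultimately show ?thesis
    using success deterministic_comp by blast
qed

end
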